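(* Let $b>0$, let $q:[-b,b]\to\mathbb{C}$ be continuous, and suppose there is a solution $f\in C^2[-b,b]$ of $f''-qf=0$ on $[-b,b]$ with $f(x)\ne0$ for all $x\in[-b,b]$ and $f(0)=1$. Let $k$ be a positive integer and suppose the function $g$ possesses on $[-b,b]$ continuous $f$-derivatives of all orders up to the order $k$. Then for any $n\ge k$ $$\mathcal{E}_n^f(g)\le\frac{\big(\frac{\pi b}{2}\big)^k\,\|\mathbf{T}\|\,\max\{\|\mathbf{T}^{-1}\|,\|\mathbf{T}_D^{-1}\|\}}{(n+1)\,n\cdots(n-k+2)}\,\|d_k^fg\|,$$ and $$\mathcal{E}_n^f(g)=\frac{o(1)}{n^k}\quad\text{as }n\to\infty.$$
   Context: Functions $\varphi_k$: let $\widetilde X^{(0)}\equiv X^{(0)}\equiv1$ and, for $n\ge1$, $\widetilde X^{(n)}(x)=n\int_0^x\widetilde X^{(n-1)}(s)(f^2(s))^{(-1)^{n-1}}ds$, $X^{(n)}(x)=n\int_0^xX^{(n-1)}(s)(f^2(s))^{(-1)^{n}}ds$; set $\varphi_k=fX^{(k)}$ for $k$ odd and $\varphi_k=f\widetilde X^{(k)}$ for $k$ even. Let $\Phi_n$ be the linear span (over $\mathbb{C}$) of $\varphi_0,\ldots,\varphi_n$. For $g\in C[-b,b]$, $\mathcal{E}_n^f(g)=\min_{h_n\in\Phi_n}\|g-h_n\|$, where $\|\cdot\|$ is the uniform norm on $[-b,b]$. $f$-derivatives: $d_0^f[g]=g$ and, for $k\ge1$, $d_k^f[g]=f^{(-1)^{k-1}}\frac{d}{dx}\big(f^{(-1)^k}d_{k-1}^f[g]\big)$,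 whenever this makes sense (so $d_k^f[g]=f\frac{d}{dx}(\frac1f d_{k-1}^f[g])$ for $k$ odd and $d_k^f[g]=\frac1f\frac{d}{dx}(f\,d_{k-1}^f[g])$ for $k$ even); derivatives at $\pm b$ are one-sided. Transmutation operators on $C[-b,b]$: for a continuous potential $Q$ on $[-b,b]$ and $\eta\in\mathbb{C}$, let $H_{Q,\eta}(u,v)$, $|u|+|v|\le b$, be the unique solution of the Goursat problem $\frac{\partial^2H}{\partial u\,\partial v}=Q(u+v)H$, $H(u,0)=\frac{\eta}{2}+\frac12\int_0^uQ(s)\,ds$, $H(0,v)=\frac{\eta}{2}$, and put $\mathbf{K}_{Q,\eta}(x,t)=H_{Q,\eta}\big(\frac{x+t}{2},\frac{x-t}{2}\big)$ for $|x|\le b$, $|t|\le b$. Then $\mathbf{T}u(x)=u(x)+\int_{-x}^{x}\mathbf{K}_{q,f'(0)}(x,t)u(t)\,dt$, and $\mathbf{T}_Du(x)=u(x)+\int_{-x}^{x}\mathbf{K}_{q_D,-f'(0)}(x,t)u(t)\,dt$ with $q_D=-q+2(f'/f)^2$. Both are bounded invertible operators on $C[-b,b]$ with bounded inverses; $\mathbf{T}$ maps $x^k$ to $\varphi_k$ and $\mathbf{T}_D$ maps $x^k$ to $\psi_k$ for every $k\ge0$, where $\psi_k=\widetilde X^{(k)}/f$ for $k$ odd and $\psi_k=X^{(k)}/f$ for $k$ even. $\|\mathbf{T}\|$, $\|\mathbf{T}^{-1}\|$, $\|\mathbf{T}_D^{-1}\|$ denote operator norms on $C[-b,b]$ with the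 uniform norm. *)

theory Defs
  imports "HOL-Analysis.Analysis" "HOL-Library.Landau_Symbols"
begin

text \<open>Functions on \<open>[-b,b]\<close> are total functions \<open>real \<Rightarrow> complex\<close> of which only the values on
  \<open>[-b,b]\<close> matter; \<open>C_space b\<close> picks one representative of each element of \<open>C[-b,b]\<close>.\<close>

definition C_space :: "real \<Rightarrow> (real \<Rightarrow> complex) set" where
  "C_space b = {u \<in> extensional {-b..b}. continuous_on {-b..b} u}"

definition unorm :: "real \<Rightarrow> (real \<Rightarrow> complex) \<Rightarrow> real" where
  "unorm b u = (SUP x\<in>{-b..b}. norm (u x))"

definition opnorm :: "real \<Rightarrow> ((real \<Rightarrow> complex) \<Rightarrow> real \<Rightarrow> complex) \<Rightarrow> real" where
  "opnorm b A = (SUP u\<in>{u \<in> C_space b. unorm b u \<le> 1}. unorm b (A u))"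

text \<open>Taking the derivative within \<open>[-b,b]\<close> makes it one-sided at the end points.\<close>

definition D_on :: "real \<Rightarrow> (real \<Rightarrow> complex) \<Rightarrow> real \<Rightarrow> complex" where
  "D_on b u x = vector_derivative u (at x within {-b..b})"

definition C2_on :: "real \<Rightarrow> (real \<Rightarrow> complex) \<Rightarrow> bool" where
  "C2_on b u \<longleftrightarrow> u differentiable_on {-b..b} \<and> D_on b u differentiable_on {-b..b} \<and>
     continuous_on {-b..b} (D_on b (D_on b u))"

text \<open>The integrals \<open>LBINT s=0..x\<close> are oriented, so \<open>x < 0\<close> is covered.\<close>

primrec Xtilde :: "(real \<Rightarrow> complex) \<Rightarrow> nat \<Rightarrow> real \<Rightarrow> complex" where
  "Xtilde f 0 = (\<lambda>x. 1)"
| "Xtilde f (Suc n) = (\<lambda>x. of_nat (Suc n) *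
     (LBINT s=ereal 0..ereal x. Xtilde f n s * ((f s)\<^sup>2) powi ((-1) ^ n)))"

primrec X :: "(real \<Rightarrow> complex) \<Rightarrow> nat \<Rightarrow> real \<Rightarrow> complex" where
  "X f 0 = (\<lambda>x. 1)"
| "X f (Suc n) = (\<lambda>x. of_nat (Suc n) *
     (LBINT s=ereal 0..ereal x. X f n s * ((f s)\<^sup>2) powi ((-1) ^ Suc n)))"

definition phi :: "(real \<Rightarrow> complex) \<Rightarrow> nat \<Rightarrow> real \<Rightarrow> complex" where
  "phi f k x = f x * (if odd k then X f k x else Xtilde f k x)"

definition Phi :: "(real \<Rightarrow> complex) \<Rightarrow> nat \<Rightarrow> (real \<Rightarrow> complex) set" where
  "Phi f n = range (\<lambda>c x. \<Sum>k\<le>n. c k * phi f k x)"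

text \<open>The infimum is a minimum; see \<open>best_approx_attained\<close> below.\<close>

definition best_approx :: "real \<Rightarrow> (real \<Rightarrow> complex) \<Rightarrow> nat \<Rightarrow> (real \<Rightarrow> complex) \<Rightarrow> real" where
  "best_approx b f n g = (INF h\<in>Phi f n. unorm b (\<lambda>x. g x - h x))"

primrec f_deriv ::
  "real \<Rightarrow> (real \<Rightarrow> complex) \<Rightarrow> nat \<Rightarrow> (real \<Rightarrow> complex) \<Rightarrow> real \<Rightarrow> complex" where
  "f_deriv b f 0 g = g"
| "f_deriv b f (Suc j) g = (\<lambda>x. f x powi ((-1) ^ j) *
     D_on b (\<lambda>s. f s powi ((-1) ^ Suc j) * f_deriv b f j g s) x)"

definition has_continuous_f_derivs ::
  "real \<Rightarrow> (real \<Rightarrow> complex) \<Rightarrow> nat \<Rightarrow> (real \<Rightarrow> complex) \<Rightarrow> bool" where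
  "has_continuous_f_derivs b f k g \<longleftrightarrow>
     (\<forall>j<k. (\<lambda>s. f s powi ((-1) ^ Suc j) * f_deriv b f j g s) differentiable_on {-b..b}) \<and>
     (\<forall>j\<le>k. continuous_on {-b..b} (f_deriv b f j g))"

definition diamond :: "real \<Rightarrow> (real \<times> real) set" where
  "diamond b = {(u, v). \<bar>u\<bar> + \<bar>v\<bar> \<le> b}"

text \<open>Since the potential is merely continuous, \<open>H\<close> is not required to be twice differentiable:
  the equation is read as \<open>\<partial>/\<partial>u (\<partial>H/\<partial>v) = Q(u+v) H\<close>, with \<open>Hv\<close> in the role of \<open>\<partial>H/\<partial>v\<close>.
  Derivatives are taken within the sections of the closed diamond, hence one-sided on its boundary.
  Extensionality makes uniqueness on the diamond uniqueness of a total function.\<close>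

definition goursat_solution ::
  "real \<Rightarrow> (real \<Rightarrow> complex) \<Rightarrow> complex \<Rightarrow> (real \<times> real \<Rightarrow> complex) \<Rightarrow> bool" where
  "goursat_solution b Q \<eta> H \<longleftrightarrow>
     H \<in> extensional (diamond b) \<and> continuous_on (diamond b) H \<and>
     (\<exists>Hv. \<forall>(u, v)\<in>diamond b.
        ((\<lambda>t. H (u, t)) has_vector_derivative Hv (u, v)) (at v within {t. (u, t) \<in> diamond b}) \<and>
        ((\<lambda>s. Hv (s, v)) has_vector_derivative Q (u + v) * H (u, v))
          (at u within {s. (s, v) \<in> diamond b})) \<and>
     (\<forall>u\<in>{-b..b}. H (u, 0) = \<eta> / 2 + (LBINT s=ereal 0..ereal u. Q s) / 2) \<and>
     (\<forall>v\<in>{-b..b}. H (0, v) = \<eta> / 2)"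

definition goursat_H :: "real \<Rightarrow> (real \<Rightarrow> complex) \<Rightarrow> complex \<Rightarrow> real \<times> real \<Rightarrow> complex" where
  "goursat_H b Q \<eta> = (THE H. goursat_solution b Q \<eta> H)"

definition trans_kernel ::
  "real \<Rightarrow> (real \<Rightarrow> complex) \<Rightarrow> complex \<Rightarrow> real \<Rightarrow> real \<Rightarrow> complex" where
  "trans_kernel b Q \<eta> x t = goursat_H b Q \<eta> ((x + t) / 2, (x - t) / 2)"

definition trans_op ::
  "real \<Rightarrow> (real \<Rightarrow> complex) \<Rightarrow> complex \<Rightarrow> (real \<Rightarrow> complex) \<Rightarrow> real \<Rightarrow> complex" where
  "trans_op b Q \<eta> u = (\<lambda>x\<in>{-b..b}.
     u x + (LBINT t=ereal (-x)..ereal x. trans_kernel b Q \<eta> x t * u t))"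

definition T_op ::
  "real \<Rightarrow> (real \<Rightarrow> complex) \<Rightarrow> (real \<Rightarrow> complex) \<Rightarrow> (real \<Rightarrow> complex) \<Rightarrow> real \<Rightarrow> complex" where
  "T_op b q f = trans_op b q (D_on b f 0)"

definition T_D_op ::
  "real \<Rightarrow> (real \<Rightarrow> complex) \<Rightarrow> (real \<Rightarrow> complex) \<Rightarrow> (real \<Rightarrow> complex) \<Rightarrow> real \<Rightarrow> complex" where
  "T_D_op b q f = trans_op b (\<lambda>x. - q x + 2 * (D_on b f x / f x)\<^sup>2) (- D_on b f 0)"

definition op_inv ::
  "real \<Rightarrow> ((real \<Rightarrow> complex) \<Rightarrow> real \<Rightarrow> complex) \<Rightarrow> (real \<Rightarrow> complex) \<Rightarrow> real \<Rightarrow> complex" where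
  "op_inv b A = inv_into (C_space b) A"

lemma unorm_upper:
  assumes "continuous_on {-b..b} u" "x \<in> {-b..b}"
  shows "norm (u x) \<le> unorm b u"
proof -
  have "compact ((\<lambda>x. norm (u x)) ` {-b..b})"
    by (intro compact_continuous_image continuous_intros assms) simp
  then show ?thesis
    unfolding unorm_def using assms(2)
    by (intro cSUP_upper) (auto dest: compact_imp_bounded bounded_imp_bdd_above)
qed

lemma unorm_least:
  assumes "0 < b" "\<And>x. x \<in> {-b..b} \<Longrightarrow> norm (u x) \<le> M"
  shows "unorm b u \<le> M"
  unfolding unorm_def using assms by (intro cSUP_least) auto

lemma unorm_nonneg: "0 < b \<Longrightarrow> continuous_on {-b..b} u \<Longrightarrow> 0 \<le> unorm b u"
  using unorm_upper[of b u 0] norm_ge_zero[of "u 0"] by (auto intro: order_trans simp del: norm_ge_zero)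

lemma unorm_add_le:
  assumes "0 < b" "continuous_on {-b..b} u" "continuous_on {-b..b} v"
  shows "unorm b (\<lambda>x. u x + v x) \<le> unorm b u + unorm b v"
  by (rule unorm_least[OF assms(1)])
     (blast intro: order_trans[OF norm_triangle_ineq] add_mono unorm_upper assms)

lemma unorm_cmult_le:
  assumes "0 < b" "continuous_on {-b..b} u"
  shows "unorm b (\<lambda>x. c * u x) \<le> norm c * unorm b u"
  by (rule unorm_least[OF assms(1)])
     (auto simp: norm_mult intro!: mult_left_mono unorm_upper assms)

lemma finite_span_proximinal:
  fixes p :: "nat \<Rightarrow> real \<Rightarrow> complex"
  assumes b: "0 < b" and p: "\<And>k. continuous_on {-b..b} (p k)"
    and g: "continuous_on {-b..b} g"
  shows "\<exists>c. \<forall>d. unorm b (\<lambda>x. g x - (\<Sum>k<n. c k * p k x))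
                  \<le> unorm b (\<lambda>x. g x - (\<Sum>k<n. d k * p k x))"
  using g
proof (induction n arbitrary: g)
  case 0
  then show ?case by simp
next
  case (Suc n)
  define S where "S d x = (\<Sum>k<n. d k * p k x)" for d x
  have cS: "continuous_on {-b..b} (S d)" for d
    unfolding S_def by (intro continuous_intros p)
  have ex: "\<exists>c. \<forall>d. unorm b (\<lambda>x. u x - S c x) \<le> unorm b (\<lambda>x. u x - S d x)"
    if "continuous_on {-b..b} u" for u
    using Suc.IH[OF that] by (simp add: S_def)
  define best where "best u = (SOME c. \<forall>d. unorm b (\<lambda>x. u x - S c x) \<le> unorm b (\<lambda>x. u x - S d x))" for u
  have best: "unorm b (\<lambda>x. u x - S (best u) x) \<le> unorm b (\<lambda>x. u x - S d x)"
    if "continuous_on {-b..b} u" for u d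
    using someI_ex[OF ex[OF that]] unfolding best_def by blast
  define N where "N u = unorm b (\<lambda>x. u x - S (best u) x)" for u
  have N: "N u \<le> unorm b (\<lambda>x. u x - S d x)" if "continuous_on {-b..b} u" for u d
    using best[OF that] by (simp add: N_def)
  have Nadd: "N (\<lambda>x. u x + v x) \<le> N u + unorm b v"
    if u: "continuous_on {-b..b} u" and v: "continuous_on {-b..b} v" for u v
  proof -
    have "N (\<lambda>x. u x + v x) \<le> unorm b (\<lambda>x. (u x + v x) - S (best u) x)"
      by (intro N continuous_intros u v)
    also have "\<dots> = unorm b (\<lambda>x. (u x - S (best u) x) + v x)" by (simp add: algebra_simps)
    also have "\<dots> \<le> N u + unorm b v"
      unfolding N_def by (intro unorm_add_le b continuous_intros u v cS)
    finally show ?thesis .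
  qed
  have Nscale: "norm c * N u \<le> N (\<lambda>x. c * u x)"
    if u: "continuous_on {-b..b} u" for c u
  proof (cases "c = 0")
    case True
    then show ?thesis unfolding N_def
      by (auto intro!: unorm_nonneg b continuous_intros cS)
  next
    case False
    define d where "d = best (\<lambda>x. c * u x)"
    have S_eq: "S (\<lambda>k. d k / c) x = S d x / c" for x
      by (simp add: S_def sum_divide_distrib)
    have "N u \<le> unorm b (\<lambda>x. u x - S (\<lambda>k. d k / c) x)" by (rule N[OF u])
    also have "\<dots> = unorm b (\<lambda>x. inverse c * (c * u x - S d x))"
      using False by (simp add: S_eq field_simps)
    also have "\<dots> \<le> norm (inverse c) * N (\<lambda>x. c * u x)"
      unfolding N_def d_def by (intro unorm_cmult_le b continuous_intros u cS)
    finally have "N u \<le> norm (inverse c) * N (\<lambda>x. c * u x)" .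
    then have "norm c * N u \<le> norm c * (norm (inverse c) * N (\<lambda>x. c * u x))"
      by (rule mult_left_mono) simp
    also have "\<dots> = (norm c * norm (inverse c)) * N (\<lambda>x. c * u x)"
      by (simp only: mult.assoc)
    also have "norm c * norm (inverse c) = 1"
      using False by (simp add: norm_inverse)
    finally show ?thesis by simp
  qed
  define F where "F z = N (\<lambda>x. g x - z * p n x)" for z
  have cu: "continuous_on {-b..b} (\<lambda>x. g x - z * p n x)" for z
    by (intro continuous_intros Suc.prems p)
  have F_Lip: "F z \<le> F w + norm (z - w) * unorm b (p n)" for z w
  proof -
    have "F z = N (\<lambda>x. (g x - w * p n x) + (w - z) * p n x)"
      by (simp add: F_def algebra_simps)
    also have "\<dots> \<le> F w + unorm b (\<lambda>x. (w - z) * p n x)"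
      unfolding F_def by (intro Nadd cu continuous_intros p)
    also have "unorm b (\<lambda>x. (w - z) * p n x) \<le> norm (w - z) * unorm b (p n)"
      by (intro unorm_cmult_le b p)
    finally show ?thesis by (simp add: norm_minus_commute)
  qed
  have cF: "continuous_on UNIV F"
  proof -
    have "(unorm b (p n))-lipschitz_on UNIV F"
    proof (rule lipschitz_onI)
      show "dist (F z) (F w) \<le> unorm b (p n) * dist z w" for z w
        using F_Lip[of z w] F_Lip[of w z]
        by (simp add: dist_norm norm_minus_commute abs_le_iff algebra_simps)
    qed (intro unorm_nonneg b p)
    then show ?thesis by (rule lipschitz_on_continuous_on)
  qed
  have "\<exists>z. \<forall>w. F z \<le> F w"
  proof (cases "N (p n) = 0")
    case True
    define e where "e = best (p n)"
    have "F 0 \<le> F w" for w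
    proof -
      define d where "d = best (\<lambda>x. g x - w * p n x)"
      have S_eq: "S (\<lambda>k. d k + w * e k) x = S d x + w * S e x" for x
        by (simp add: S_def sum.distrib sum_distrib_left algebra_simps)
      have "F 0 \<le> unorm b (\<lambda>x. g x - S (\<lambda>k. d k + w * e k) x)"
        using N[OF Suc.prems] by (simp add: F_def)
      also have "\<dots> = unorm b (\<lambda>x. (g x - w * p n x - S d x) + w * (p n x - S e x))"
        by (simp add: S_eq algebra_simps)
      also have "\<dots> \<le> F w + unorm b (\<lambda>x. w * (p n x - S e x))"
        unfolding F_def N_def d_def by (intro unorm_add_le b continuous_intros cu cS p Suc.prems)
      also have "unorm b (\<lambda>x. w * (p n x - S e x)) \<le> norm w * N (p n)"
        unfolding e_def N_def by (intro unorm_cmult_le b continuous_intros cS p)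
      finally show ?thesis using True by simp
    qed
    then show ?thesis by blast
  next
    case False
    moreover have "0 \<le> N (p n)"
      unfolding N_def by (intro unorm_nonneg b continuous_intros cS p)
    ultimately have pos: "0 < N (p n)" by simp
    have coerc: "norm w * N (p n) \<le> F w + unorm b g" for w
    proof -
      have "norm w * N (p n) = norm (- w) * N (p n)" by simp
      also have "\<dots> \<le> N (\<lambda>x. - w * p n x)" by (rule Nscale[OF p])
      also have "\<dots> = N (\<lambda>x. (g x - w * p n x) + (- 1) * g x)" by simp
      also have "\<dots> \<le> F w + unorm b (\<lambda>x. (- 1) * g x)"
        unfolding F_def by (intro Nadd cu continuous_intros Suc.prems)
      also have "unorm b (\<lambda>x. (- 1) * g x) \<le> norm (- 1 :: complex) * unorm b g"
        by (intro unorm_cmult_le b Suc.prems)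
      finally show ?thesis by simp
    qed
    define R where "R = (F 0 + unorm b g) / N (p n)"
    have "0 \<le> R"
      using coerc[of 0] pos by (simp add: R_def)
    then obtain z where z: "\<And>w. w \<in> cball 0 R \<Longrightarrow> F z \<le> F w"
      using continuous_attains_inf[of "cball 0 R" F] continuous_on_subset[OF cF subset_UNIV]
      by (metis centre_in_cball compact_cball empty_iff)
    have "F z \<le> F w" for w
    proof (cases "w \<in> cball 0 R")
      case False
      then have "R * N (p n) < norm w * N (p n)" using pos by simp
      then have "F 0 < F w" using coerc[of w] pos by (simp add: R_def)
      moreover have "F z \<le> F 0" using z[of 0] \<open>0 \<le> R\<close> by simp
      ultimately show ?thesis by simp
    qed (rule z)
    then show ?thesis by blast
  qed
  then obtain z where z: "\<And>w. F z \<le> F w" by blast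
  define c where "c = (best (\<lambda>x. g x - z * p n x))(n := z)"
  have Sc: "S c x = S (best (\<lambda>x. g x - z * p n x)) x" for x
    unfolding S_def c_def by (intro sum.cong) auto
  have split: "(\<Sum>k<Suc n. d k * p k x) = S d x + d n * p n x" for d x
    by (simp add: S_def)
  show ?case
  proof (intro exI[of _ c] allI)
    fix d
    have "unorm b (\<lambda>x. g x - (\<Sum>k<Suc n. c k * p k x)) = F z"
      unfolding split Sc by (simp add: F_def N_def c_def algebra_simps)
    also have "\<dots> \<le> F (d n)" by (rule z)
    also have "\<dots> \<le> unorm b (\<lambda>x. (g x - d n * p n x) - S d x)"
      unfolding F_def by (rule N[OF cu])
    also have "\<dots> = unorm b (\<lambda>x. g x - (\<Sum>k<Suc n. d k * p k x))"
      unfolding split by (simp add: algebra_simps)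
    finally show "unorm b (\<lambda>x. g x - (\<Sum>k<Suc n. c k * p k x))
      \<le> unorm b (\<lambda>x. g x - (\<Sum>k<Suc n. d k * p k x))" .
  qed
qed

lemma continuous_on_LBINT:
  fixes h :: "real \<Rightarrow> complex"
  assumes b: "0 < b" and h: "continuous_on {-b..b} h"
  shows "continuous_on {-b..b} (\<lambda>x. LBINT s=ereal 0..ereal x. h s)"
proof (rule continuous_on_vector_derivative)
  fix x assume "x \<in> {-b..b}"
  then show "((\<lambda>x. LBINT s=ereal 0..ereal x. h s) has_vector_derivative h x) (at x within {-b..b})"
    using b h by (intro interval_integral_FTC2) auto
qed

lemma continuous_on_phi:
  assumes b: "0 < b" and f: "continuous_on {-b..b} f" "\<And>x. x \<in> {-b..b} \<Longrightarrow> f x \<noteq> 0"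
  shows "continuous_on {-b..b} (phi f k)"
proof -
  have "continuous_on {-b..b} (Xtilde f n)" for n
  proof (induction n)
    case (Suc n)
    then show ?case
      using f(2) by (fastforce intro!: continuous_intros continuous_on_LBINT b f(1))
  qed simp
  moreover have "continuous_on {-b..b} (X f n)" for n
  proof (induction n)
    case (Suc n)
    then show ?case
      using f(2) by (fastforce intro!: continuous_intros continuous_on_LBINT b f(1))
  qed simp
  ultimately show ?thesis
    unfolding phi_def[abs_def] by (cases "odd k") (auto intro!: continuous_intros f)
qed

lemma best_approx_attained:
  assumes "0 < b" "continuous_on {-b..b} f" "\<And>x. x \<in> {-b..b} \<Longrightarrow> f x \<noteq> 0"
    and "continuous_on {-b..b} g"
  shows "\<exists>h\<in>Phi f n. best_approx b f n g = unorm b (\<lambda>x. g x - h x) \<and>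
           (\<forall>h'\<in>Phi f n. unorm b (\<lambda>x. g x - h x) \<le> unorm b (\<lambda>x. g x - h' x))"
proof -
  obtain c where c: "\<And>d. unorm b (\<lambda>x. g x - (\<Sum>k<Suc n. c k * phi f k x))
      \<le> unorm b (\<lambda>x. g x - (\<Sum>k<Suc n. d k * phi f k x))"
    using finite_span_proximinal[of b "phi f" g "Suc n"] continuous_on_phi assms by blast
  define h where "h = (\<lambda>x. \<Sum>k\<le>n. c k * phi f k x)"
  have h: "h \<in> Phi f n" by (auto simp: h_def Phi_def)
  have le: "unorm b (\<lambda>x. g x - h x) \<le> unorm b (\<lambda>x. g x - h' x)" if "h' \<in> Phi f n" for h'
    using that c by (auto simp: h_def Phi_def lessThan_Suc_atMost)
  have "best_approx b f n g = unorm b (\<lambda>x. g x - h x)"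
    unfolding best_approx_def by (rule cInf_eq_minimum) (use h le in auto)
  with h le show ?thesis by blast
qed

end

theory Submission
  imports Defs "HOL-Computational_Algebra.Polynomial"
begin

text \<open>
  The transmutation operator \<open>T\<close> carries the powers \<open>x^k\<close> to the functions \<open>\<phi>_k\<close>. Hence, if \<open>p\<close> is
  a polynomial of degree at most \<open>n\<close> close to \<open>T^{-1} g\<close>, then \<open>T p\<close> lies in \<open>\<Phi>_n\<close> and is close to
  \<open>T (T^{-1} g) = g\<close>, up to the factor \<open>\<parallel>T\<parallel>\<close> (\<open>best_approx_le\<close>). What remains is the classical theorem of
  Jackson for \<open>T^{-1} g\<close>, provided that its derivatives are known in terms of \<open>g\<close>.

  Everything about \<open>T\<close> rests on one observation. With \<open>a = f'/f\<close> the two potentials are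
  \<open>q = a\<^sup>2 + a'\<close> and \<open>q_D = a\<^sup>2 - a'\<close>, and both Goursat problems are solved by one first order system,
  \<open>S_u = a(u+v) D\<close>, \<open>D_v = a(u+v) S\<close>, \<open>S(0,v) = 0\<close>, \<open>D(u,0) = a(u)\<close>:
  the function \<open>(S + D)/2\<close> is the solution for \<open>q\<close> and \<open>(S - D)/2\<close> the one for \<open>q_D\<close>. Replacing
  \<open>f, a, D\<close> by \<open>1/f, -a, -D\<close> exchanges the two problems, so that each statement about \<open>T\<close> is also one
  about \<open>T_D\<close>. An integration by parts along the segment \<open>u + v = x\<close>
  gives the intertwining relation \<open>(d/dx - a) T u = T_D u'\<close> (\<open>T_has_vector_derivative\<close>), that is
  \<open>f d/dx (T u / f) = T_D u'\<close>. Only continuity of \<open>q\<close> is involved, because \<open>S\<close> and \<open>D\<close> are once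
  differentiable. Applied alternately to \<open>T\<close> and \<open>T_D\<close>, the relation proves
  \<open>T x^k = \<phi>_k\<close> by induction (\<open>T_monomial\<close>), and, read backwards, it shows
  that the derivative of \<open>T^{-1} g\<close> is \<open>T_D^{-1} (d_1 g)\<close> (\<open>op_inv_has_vector_derivative\<close>). Thus the \<open>k\<close>-th
  derivative of \<open>T^{-1} g\<close> is \<open>T^{-1} (d_k g)\<close> or \<open>T_D^{-1} (d_k g)\<close> according to the parity of \<open>k\<close>,
  which is where the maximum of the two norms comes from. The Goursat problem and
  the invertibility of \<open>T\<close> are both handled by successive approximation for Volterra equations.

  In Jackson's theorem the sharp constant matters: \<open>E_n(u) \<le> (\<pi> b / 2) / (n + 1) E_{n-1}(u')\<close>,
  to be used \<open>k\<close> times. Substituting \<open>x = b cos \<theta>\<close>, this becomes the inequality of Favard for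
  trigonometric polynomials, and that one follows from the best approximation in the mean of the
  sawtooth \<open>(\<pi> - x)/2\<close> by sine polynomials of degree less than \<open>N = n + 1\<close>. The sine
  polynomial that interpolates the sawtooth at the zeros of \<open>sin (N x)\<close> has an error with exactly the sign of
  \<open>sin (N x)\<close> (\<open>sawtooth_interpolation\<close>), and the sign function of \<open>sin (N x)\<close> is orthogonal to
  \<open>sin (k x)\<close> for \<open>k < N\<close>; so the mean error can be evaluated exactly (\<open>sawtooth_L1\<close>). The
  \<open>o(1)\<close> comes from stopping the iteration at \<open>E_{n-k}\<close> of the \<open>k\<close>-th derivative, which tends to
  zero by the theorem of Weierstrass.
\<close>

section \<open>Oriented primitives and differentiation under the integral\<close>

lemma deriv_growth_nonneg:
  fixes h h' :: "real \<Rightarrow> complex"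
  assumes u: "0 \<le> u"
    and d: "\<And>s. s \<in> {0..u} \<Longrightarrow> (h has_vector_derivative h' s) (at s within {0..u})"
    and h0: "h 0 = 0"
    and bd: "\<And>s. s \<in> {0..u} \<Longrightarrow> norm (h' s) \<le> C * \<bar>s\<bar> ^ n"
  shows "norm (h u) \<le> C * \<bar>u\<bar> ^ Suc n / Suc n"
proof -
  have i1: "(h' has_integral (h u - h 0)) {0..u}"
    by (rule fundamental_theorem_of_calculus) (use u d in auto)
  have "((\<lambda>s. C * s ^ Suc n / Suc n) has_vector_derivative C * s ^ n) (at s within {0..u})" for s
    by (auto intro!: derivative_eq_intros simp flip: has_real_derivative_iff_has_vector_derivative
        simp del: power_Suc)
  then have i2: "((\<lambda>s. C * s ^ n) has_integral (C * u ^ Suc n / Suc n - C * 0 ^ Suc n / Suc n)) {0..u}"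
    using u by (intro fundamental_theorem_of_calculus) auto
  have "norm (integral {0..u} h') \<le> integral {0..u} (\<lambda>s. C * s ^ n)"
    by (rule integral_norm_bound_integral) (use i1 i2 bd in \<open>auto simp: integrable_on_def abs_of_nonneg\<close>)
  also have "integral {0..u} h' = h u" using i1 h0 by (simp add: integral_unique)
  also have "integral {0..u} (\<lambda>s. C * s ^ n) = C * \<bar>u\<bar> ^ Suc n / Suc n"
    using integral_unique[OF i2] u by simp
  finally show ?thesis .
qed

text \<open>Integration raises the power by one and divides by it. Repeated application produces the
  factorials on which all convergence and uniqueness arguments below depend.\<close>

lemma deriv_growth:
  fixes h h' :: "real \<Rightarrow> complex"
  assumes d: "\<And>s. s \<in> closed_segment 0 u \<Longrightarrow>
      (h has_vector_derivative h' s) (at s within closed_segment 0 u)"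
    and h0: "h 0 = 0"
    and bd: "\<And>s. s \<in> closed_segment 0 u \<Longrightarrow> norm (h' s) \<le> C * \<bar>s\<bar> ^ n"
  shows "norm (h u) \<le> C * \<bar>u\<bar> ^ Suc n / Suc n"
proof (cases "0 \<le> u")
  case True
  then show ?thesis using assms deriv_growth_nonneg[of u h h' C n]
    by (simp add: closed_segment_eq_real_ivl)
next
  case False
  then have seg: "closed_segment 0 u = {u..0}" by (simp add: closed_segment_eq_real_ivl)
  have img: "uminus ` {0..- u} = {u..0::real}" by simp
  have "((\<lambda>s. h (- s)) has_vector_derivative - h' (- s)) (at s within {0..- u})"
    if "s \<in> {0..- u}" for s
  proof -
    have "(h has_vector_derivative h' (- s)) (at (- s) within uminus ` {0..- u})"
      using d[of "- s"] that unfolding seg img by auto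
    then have "((h \<circ> uminus) has_vector_derivative (- 1) *\<^sub>R h' (- s)) (at s within {0..- u})"
      by (intro vector_diff_chain_within) (auto intro!: derivative_eq_intros)
    then show ?thesis by (simp add: o_def)
  qed
  moreover have "norm (- h' (- s)) \<le> C * \<bar>s\<bar> ^ n" if "s \<in> {0..- u}" for s
    using bd[of "- s"] that unfolding seg by simp
  ultimately have "norm (h (- (- u))) \<le> C * \<bar>- u\<bar> ^ Suc n / Suc n"
    using False h0
    by (intro deriv_growth_nonneg[where h = "\<lambda>s. h (- s)" and h' = "\<lambda>s. - h' (- s)"]) simp_all
  then show ?thesis by simp
qed

text \<open>The oriented integral of \<open>\<phi>\<close> from \<open>0\<close> to \<open>x\<close>. The fixed domain \<open>[0,1]\<close> avoids
  a case distinction on the sign of \<open>x\<close> and makes the dependence on parameters a matter of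
  the standard theorems on parameter integrals.\<close>

definition prim :: "(real \<Rightarrow> complex) \<Rightarrow> real \<Rightarrow> complex" where
  "prim \<phi> x = of_real x * integral {0..1} (\<lambda>\<tau>. \<phi> (x * \<tau>))"

lemma prim_0 [simp]: "prim \<phi> 0 = 0"
  by (simp add: prim_def)

lemma prim_zero [simp]: "prim (\<lambda>s. 0) x = 0"
  by (simp add: prim_def)

lemma prim_cong:
  assumes "\<And>s. s \<in> closed_segment 0 x \<Longrightarrow> \<phi> s = \<psi> s"
  shows "prim \<phi> x = prim \<psi> x"
proof -
  have "x * \<tau> \<in> closed_segment 0 x" if "\<tau> \<in> {0..1}" for \<tau>
    using that by (auto simp: in_segment mult.commute intro!: exI[of _ \<tau>])
  then show ?thesis unfolding prim_def using assms by (auto intro!: integral_cong)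
qed

lemma has_vector_derivative_prim:
  assumes c: "continuous_on UNIV \<phi>"
  shows "(prim \<phi> has_vector_derivative \<phi> x) (at x within S)"
proof -
  define r where "r = \<bar>x\<bar> + 1"
  obtain G where G: "\<And>y. y \<in> {-r..r} \<Longrightarrow> (G has_vector_derivative \<phi> y) (at y within {-r..r})"
    using antiderivative_continuous[of "-r" r \<phi>] continuous_on_subset[OF c] by auto
  have eq: "prim \<phi> y = G y - G 0" if y: "y \<in> {-r..r}" for y
  proof -
    have "((\<lambda>\<tau>. y *\<^sub>R \<phi> (y * \<tau>)) has_integral ((G \<circ> (\<lambda>\<tau>. y * \<tau>)) 1 - (G \<circ> (\<lambda>\<tau>. y * \<tau>)) 0)) {0..1}"
    proof (rule fundamental_theorem_of_calculus)
      fix \<tau> :: real assume \<tau>: "\<tau> \<in> {0..1}"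
      have ab: "\<bar>y * t\<bar> \<le> r" if "t \<in> {0..1}" for t
      proof -
        have "\<bar>y\<bar> * \<bar>t\<bar> \<le> r * 1" by (rule mult_mono) (use y that in auto)
        then show ?thesis by (simp add: abs_mult)
      qed
      have sub: "(\<lambda>\<tau>. y * \<tau>) ` {0..1} \<subseteq> {-r..r}"
      proof clarify
        fix t :: real assume "t \<in> {0..1}"
        from ab[OF this] show "y * t \<in> {-r..r}" by (simp add: abs_le_iff)
      qed
      have "(G has_vector_derivative \<phi> (y * \<tau>)) (at (y * \<tau>) within (\<lambda>\<tau>. y * \<tau>) ` {0..1})"
        by (rule has_vector_derivative_within_subset[OF G sub]) (use sub \<tau> in blast)
      then show "(G \<circ> (\<lambda>\<tau>. y * \<tau>) has_vector_derivative y *\<^sub>R \<phi> (y * \<tau>)) (at \<tau> within {0..1})"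
        by (intro vector_diff_chain_within) (auto intro!: derivative_eq_intros
            simp flip: has_real_derivative_iff_has_vector_derivative)
    qed simp
    from integral_unique[OF this] show ?thesis by (simp add: prim_def scaleR_conv_of_real)
  qed
  have xr: "x \<in> {-r..r}" by (auto simp: r_def)
  have "((\<lambda>y. G y - G 0) has_vector_derivative \<phi> x) (at x within {-r..r})"
    using has_vector_derivative_diff[OF G[OF xr] has_vector_derivative_const[of "G 0"]] by simp
  then have "(prim \<phi> has_vector_derivative \<phi> x) (at x within {-r..r})"
    by (rule has_vector_derivative_transform[rotated 2]) (auto simp: eq r_def)
  moreover have "at x within {-r..r} = at x"
    by (rule at_within_interior) (auto simp: r_def)
  ultimately show ?thesis by (auto intro: has_vector_derivative_at_within)
qed

lemma prim_add:
  assumes "continuous_on UNIV \<phi>" "continuous_on UNIV \<psi>"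
  shows "prim (\<lambda>s. \<phi> s + \<psi> s) x = prim \<phi> x + prim \<psi> x"
proof -
  have c: "continuous_on {0..1} (\<lambda>\<tau>. \<phi> (x * \<tau>))" if "continuous_on UNIV \<phi>" for \<phi> :: "real \<Rightarrow> complex"
    by (intro continuous_on_compose2[OF that] continuous_intros) auto
  show ?thesis
    unfolding prim_def
    by (subst integral_add) (auto intro!: integrable_continuous_real c assms simp: distrib_left)
qed

lemma prim_cmult: "prim (\<lambda>s. c * \<phi> s) x = c * prim \<phi> x"
  by (simp add: prim_def)

lemma prim_diff:
  assumes "continuous_on UNIV \<phi>" "continuous_on UNIV \<psi>"
  shows "prim (\<lambda>s. \<phi> s - \<psi> s) x = prim \<phi> x - prim \<psi> x"
  using prim_add[of \<phi> "\<lambda>s. - 1 * \<psi> s" x] prim_cmult[of "-1" \<psi> x] assms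
  by (simp add: continuous_on_minus)

lemma prim_FTC:
  fixes h h' :: "real \<Rightarrow> complex"
  assumes d: "\<And>s. s \<in> closed_segment 0 x \<Longrightarrow> (h has_vector_derivative h' s) (at s within closed_segment 0 x)"
    and c: "continuous_on UNIV h'"
  shows "h x - h 0 = prim h' x"
proof -
  have "norm ((h x - prim h' x) - (h 0 - prim h' 0)) \<le> 0 * \<bar>x\<bar> ^ Suc 0 / Suc 0"
    by (rule deriv_growth[where h' = "\<lambda>_. 0" and h = "\<lambda>s. (h s - prim h' s) - (h 0 - prim h' 0)"])
       (auto intro!: derivative_eq_intros d has_vector_derivative_prim[OF c])
  then show ?thesis by (simp add: algebra_simps)
qed

lemma prim_growth:
  assumes "continuous_on UNIV \<phi>" "\<And>s. s \<in> closed_segment 0 x \<Longrightarrow> norm (\<phi> s) \<le> C * \<bar>s\<bar> ^ n"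
  shows "norm (prim \<phi> x) \<le> C * \<bar>x\<bar> ^ Suc n / Suc n"
  by (rule deriv_growth[where h' = \<phi>]) (use assms has_vector_derivative_prim in auto)

text \<open>The connection with the oriented Lebesgue integrals by which kernels, transmutation operators
  and formal powers are defined: such an integral is evaluated by exhibiting a primitive.\<close>

lemma LBINT_eq_diff:
  fixes h h' :: "real \<Rightarrow> complex"
  assumes d: "\<And>s. s \<in> closed_segment y x \<Longrightarrow> (h has_vector_derivative h' s) (at s within closed_segment y x)"
    and c: "continuous_on (closed_segment y x) h'"
  shows "(LBINT s=ereal y..ereal x. h' s) = h x - h y"
proof -
  have e: "closed_segment y x = {min y x..max y x}"
    by (auto simp: closed_segment_eq_real_ivl)
  show ?thesis
    by (rule interval_integral_FTC_finite) (use d c in \<open>auto simp: e\<close>)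
qed

lemma continuous_on_prim_param:
  fixes \<Psi> :: "real \<Rightarrow> 'a::topological_space \<Rightarrow> complex"
  assumes c: "continuous_on UNIV (\<lambda>(s, y). \<Psi> s y)"
    and g: "continuous_on A g" and k: "continuous_on A k"
  shows "continuous_on A (\<lambda>z. prim (\<lambda>s. \<Psi> s (k z)) (g z))"
proof -
  have "continuous_on A (\<lambda>z. integral (cbox 0 1) (\<lambda>\<tau>. \<Psi> (g z * \<tau>) (k z)))"
  proof (rule integral_continuous_on_param)
    have "continuous_on (A \<times> cbox 0 1) ((\<lambda>(s, y). \<Psi> s y) \<circ> (\<lambda>w. (g (fst w) * snd w, k (fst w))))"
      by (intro continuous_on_compose continuous_on_subset[OF c])
         (auto intro!: continuous_intros continuous_on_compose2[OF g] continuous_on_compose2[OF k])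
    then show "continuous_on (A \<times> cbox 0 1) (\<lambda>(z, \<tau>). \<Psi> (g z * \<tau>) (k z))"
      by (simp add: o_def case_prod_unfold)
  qed
  then show ?thesis unfolding prim_def by (auto intro!: continuous_intros g)
qed

lemma continuous_on_split:
  assumes "continuous_on UNIV (\<lambda>(s, y). \<Psi> s y)" "continuous_on A g" "continuous_on A k"
  shows "continuous_on A (\<lambda>z. \<Psi> (g z) (k z))"
  using continuous_on_compose2[OF assms(1) continuous_on_Pair[OF assms(2,3)]] by simp

lemma has_vector_derivative_prim_param:
  fixes \<Psi> \<Psi>' :: "real \<Rightarrow> real \<Rightarrow> complex"
  assumes d: "\<And>s y. ((\<lambda>y. \<Psi> s y) has_vector_derivative \<Psi>' s y) (at y)"
    and c: "continuous_on UNIV (\<lambda>(s, y). \<Psi> s y)" and c': "continuous_on UNIV (\<lambda>(s, y). \<Psi>' s y)"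
  shows "((\<lambda>y. prim (\<lambda>s. \<Psi> s y) x) has_vector_derivative prim (\<lambda>s. \<Psi>' s y) x) (at y)"
proof -
  have "((\<lambda>y. integral (cbox 0 1) (\<lambda>\<tau>. \<Psi> (x * \<tau>) y)) has_vector_derivative
      integral (cbox 0 1) (\<lambda>\<tau>. \<Psi>' (x * \<tau>) y)) (at y within UNIV)"
  proof (rule leibniz_rule_vector_derivative)
    show "((\<lambda>y. \<Psi> (x * t) y) has_vector_derivative \<Psi>' (x * t) y) (at y within UNIV)" for y t
      using d by simp
    show "(\<lambda>t. \<Psi> (x * t) y) integrable_on cbox 0 1" for y
      by (intro integrable_continuous continuous_on_split[OF c] continuous_intros)
    show "continuous_on (UNIV \<times> cbox 0 1) (\<lambda>(y, t). \<Psi>' (x * t) y)"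
      unfolding case_prod_unfold by (intro continuous_on_split[OF c'] continuous_intros)
  qed auto
  then show ?thesis unfolding prim_def
    by (auto intro!: derivative_eq_intros)
qed

lemma has_vector_derivative_shift:
  fixes G :: "real \<Rightarrow> complex"
  assumes d: "\<And>y. (G has_vector_derivative G' y) (at y)"
  shows "((\<lambda>s. G (x + s)) has_vector_derivative G' (x + s)) (at s within S)"
    and "((\<lambda>s. G (x - s)) has_vector_derivative - G' (x - s)) (at s within S)"
proof -
  have "((\<lambda>s. x + s) has_vector_derivative 1) (at s within S)"
    by (auto intro!: derivative_eq_intros)
  from vector_diff_chain_within[OF this has_vector_derivative_at_within[OF d]]
  show "((\<lambda>s. G (x + s)) has_vector_derivative G' (x + s)) (at s within S)"
    by (simp add: o_def)
  have "((\<lambda>s. x - s) has_vector_derivative -1) (at s within S)"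
    by (auto intro!: derivative_eq_intros)
  from vector_diff_chain_within[OF this has_vector_derivative_at_within[OF d]]
  show "((\<lambda>s. G (x - s)) has_vector_derivative - G' (x - s)) (at s within S)"
    by (simp add: o_def)
qed

lemma has_vector_derivative_two_var:
  fixes f :: "real \<Rightarrow> real \<Rightarrow> complex"
  assumes fx: "((\<lambda>x. f x (h t)) has_vector_derivative fx) (at (g t))"
    and fy: "\<And>x y. ((\<lambda>y. f x y) has_vector_derivative fy x y) (at y)"
    and cont: "continuous_on UNIV (\<lambda>(x, y). fy x y)"
    and g: "(g has_real_derivative g') (at t)" and h: "(h has_real_derivative h') (at t)"
  shows "((\<lambda>t. f (g t) (h t)) has_vector_derivative g' *\<^sub>R fx + h' *\<^sub>R fy (g t) (h t)) (at t)"
proof -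
  have "((\<lambda>(x, y). f x y) has_derivative (\<lambda>(tx, ty). tx *\<^sub>R fx + blinfun_apply (blinfun_scaleR_left (fy (g t) (h t))) ty))
      (at (g t, h t) within UNIV \<times> UNIV)"
  proof (rule has_derivative_partialsI)
    show "((\<lambda>x. f x (h t)) has_derivative (\<lambda>tx. tx *\<^sub>R fx)) (at (g t))"
      using fx by (simp add: has_vector_derivative_def)
    show "((\<lambda>y. f x y) has_derivative blinfun_apply (blinfun_scaleR_left (fy x y))) (at y)" for x y
      using fy by (simp add: has_vector_derivative_def)
    have "continuous_on UNIV (\<lambda>z. blinfun_scaleR_left ((\<lambda>(x, y). fy x y) z))"
      by (intro continuous_intros cont)
    then show "continuous (at (g t, h t) within UNIV \<times> UNIV) (\<lambda>(x, y). blinfun_scaleR_left (fy x y))"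
      by (simp add: case_prod_unfold continuous_on_eq_continuous_within)
  qed auto
  then have 1: "((\<lambda>z. f (fst z) (snd z)) has_derivative (\<lambda>z. fst z *\<^sub>R fx + snd z *\<^sub>R fy (g t) (h t))) (at (g t, h t))"
    by (simp add: case_prod_unfold)
  have 2: "((\<lambda>t. (g t, h t)) has_derivative (\<lambda>s. (g' * s, h' * s))) (at t)"
    using g h by (intro has_derivative_Pair) (simp_all add: has_field_derivative_def)
  show ?thesis
    using diff_chain_at[OF 2 1] by (simp add: o_def has_vector_derivative_def scaleR_add_right mult.commute)
qed

text \<open>The Leibniz rule for an integral in which the upper limit and the parameter are the same variable.\<close>

lemma has_vector_derivative_prim_diag:
  fixes \<Psi> \<Psi>' :: "real \<Rightarrow> real \<Rightarrow> complex"
  assumes d: "\<And>s y. ((\<lambda>y. \<Psi> s y) has_vector_derivative \<Psi>' s y) (at y)"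
    and c: "continuous_on UNIV (\<lambda>(s, y). \<Psi> s y)" and c': "continuous_on UNIV (\<lambda>(s, y). \<Psi>' s y)"
  shows "((\<lambda>x. prim (\<lambda>s. \<Psi> s x) x) has_vector_derivative \<Psi> x x + prim (\<lambda>s. \<Psi>' s x) x) (at x)"
proof -
  have "((\<lambda>t. (\<lambda>x y. prim (\<lambda>s. \<Psi> s y) x) t t) has_vector_derivative
      1 *\<^sub>R \<Psi> x x + 1 *\<^sub>R (\<lambda>x y. prim (\<lambda>s. \<Psi>' s y) x) x x) (at x)"
  proof (rule has_vector_derivative_two_var[where f = "\<lambda>x y. prim (\<lambda>s. \<Psi> s y) x" and fx = "\<Psi> x x"
        and fy = "\<lambda>x y. prim (\<lambda>s. \<Psi>' s y) x" and g = "\<lambda>t. t" and h = "\<lambda>t. t"])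
    show "(prim (\<lambda>s. \<Psi> s x) has_vector_derivative \<Psi> x x) (at x)"
      by (intro has_vector_derivative_prim continuous_on_split[OF c] continuous_intros)
    show "((\<lambda>y. prim (\<lambda>s. \<Psi> s y) x) has_vector_derivative prim (\<lambda>s. \<Psi>' s y) x) (at y)" for x y
      by (rule has_vector_derivative_prim_param[OF d c c'])
    show "continuous_on UNIV (\<lambda>(x, y). prim (\<lambda>s. \<Psi>' s y) x)"
      unfolding case_prod_unfold
      by (rule continuous_on_prim_param[OF c']) (auto intro!: continuous_intros)
  qed auto
  then show ?thesis by simp
qed

lemma segment_abs_le: "s \<in> closed_segment 0 (u::real) \<Longrightarrow> \<bar>u\<bar> \<le> b \<Longrightarrow> \<bar>s\<bar> \<le> b"
  by (auto simp: closed_segment_eq_real_ivl split: if_splits)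

lemma compact_norm_bound:
  fixes f :: "'a::topological_space \<Rightarrow> 'b::real_normed_vector"
  assumes "compact K" "continuous_on K f"
  obtains A where "0 \<le> A" "\<And>x. x \<in> K \<Longrightarrow> norm (f x) \<le> A"
proof -
  have "bounded (f ` K)" using assms by (intro compact_imp_bounded compact_continuous_image)
  then obtain A where "\<And>x. x \<in> K \<Longrightarrow> norm (f x) \<le> A" unfolding bounded_iff by blast
  then show thesis by (intro that[of "max A 0"]) (auto intro: max.coboundedI1)
qed

text \<open>Composition with \<open>clip b\<close> extends a continuous function on \<open>[-b,b]\<close> to a continuous function on
  the line, so that parameter integrals can be formed without regard to domains.\<close>

definition clip :: "real \<Rightarrow> real \<Rightarrow> real" where
  "clip b x = max (- b) (min b x)"

lemma clip_bounds [simp]: "0 < b \<Longrightarrow> - b \<le> clip b x" "0 < b \<Longrightarrow> clip b x \<le> b"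
  by (auto simp: clip_def)

lemma clip_id [simp]: "x \<in> {-b..b} \<Longrightarrow> clip b x = x"
  by (auto simp: clip_def)

lemma continuous_on_clip [continuous_intros]:
  "continuous_on A g \<Longrightarrow> continuous_on A (\<lambda>x. clip b (g x))"
  unfolding clip_def by (intro continuous_intros)

lemma continuous_on_clip_compose:
  assumes "0 < b" "continuous_on {-b..b} \<phi>"
  shows "continuous_on UNIV (\<lambda>x. \<phi> (clip b x))"
  by (rule continuous_on_compose2[OF assms(2)]) (use assms in \<open>auto intro!: continuous_intros\<close>)

section \<open>Volterra equations of the second kind\<close>

text \<open>The assumption \<open>est\<close> expresses that \<open>V\<close> integrates with respect to \<open>\<rho>\<close>. It holds with
  \<open>\<rho> (u, v) = \<bar>u\<bar> \<bar>v\<bar>\<close> for the Goursat problem and with \<open>\<rho> x = \<bar>x\<bar>\<close> for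
  the integral part of a transmutation operator.\<close>

locale volterra =
  fixes K :: "'a::topological_space set" and \<rho> :: "'a \<Rightarrow> real" and R M :: real
    and V :: "('a \<Rightarrow> complex) \<Rightarrow> 'a \<Rightarrow> complex"
  assumes rho: "\<And>x. x \<in> K \<Longrightarrow> 0 \<le> \<rho> x \<and> \<rho> x \<le> R" and M: "0 \<le> M" and R: "0 \<le> R"
    and cont: "\<And>u. continuous_on K u \<Longrightarrow> continuous_on K (V u)"
    and diff: "\<And>u w x. continuous_on K u \<Longrightarrow> continuous_on K w \<Longrightarrow> x \<in> K \<Longrightarrow>
      V (\<lambda>y. u y - w y) x = V u x - V w x"
    and est: "\<And>u C n x. continuous_on K u \<Longrightarrow> 0 \<le> C \<Longrightarrow> (\<And>y. y \<in> K \<Longrightarrow> norm (u y) \<le> C * \<rho> y ^ n) \<Longrightarrow>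
      x \<in> K \<Longrightarrow> norm (V u x) \<le> M * C * \<rho> x ^ Suc n / Suc n"
begin

lemma est_fact:
  assumes "continuous_on K u" "0 \<le> C" "\<And>y. y \<in> K \<Longrightarrow> norm (u y) \<le> C * ((M * \<rho> y) ^ n / fact n)" "x \<in> K"
  shows "norm (V u x) \<le> C * ((M * \<rho> x) ^ Suc n / fact (Suc n))"
proof -
  have "norm (V u x) \<le> M * (C * M ^ n / fact n) * \<rho> x ^ Suc n / Suc n"
    by (rule est) (use assms M in \<open>auto simp: power_mult_distrib mult_ac\<close>)
  also have "\<dots> = C * ((M * \<rho> x) ^ Suc n / fact (Suc n))"
    by (simp add: power_mult_distrib field_simps)
  finally show ?thesis .
qed

text \<open>The difference of two solutions is a fixed point of \<open>V\<close>, hence of all its powers, which tend to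
  zero like the terms of an exponential series.\<close>

lemma unique:
  assumes cu: "continuous_on K u" and cw: "continuous_on K w" and bd: "bounded (u ` K)" "bounded (w ` K)"
    and eu: "\<And>x. x \<in> K \<Longrightarrow> u x = g x + V u x" and ew: "\<And>x. x \<in> K \<Longrightarrow> w x = g x + V w x"
    and x: "x \<in> K"
  shows "u x = w x"
proof -
  define d where "d y = u y - w y" for y
  have cd: "continuous_on K d" unfolding d_def by (intro continuous_intros cu cw)
  have dV: "d y = V d y" if "y \<in> K" for y
    using eu[OF that] ew[OF that] diff[OF cu cw that] by (simp add: d_def[abs_def])
  obtain C1 C2 where "\<And>y. y \<in> K \<Longrightarrow> norm (u y) \<le> C1" "\<And>y. y \<in> K \<Longrightarrow> norm (w y) \<le> C2"
    using bd by (auto simp: bounded_iff)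
  then have C: "norm (d y) \<le> C1 + C2" if "y \<in> K" for y
    using norm_triangle_ineq4[of "u y" "w y"] that by (fastforce simp: d_def)
  then have C0: "0 \<le> C1 + C2" using x norm_ge_zero order_trans by blast
  have "\<forall>y\<in>K. norm (d y) \<le> (C1 + C2) * ((M * \<rho> y) ^ n / fact n)" for n
  proof (induction n)
    case (Suc n)
    then show ?case using est_fact[OF cd C0, of n] dV by metis
  qed (use C in auto)
  then have le: "norm (d x) \<le> (C1 + C2) * ((M * \<rho> x) ^ n / fact n)" for n using x by blast
  have "(\<lambda>n. (C1 + C2) * ((M * \<rho> x) ^ n / fact n)) \<longlonglongrightarrow> (C1 + C2) * 0"
    using summable_LIMSEQ_zero[OF summable_exp[of "M * \<rho> x"]]
    by (intro tendsto_mult tendsto_const) (simp add: field_simps)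
  then have "norm (d x) \<le> 0"
    using le LIMSEQ_le_const[of _ "(C1 + C2) * 0" "norm (d x)"] by fastforce
  then show ?thesis by (simp add: d_def)
qed

text \<open>Successive approximation from \<open>0\<close>. The increments are the iterates of \<open>V\<close> on \<open>g\<close> and are
  dominated by the exponential series of \<open>M R\<close>, which also gives the bound on the solution.\<close>

lemma exists:
  assumes cg: "continuous_on K g" and bd: "\<And>x. x \<in> K \<Longrightarrow> norm (g x) \<le> C" and C: "0 \<le> C"
  obtains w where "continuous_on K w" "\<And>x. x \<in> K \<Longrightarrow> w x = g x + V w x"
    "\<And>x. x \<in> K \<Longrightarrow> norm (w x) \<le> C * exp (M * R)"
proof -
  define s where "s = rec_nat (\<lambda>_. 0) (\<lambda>_ u x. g x + V u x)"
  have s0: "s 0 = (\<lambda>_. 0)" and sS: "s (Suc n) = (\<lambda>x. g x + V (s n) x)" for n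
    by (simp_all add: s_def)
  have cs: "continuous_on K (s n)" for n
    by (induction n) (auto simp: s0 sS intro!: continuous_intros cg cont)
  define d where "d n x = s (Suc n) x - s n x" for n x
  have cd: "continuous_on K (d n)" for n unfolding d_def by (intro continuous_intros cs)
  have d0: "d 0 x = g x" if "x \<in> K" for x
    using diff[of "\<lambda>_. 0" "\<lambda>_. 0" x] that by (simp add: d_def s0 sS)
  have dS: "d (Suc n) x = V (d n) x" if "x \<in> K" for n x
  proof -
    have "d (Suc n) x = V (s (Suc n)) x - V (s n) x" by (simp add: d_def sS)
    also have "\<dots> = V (d n) x" using diff[OF cs cs that] by (simp add: d_def[abs_def])
    finally show ?thesis .
  qed
  have dbd: "\<forall>x\<in>K. norm (d n x) \<le> C * ((M * \<rho> x) ^ n / fact n)" for n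
  proof (induction n)
    case (Suc n)
    then show ?case using est_fact[OF cd C, of n n] dS by metis
  qed (use d0 bd in auto)
  have dbd2: "norm (d n x) \<le> C * ((M * R) ^ n / fact n)" if x: "x \<in> K" for n x
  proof -
    have "(M * \<rho> x) ^ n \<le> (M * R) ^ n"
      using rho[OF x] M by (intro power_mono mult_left_mono) auto
    then have "C * ((M * \<rho> x) ^ n / fact n) \<le> C * ((M * R) ^ n / fact n)"
      using C by (intro mult_left_mono divide_right_mono) auto
    then show ?thesis using dbd x order_trans by blast
  qed
  have sums_exp: "(\<lambda>n. C * ((M * R) ^ n / fact n)) sums (C * exp (M * R))"
    using exp_converges[of "M * R"] by (intro sums_mult) (simp add: field_simps)
  have tele: "(\<Sum>i<n. d i x) = s n x" for n x
    unfolding d_def using sum_lessThan_telescope[of "\<lambda>i. s i x" n] by (simp add: s0)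
  define w where "w x = (\<Sum>i. d i x)" for x
  have "uniform_limit K (\<lambda>n x. \<Sum>i<n. d i x) w sequentially"
    unfolding w_def[abs_def]
    by (rule Weierstrass_m_test[OF dbd2]) (use sums_exp in \<open>auto simp: sums_iff\<close>)
  then have ul: "uniform_limit K s w sequentially" by (simp add: tele[abs_def])
  have cw: "continuous_on K w"
    by (rule uniform_limit_theorem[OF _ ul]) (auto simp: cs)
  have "w x = g x + V w x" if x: "x \<in> K" for x
  proof -
    have l1: "(\<lambda>n. s (Suc n) x) \<longlonglongrightarrow> w x"
      using tendsto_uniform_limitI[OF ul x] by (rule LIMSEQ_Suc)
    have "(\<lambda>n. V (s n) x) \<longlonglongrightarrow> V w x"
    proof (rule LIMSEQ_I)
      fix r :: real assume r: "0 < r"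
      define e where "e = r / (M * R + 1)"
      have p: "0 < M * R + 1" using M R by (simp add: add_nonneg_pos)
      have e: "0 < e" using r p by (simp add: e_def)
      obtain N where N: "\<And>n y. n \<ge> N \<Longrightarrow> y \<in> K \<Longrightarrow> dist (s n y) (w y) < e"
        using uniform_limitD[OF ul e] by (auto simp: eventually_sequentially)
      have "norm (V (s n) x - V w x) < r" if n: "n \<ge> N" for n
      proof -
        have "norm (V (\<lambda>y. s n y - w y) x) \<le> M * e * \<rho> x ^ Suc 0 / Suc 0"
          by (rule est) (use N[OF n] e x in \<open>auto intro!: continuous_intros cs cw simp: dist_norm less_imp_le\<close>)
        also have "\<dots> \<le> M * e * R" using rho[OF x] M e by (simp add: mult_left_mono)
        also have "\<dots> < (M * R + 1) * e" using e by (simp add: algebra_simps)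
        also have "\<dots> = r" using p by (simp add: e_def)
        finally show ?thesis using diff[OF cs cw x] by simp
      qed
      then show "\<exists>N. \<forall>n\<ge>N. norm (V (s n) x - V w x) < r" by blast
    qed
    then have "(\<lambda>n. s (Suc n) x) \<longlonglongrightarrow> g x + V w x"
      unfolding sS by (intro tendsto_add tendsto_const)
    with l1 show ?thesis by (rule LIMSEQ_unique)
  qed
  moreover have "norm (w x) \<le> C * exp (M * R)" if x: "x \<in> K" for x
  proof -
    have "norm (w x) \<le> (\<Sum>n. C * ((M * R) ^ n / fact n))"
      unfolding w_def by (rule norm_suminf_le) (use dbd2[OF x] sums_exp in \<open>auto simp: sums_iff\<close>)
    then show ?thesis using sums_exp by (simp add: sums_iff)
  qed
  ultimately show thesis using cw that by blast
qed

end

section \<open>The Goursat problem as a first order system\<close>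

text \<open>The system that factorises the Goursat problems for \<open>a\<^sup>2 + a'\<close> and \<open>a\<^sup>2 - a'\<close>.
  \<open>Sv\<close> and \<open>Dv\<close> are the partial derivatives in the second variable. All functions live on the whole plane, so
  that derivatives are two-sided, but the equation for the derivative of \<open>D\<close> is imposed on the square
  \<open>[-b,b]\<^sup>2\<close> only, where the construction below provides it.\<close>

locale first_order_goursat =
  fixes b :: real and a a' :: "real \<Rightarrow> complex" and S D Sv Dv :: "real \<Rightarrow> real \<Rightarrow> complex"
  assumes b: "0 < b"
    and da: "\<And>x. (a has_vector_derivative a' x) (at x)"
    and ca': "continuous_on UNIV a'"
    and cS: "continuous_on UNIV (\<lambda>(u, v). S u v)" and cD: "continuous_on UNIV (\<lambda>(u, v). D u v)"
    and cSv: "continuous_on UNIV (\<lambda>(u, v). Sv u v)" and cDv: "continuous_on UNIV (\<lambda>(u, v). Dv u v)"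
    and dSu: "\<And>u v. ((\<lambda>s. S s v) has_vector_derivative a (u + v) * D u v) (at u)"
    and dSv: "\<And>u v. ((\<lambda>t. S u t) has_vector_derivative Sv u v) (at v)"
    and dDv: "\<And>u v. ((\<lambda>t. D u t) has_vector_derivative Dv u v) (at v)"
    and dSvu: "\<And>u v. ((\<lambda>s. Sv s v) has_vector_derivative a' (u + v) * D u v + a (u + v) * Dv u v) (at u)"
    and Dv: "\<And>u v. \<bar>u\<bar> \<le> b \<Longrightarrow> \<bar>v\<bar> \<le> b \<Longrightarrow> Dv u v = a (u + v) * S u v"
    and S0: "\<And>v. S 0 v = 0" and Du0: "\<And>u. D u 0 = a u" and D0v: "\<And>v. D 0 v = a 0"

text \<open>Changing the sign of \<open>a\<close> exchanges the two potentials. All results on the operator \<open>T_D\<close> are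
  obtained from those on \<open>T\<close> through this symmetry.\<close>

lemma (in first_order_goursat) reflect:
  "first_order_goursat b (\<lambda>x. - a x) (\<lambda>x. - a' x) S (\<lambda>u v. - D u v) Sv (\<lambda>u v. - Dv u v)"
proof
  show "((\<lambda>x. - a x) has_vector_derivative - a' x) (at x)" for x
    by (intro has_vector_derivative_minus da)
  show "((\<lambda>t. - D u t) has_vector_derivative - Dv u v) (at v)" for u v
    by (intro has_vector_derivative_minus dDv)
qed (use b ca' cS cSv dSu dSv dSvu Dv S0 Du0 D0v cD cDv in
      \<open>auto intro!: continuous_on_minus simp: case_prod_unfold\<close>)

definition u_integral :: "(real \<Rightarrow> complex) \<Rightarrow> (real \<Rightarrow> real \<Rightarrow> complex) \<Rightarrow> real \<Rightarrow> real \<Rightarrow> complex" where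
  "u_integral a W u v = prim (\<lambda>s. a (s + v) * W s v) u"

definition v_integral :: "(real \<Rightarrow> complex) \<Rightarrow> (real \<Rightarrow> real \<Rightarrow> complex) \<Rightarrow> real \<Rightarrow> real \<Rightarrow> complex" where
  "v_integral a W u v = prim (\<lambda>t. a (u + t) * W u t) v"

lemma continuous_on_sum_arg_mult:
  fixes a :: "real \<Rightarrow> complex" and W :: "real \<Rightarrow> real \<Rightarrow> complex"
  assumes "continuous_on UNIV a" "continuous_on UNIV (\<lambda>(s, t). W s t)"
    "continuous_on A g" "continuous_on A h"
  shows "continuous_on A (\<lambda>z. a (g z + h z) * W (g z) (h z))"
  by (rule continuous_on_mult[OF continuous_on_compose2[OF assms(1) continuous_on_add[OF assms(3,4)]]
        continuous_on_split[OF assms(2-4)]]) simp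

lemma continuous_on_u_integral:
  assumes "continuous_on UNIV a" "continuous_on UNIV (\<lambda>(s, t). W s t)"
  shows "continuous_on UNIV (\<lambda>(u, v). u_integral a W u v)"
  unfolding u_integral_def case_prod_unfold
proof (rule continuous_on_prim_param)
  show "continuous_on UNIV (\<lambda>(s, y). a (s + y) * W s y)"
    unfolding case_prod_unfold
    by (rule continuous_on_sum_arg_mult[OF assms]) (auto intro!: continuous_intros)
qed (auto intro!: continuous_intros)

lemma continuous_on_v_integral:
  assumes "continuous_on UNIV a" "continuous_on UNIV (\<lambda>(s, t). W s t)"
  shows "continuous_on UNIV (\<lambda>(u, v). v_integral a W u v)"
  unfolding v_integral_def case_prod_unfold
proof (rule continuous_on_prim_param[where \<Psi> = "\<lambda>t u. a (u + t) * W u t"])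
  show "continuous_on UNIV (\<lambda>(t, u). a (u + t) * W u t)"
    unfolding case_prod_unfold
    by (rule continuous_on_sum_arg_mult[OF assms]) (auto intro!: continuous_intros)
qed (auto intro!: continuous_intros)

text \<open>Each of the two integrations contributes a factor \<open>1/(n+1)\<close>; one of them suffices.\<close>

lemma goursat_growth:
  assumes ca: "continuous_on UNIV a" and cW: "continuous_on UNIV (\<lambda>(s, t). W s t)"
    and A: "\<And>s. \<bar>s\<bar> \<le> 2 * b \<Longrightarrow> norm (a s) \<le> A" and A0: "0 \<le> A" and C: "0 \<le> C"
    and W: "\<And>s t. \<bar>s\<bar> \<le> b \<Longrightarrow> \<bar>t\<bar> \<le> b \<Longrightarrow> norm (W s t) \<le> C * (\<bar>s\<bar> * \<bar>t\<bar>) ^ n"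
    and uv: "\<bar>u\<bar> \<le> b" "\<bar>v\<bar> \<le> b"
  shows "norm (v_integral a (u_integral a W) u v) \<le> (A * A) * C * (\<bar>u\<bar> * \<bar>v\<bar>) ^ Suc n / Suc n"
proof -
  have inner: "norm (u_integral a W u t) \<le> (A * C * \<bar>t\<bar> ^ n) * \<bar>u\<bar> ^ Suc n / Suc n" if t: "\<bar>t\<bar> \<le> b" for t
    unfolding u_integral_def
  proof (rule prim_growth)
    show "continuous_on UNIV (\<lambda>s. a (s + t) * W s t)"
      by (intro continuous_on_sum_arg_mult ca cW continuous_intros)
    fix s assume "s \<in> closed_segment 0 u"
    then have s: "\<bar>s\<bar> \<le> b" using uv segment_abs_le by blast
    then have "\<bar>s + t\<bar> \<le> 2 * b" using t by linarith
    from A[OF this] W[OF s t] have "norm (a (s + t) * W s t) \<le> A * (C * (\<bar>s\<bar> * \<bar>t\<bar>) ^ n)"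
      unfolding norm_mult using A0 by (intro mult_mono) auto
    then show "norm (a (s + t) * W s t) \<le> A * C * \<bar>t\<bar> ^ n * \<bar>s\<bar> ^ n"
      by (simp add: power_mult_distrib mult_ac)
  qed
  have "norm (v_integral a (u_integral a W) u v) \<le> (A * (A * C * \<bar>u\<bar> ^ Suc n / Suc n)) * \<bar>v\<bar> ^ Suc n / Suc n"
    unfolding v_integral_def
  proof (rule prim_growth)
    show "continuous_on UNIV (\<lambda>t. a (u + t) * u_integral a W u t)"
      by (intro continuous_on_sum_arg_mult ca continuous_on_u_integral cW continuous_intros)
    fix t assume "t \<in> closed_segment 0 v"
    then have t: "\<bar>t\<bar> \<le> b" using uv segment_abs_le by blast
    then have "\<bar>u + t\<bar> \<le> 2 * b" using uv by linarith
    from A[OF this] inner[OF t]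
    have "norm (a (u + t) * u_integral a W u t) \<le> A * ((A * C * \<bar>t\<bar> ^ n) * \<bar>u\<bar> ^ Suc n / Suc n)"
      unfolding norm_mult using A0 by (intro mult_mono) auto
    then show "norm (a (u + t) * u_integral a W u t) \<le> A * (A * C * \<bar>u\<bar> ^ Suc n / Suc n) * \<bar>t\<bar> ^ n"
      by (simp add: mult_ac)
  qed
  also have "\<dots> = (A * A) * C * (\<bar>u\<bar> * \<bar>v\<bar>) ^ Suc n / Suc n * (1 / Suc n)"
    by (simp add: power_mult_distrib)
  also have "\<dots> \<le> (A * A) * C * (\<bar>u\<bar> * \<bar>v\<bar>) ^ Suc n / Suc n * 1"
    using A0 C by (intro mult_left_mono) auto
  finally show ?thesis by simp
qed

text \<open>Eliminating \<open>S\<close> leaves a Volterra equation for \<open>D\<close>, which is solved on the square. The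
  right-hand sides of the integral equations for \<open>D\<close> and \<open>S\<close> make sense for all arguments once the solution is
  extended by clipping; taking them as the definition of \<open>D\<close> and \<open>S\<close> changes nothing on the square and makes
  the functions differentiable everywhere, in particular at its boundary.\<close>

lemma first_order_goursat_exists:
  assumes b: "0 < b" and da: "\<And>x. (a has_vector_derivative a' x) (at x)" and ca': "continuous_on UNIV a'"
  obtains S D Sv Dv where "first_order_goursat b a a' S D Sv Dv"
proof -
  have ca: "continuous_on UNIV a"
    by (rule continuous_on_vector_derivative) (use da in simp)
  obtain A where A': "0 \<le> A" and A0: "\<And>s. s \<in> {-(2*b)..2*b} \<Longrightarrow> norm (a s) \<le> A"
    using compact_norm_bound[OF compact_Icc continuous_on_subset[OF ca subset_UNIV]] by blast
  have A: "norm (a s) \<le> A" if "\<bar>s\<bar> \<le> 2 * b" for s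
    using A0[of s] that by (auto simp: abs_le_iff)
  define ext where "ext W = (\<lambda>s t. W (clip b s, clip b t))" for W :: "real \<times> real \<Rightarrow> complex"
  define V where "V W = (\<lambda>(u, v). v_integral a (u_integral a (ext W)) u v)" for W
  define K where "K = {-b..b} \<times> {-b..b}"
  have cext: "continuous_on UNIV (\<lambda>(s, t). ext W s t)" if "continuous_on K W" for W
    unfolding ext_def case_prod_unfold
    by (rule continuous_on_compose2[OF that]) (use b in \<open>auto intro!: continuous_intros simp: K_def\<close>)
  interpret volterra K "\<lambda>(u, v). \<bar>u\<bar> * \<bar>v\<bar>" "b * b" "A * A" V
  proof
    fix W W' :: "real \<times> real \<Rightarrow> complex" and z assume cW: "continuous_on K W"
    show "continuous_on K (V W)" unfolding V_def
      by (rule continuous_on_subset[OF continuous_on_v_integral[OF ca continuous_on_u_integral[OF ca cext[OF cW]]]]) simp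
    { assume cW': "continuous_on K W'"
      have ui: "u_integral a (ext (\<lambda>y. W y - W' y)) u t = u_integral a (ext W) u t - u_integral a (ext W') u t" for u t
      proof -
        have "prim (\<lambda>s. a (s + t) * ext W s t) u - prim (\<lambda>s. a (s + t) * ext W' s t) u =
            prim (\<lambda>s. a (s + t) * ext W s t - a (s + t) * ext W' s t) u"
          by (rule prim_diff[symmetric])
             (intro continuous_on_sum_arg_mult ca cext[OF cW] cext[OF cW'] continuous_intros)+
        then show ?thesis by (simp add: u_integral_def ext_def right_diff_distrib)
      qed
      show "V (\<lambda>y. W y - W' y) z = V W z - V W' z"
      proof (cases z)
        case (Pair u v)
        have "prim (\<lambda>t. a (u + t) * u_integral a (ext W) u t) v - prim (\<lambda>t. a (u + t) * u_integral a (ext W') u t) v =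
            prim (\<lambda>t. a (u + t) * u_integral a (ext W) u t - a (u + t) * u_integral a (ext W') u t) v"
          by (rule prim_diff[symmetric])
             (intro continuous_on_sum_arg_mult ca continuous_on_u_integral cext[OF cW] cext[OF cW'] continuous_intros)+
        then show ?thesis by (simp add: Pair V_def v_integral_def ui right_diff_distrib)
      qed }
    { fix C n assume C: "0 \<le> C" and bd: "\<And>y. y \<in> K \<Longrightarrow> norm (W y) \<le> C * (case y of (u, v) \<Rightarrow> \<bar>u\<bar> * \<bar>v\<bar>) ^ n" and z: "z \<in> K"
      obtain u v where uv: "z = (u, v)" "\<bar>u\<bar> \<le> b" "\<bar>v\<bar> \<le> b" using z by (auto simp: K_def abs_le_iff)
      have "norm (v_integral a (u_integral a (ext W)) u v) \<le> (A * A) * C * (\<bar>u\<bar> * \<bar>v\<bar>) ^ Suc n / Suc n"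
      proof (rule goursat_growth[OF ca cext[OF cW] A A' C _ uv(2,3)])
        fix s t assume "\<bar>s\<bar> \<le> b" "\<bar>t\<bar> \<le> b"
        then show "norm (ext W s t) \<le> C * (\<bar>s\<bar> * \<bar>t\<bar>) ^ n"
          using bd[of "(s, t)"] by (simp add: ext_def K_def abs_le_iff)
      qed
      then show "norm (V W z) \<le> A * A * C * (case z of (u, v) \<Rightarrow> \<bar>u\<bar> * \<bar>v\<bar>) ^ Suc n / real (Suc n)"
        by (simp add: V_def uv(1)) }
  qed (use b A' in \<open>auto simp: K_def abs_le_iff intro!: mult_mono\<close>)
  have ca2: "continuous_on K (\<lambda>z. a (fst z))"
    by (intro continuous_on_compose2[OF ca] continuous_intros) auto
  obtain w where cw: "continuous_on K w" and w: "\<And>z. z \<in> K \<Longrightarrow> w z = a (fst z) + V w z"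
    by (rule exists[OF ca2, of A]) (use A A' b in \<open>auto simp: K_def\<close>)
  define S1 where "S1 = u_integral a (ext w)"
  have cS1: "continuous_on UNIV (\<lambda>(u, v). S1 u v)"
    unfolding S1_def by (rule continuous_on_u_integral[OF ca cext[OF cw]])
  \<comment> \<open>On the square this is \<open>w\<close>, but it is differentiable in \<open>v\<close> at every point of the plane.\<close>
  define D where "D u v = a u + v_integral a S1 u v" for u v
  define Dv where "Dv u v = a (u + v) * S1 u v" for u v
  define S where "S = u_integral a D"
  define Sv where "Sv u v = prim (\<lambda>s. a' (s + v) * D s v + a (s + v) * Dv s v) u" for u v
  have cD: "continuous_on UNIV (\<lambda>(u, v). D u v)"
    using continuous_on_v_integral[OF ca cS1] unfolding D_def case_prod_unfold
    by (intro continuous_intros continuous_on_compose2[OF ca]) auto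
  have cDv: "continuous_on UNIV (\<lambda>(u, v). Dv u v)"
    unfolding Dv_def case_prod_unfold by (intro continuous_on_sum_arg_mult ca cS1 continuous_intros)
  have cS: "continuous_on UNIV (\<lambda>(u, v). S u v)"
    unfolding S_def by (rule continuous_on_u_integral[OF ca cD])
  have cSvi: "continuous_on UNIV (\<lambda>(s, v). a' (s + v) * D s v + a (s + v) * Dv s v)"
    unfolding case_prod_unfold by (intro continuous_on_add continuous_on_sum_arg_mult ca ca' cD cDv continuous_intros)
  have cSv: "continuous_on UNIV (\<lambda>(u, v). Sv u v)"
    unfolding Sv_def case_prod_unfold
    by (rule continuous_on_prim_param) (use cSvi in \<open>auto intro!: continuous_intros\<close>)
  have dDv: "((\<lambda>t. D u t) has_vector_derivative Dv u v) (at v)" for u v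
  proof -
    have "continuous_on UNIV (\<lambda>t. a (u + t) * S1 u t)"
      by (intro continuous_on_sum_arg_mult ca cS1 continuous_intros)
    from has_vector_derivative_prim[OF this, of v UNIV] show ?thesis
      unfolding D_def v_integral_def Dv_def by (auto intro!: derivative_eq_intros)
  qed
  have dsum: "((\<lambda>t. a (s + t)) has_vector_derivative a' (s + v)) (at v)" for s v
  proof -
    have "((\<lambda>t. s + t) has_vector_derivative 1) (at v within UNIV)"
      by (auto intro!: derivative_eq_intros)
    from vector_diff_chain_within[OF this has_vector_derivative_at_within[OF da]]
    show ?thesis by (simp add: o_def)
  qed
  have SS1: "S u v = S1 u v" if uv: "\<bar>u\<bar> \<le> b" "\<bar>v\<bar> \<le> b" for u v
    unfolding S_def S1_def u_integral_def
  proof (rule prim_cong)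
    fix s assume "s \<in> closed_segment 0 u"
    then have s: "\<bar>s\<bar> \<le> b" using uv segment_abs_le by blast
    have "(s, v) \<in> K" using s uv by (auto simp: K_def abs_le_iff)
    then have "ext w s v = D s v"
      using w[of "(s, v)"] by (auto simp: ext_def K_def D_def V_def S1_def)
    then show "a (s + v) * D s v = a (s + v) * ext w s v" by simp
  qed
  have "first_order_goursat b a a' S D Sv Dv"
  proof
    show "((\<lambda>s. S s v) has_vector_derivative a (u + v) * D u v) (at u)" for u v
      unfolding S_def u_integral_def
      by (rule has_vector_derivative_prim) (intro continuous_on_sum_arg_mult ca cD continuous_intros)
    show "((\<lambda>t. S u t) has_vector_derivative Sv u v) (at v)" for u v
      unfolding S_def u_integral_def Sv_def
    proof (rule has_vector_derivative_prim_param)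
      show "((\<lambda>y. a (s + y) * D s y) has_vector_derivative a' (s + y) * D s y + a (s + y) * Dv s y) (at y)" for s y
        by (rule has_vector_derivative_eq_rhs[OF has_vector_derivative_mult[OF dsum dDv]]) simp
      show "continuous_on UNIV (\<lambda>(s, y). a (s + y) * D s y)"
        unfolding case_prod_unfold by (intro continuous_on_sum_arg_mult ca cD continuous_intros)
    qed (rule cSvi)
    show "((\<lambda>s. Sv s v) has_vector_derivative a' (u + v) * D u v + a (u + v) * Dv u v) (at u)" for u v
      unfolding Sv_def
      by (rule has_vector_derivative_prim)
         (intro continuous_on_add continuous_on_sum_arg_mult ca ca' cD cDv continuous_intros)
  qed (use b da ca' cS cD cSv cDv dDv SS1 in \<open>auto simp: Dv_def S_def u_integral_def D_def v_integral_def S1_def\<close>)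
  then show thesis by (rule that)
qed

lemma diamond_section:
  assumes "(u, v) \<in> diamond b"
  shows "s \<in> closed_segment 0 u \<Longrightarrow> (s, v) \<in> diamond b" "t \<in> closed_segment 0 v \<Longrightarrow> (u, t) \<in> diamond b"
  using assms segment_abs_le[of s u "\<bar>u\<bar>"] segment_abs_le[of t v "\<bar>v\<bar>"] by (auto simp: diamond_def)

text \<open>The difference of two solutions vanishes on both axes, and its mixed derivative is bounded
  by the maximum of \<open>\<bar>Q\<bar>\<close> times the difference itself. Integrating this bound again and again, first in \<open>u\<close> and then in \<open>v\<close>, forces it to be zero.\<close>

lemma goursat_solution_unique:
  assumes b: "0 < b" and cQ: "continuous_on {-b..b} Q"
    and H1: "goursat_solution b Q \<eta> H1" and H2: "goursat_solution b Q \<eta> H2"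
  shows "H1 = H2"
proof -
  have "\<exists>Hv1. \<forall>(u, v)\<in>diamond b.
      ((\<lambda>t. H1 (u, t)) has_vector_derivative Hv1 (u, v)) (at v within {t. (u, t) \<in> diamond b}) \<and>
      ((\<lambda>s. Hv1 (s, v)) has_vector_derivative Q (u + v) * H1 (u, v)) (at u within {s. (s, v) \<in> diamond b})"
    using H1 unfolding goursat_solution_def by blast
  then obtain Hv1 where Hv1: "\<And>u v. (u, v) \<in> diamond b \<Longrightarrow>
      ((\<lambda>t. H1 (u, t)) has_vector_derivative Hv1 (u, v)) (at v within {t. (u, t) \<in> diamond b})"
      "\<And>u v. (u, v) \<in> diamond b \<Longrightarrow>
      ((\<lambda>s. Hv1 (s, v)) has_vector_derivative Q (u + v) * H1 (u, v)) (at u within {s. (s, v) \<in> diamond b})"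
    by blast
  have "\<exists>Hv2. \<forall>(u, v)\<in>diamond b.
      ((\<lambda>t. H2 (u, t)) has_vector_derivative Hv2 (u, v)) (at v within {t. (u, t) \<in> diamond b}) \<and>
      ((\<lambda>s. Hv2 (s, v)) has_vector_derivative Q (u + v) * H2 (u, v)) (at u within {s. (s, v) \<in> diamond b})"
    using H2 unfolding goursat_solution_def by blast
  then obtain Hv2 where Hv2: "\<And>u v. (u, v) \<in> diamond b \<Longrightarrow>
      ((\<lambda>t. H2 (u, t)) has_vector_derivative Hv2 (u, v)) (at v within {t. (u, t) \<in> diamond b})"
      "\<And>u v. (u, v) \<in> diamond b \<Longrightarrow>
      ((\<lambda>s. Hv2 (s, v)) has_vector_derivative Q (u + v) * H2 (u, v)) (at u within {s. (s, v) \<in> diamond b})"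
    by blast
  define H where "H z = H1 z - H2 z" for z
  define Hv where "Hv z = Hv1 z - Hv2 z" for z
  have dH: "((\<lambda>t. H (u, t)) has_vector_derivative Hv (u, v)) (at v within {t. (u, t) \<in> diamond b})"
    and dHv: "((\<lambda>s. Hv (s, v)) has_vector_derivative Q (u + v) * H (u, v)) (at u within {s. (s, v) \<in> diamond b})"
    if "(u, v) \<in> diamond b" for u v
    using has_vector_derivative_diff[OF Hv1(1)[OF that] Hv2(1)[OF that]]
      has_vector_derivative_diff[OF Hv1(2)[OF that] Hv2(2)[OF that]]
    by (simp_all add: H_def Hv_def right_diff_distrib)
  have H0: "H (u, 0) = 0" if "\<bar>u\<bar> \<le> b" for u
    using H1 H2 that by (auto simp: goursat_solution_def H_def abs_le_iff)
  have H0': "H (0, v) = 0" if "\<bar>v\<bar> \<le> b" for v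
  proof -
    have "\<forall>v\<in>{-b..b}. H1 (0, v) = \<eta> / 2" "\<forall>v\<in>{-b..b}. H2 (0, v) = \<eta> / 2"
      using H1 H2 unfolding goursat_solution_def by blast+
    moreover have "v \<in> {-b..b}" using that by (simp add: abs_le_iff)
    ultimately show ?thesis unfolding H_def by (metis diff_self)
  qed
  \<comment> \<open>At the corners of the diamond a section may shrink to a point, and a derivative within it is arbitrary;
      on the axis \<open>u = 0\<close> the section is \<open>[-b,b]\<close> and the derivative is unique.\<close>
  have Hv0: "Hv (0, v) = 0" if v: "\<bar>v\<bar> \<le> b" for v
  proof -
    have s: "{t. (0, t) \<in> diamond b} = cbox (-b) b" by (auto simp: diamond_def)
    have "((\<lambda>t. H (0, t)) has_vector_derivative Hv (0, v)) (at v within cbox (-b) b)"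
      using dH[of 0 v] v unfolding s by (auto simp: diamond_def)
    moreover have "((\<lambda>t. H (0, t)) has_vector_derivative 0) (at v within cbox (-b) b)"
      by (rule has_vector_derivative_transform[OF _ _ has_vector_derivative_const[of 0]])
         (use v H0' in auto)
    ultimately show ?thesis
      by (rule vector_derivative_unique_within_closed_interval[rotated 2]) (use b v in auto)
  qed
  have cH: "continuous_on (diamond b) H"
    unfolding H_def by (intro continuous_intros) (use H1 H2 in \<open>auto simp: goursat_solution_def\<close>)
  have "compact (diamond b)"
  proof -
    have "closed (diamond b)" unfolding diamond_def case_prod_unfold
      by (intro closed_Collect_le continuous_intros)
    moreover have "diamond b \<subseteq> cbox (-b, -b) (b, b)"
      by (auto simp: diamond_def)
    ultimately show ?thesis using compact_eq_bounded_closed bounded_subset bounded_cbox by metis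
  qed
  from compact_norm_bound[OF this cH]
  obtain C where C0: "0 \<le> C" and C: "\<And>z. z \<in> diamond b \<Longrightarrow> norm (H z) \<le> C" by blast
  obtain A where A0: "0 \<le> A" and A: "\<And>s. s \<in> {-b..b} \<Longrightarrow> norm (Q s) \<le> A"
    using compact_norm_bound[OF compact_Icc cQ] by blast
  have est: "\<forall>u v. (u, v) \<in> diamond b \<longrightarrow> norm (H (u, v)) \<le> C * ((A * (\<bar>u\<bar> * \<bar>v\<bar>)) ^ n / fact n)" for n
  proof (induction n)
    case 0
    then show ?case using C by auto
  next
    case (Suc n)
    define c where "c = C * A ^ n / fact n"
    have c0: "0 \<le> c" using A0 C0 by (simp add: c_def)
    have IH: "norm (H (u, v)) \<le> c * (\<bar>u\<bar> ^ n * \<bar>v\<bar> ^ n)" if "(u, v) \<in> diamond b" for u v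
      using Suc that by (simp add: c_def power_mult_distrib mult.assoc)
    have bv: "norm (Hv (u, v)) \<le> (A * c * \<bar>v\<bar> ^ n) * \<bar>u\<bar> ^ Suc n / Suc n" if uv: "(u, v) \<in> diamond b" for u v
    proof (rule deriv_growth[where h = "\<lambda>s. Hv (s, v)" and h' = "\<lambda>s. Q (s + v) * H (s, v)"])
      show "Hv (0, v) = 0" using uv by (intro Hv0) (auto simp: diamond_def)
      fix s assume s: "s \<in> closed_segment 0 u"
      note sv = diamond_section(1)[OF uv s]
      show "((\<lambda>s. Hv (s, v)) has_vector_derivative Q (s + v) * H (s, v)) (at s within closed_segment 0 u)"
        by (rule has_vector_derivative_within_subset[OF dHv[OF sv]]) (use diamond_section(1)[OF uv] in auto)
      have "norm (Q (s + v)) \<le> A" using sv by (intro A) (auto simp: diamond_def)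
      then have "norm (Q (s + v) * H (s, v)) \<le> A * (c * (\<bar>s\<bar> ^ n * \<bar>v\<bar> ^ n))"
        unfolding norm_mult using IH[OF sv] A0 by (intro mult_mono) auto
      then show "norm (Q (s + v) * H (s, v)) \<le> A * c * \<bar>v\<bar> ^ n * \<bar>s\<bar> ^ n" by (simp add: mult_ac)
    qed
    show ?case
    proof (intro allI impI)
      fix u v assume uv: "(u, v) \<in> diamond b"
      have "norm (H (u, v)) \<le> (A * c * \<bar>u\<bar> ^ Suc n / Suc n) * \<bar>v\<bar> ^ Suc n / Suc n"
      proof (rule deriv_growth[where h = "\<lambda>t. H (u, t)" and h' = "\<lambda>t. Hv (u, t)"])
        show "H (u, 0) = 0" using uv by (intro H0) (auto simp: diamond_def)
        fix t assume t: "t \<in> closed_segment 0 v"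
        note ut = diamond_section(2)[OF uv t]
        show "((\<lambda>t. H (u, t)) has_vector_derivative Hv (u, t)) (at t within closed_segment 0 v)"
          by (rule has_vector_derivative_within_subset[OF dH[OF ut]]) (use diamond_section(2)[OF uv] in auto)
        show "norm (Hv (u, t)) \<le> A * c * \<bar>u\<bar> ^ Suc n / Suc n * \<bar>t\<bar> ^ n"
          using bv[OF ut] by (simp add: mult_ac)
      qed
      also have "\<dots> = (A * c * (\<bar>u\<bar> * \<bar>v\<bar>) ^ Suc n / Suc n) * (1 / Suc n)"
        by (simp add: power_mult_distrib)
      also have "\<dots> \<le> (A * c * (\<bar>u\<bar> * \<bar>v\<bar>) ^ Suc n / Suc n) * 1"
        using A0 c0 by (intro mult_left_mono) auto
      also have "\<dots> = C * ((A * (\<bar>u\<bar> * \<bar>v\<bar>)) ^ Suc n / fact (Suc n))"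
        by (simp add: c_def power_mult_distrib mult_ac)
      finally show "norm (H (u, v)) \<le> C * ((A * (\<bar>u\<bar> * \<bar>v\<bar>)) ^ Suc n / fact (Suc n))" .
    qed
  qed
  have "H z = 0" if z: "z \<in> diamond b" for z
  proof -
    obtain u v where uv: "z = (u, v)" by (cases z)
    have "(\<lambda>n. C * ((A * (\<bar>u\<bar> * \<bar>v\<bar>)) ^ n / fact n)) \<longlonglongrightarrow> C * 0"
      using summable_LIMSEQ_zero[OF summable_exp[of "A * (\<bar>u\<bar> * \<bar>v\<bar>)"]]
      by (intro tendsto_mult tendsto_const) (simp add: field_simps)
    then have "norm (H (u, v)) \<le> C * 0"
      by (rule LIMSEQ_le_const) (use est z uv in blast)
    then show ?thesis by (simp add: uv)
  qed
  then have "H1 z = H2 z" if "z \<in> diamond b" for z using that by (simp add: H_def)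
  moreover have "H1 \<in> extensional (diamond b)" "H2 \<in> extensional (diamond b)"
    using H1 H2 by (auto simp: goursat_solution_def)
  ultimately show ?thesis by (metis extensionalityI)
qed

context first_order_goursat
begin

definition kernel :: "real \<Rightarrow> real \<Rightarrow> complex" where
  "kernel u v = (S u v + D u v) / 2"

lemma ca: "continuous_on UNIV a"
  by (rule continuous_on_vector_derivative) (use da in simp)

lemma continuous_kernel: "continuous_on UNIV (\<lambda>(u, v). kernel u v)"
  using cS cD unfolding kernel_def case_prod_unfold by (intro continuous_intros) auto

text \<open>On the square the derivative in \<open>v\<close> of \<open>(S + D)/2\<close> is \<open>(S_v + a S)/2\<close>. Its derivative in \<open>u\<close> is
  \<open>(a' D + a D_v + a' S + a S_u)/2\<close>, which by the two equations of the system equals \<open>(a' + a\<^sup>2) (S + D)/2\<close>.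
  No derivative of \<open>a'\<close> occurs, so a continuous potential is enough.\<close>

lemma goursat_solution_kernel:
  assumes Q: "\<And>x. x \<in> {-b..b} \<Longrightarrow> Q x = a' x + (a x)\<^sup>2"
  shows "goursat_solution b Q (a 0) (restrict (\<lambda>(u, v). kernel u v) (diamond b))"
  unfolding goursat_solution_def
proof (intro conjI ballI)
  show "continuous_on (diamond b) (restrict (\<lambda>(u, v). kernel u v) (diamond b))"
    using continuous_on_subset[OF continuous_kernel, of "diamond b"]
    by (simp cong: continuous_on_cong_simp)
  define Hv where "Hv = (\<lambda>(u, v). (Sv u v + a (u + v) * S u v) / 2)"
  have "((\<lambda>t. restrict (\<lambda>(u, v). kernel u v) (diamond b) (u, t)) has_vector_derivative Hv (u, v))
      (at v within {t. (u, t) \<in> diamond b})"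
    if uv: "(u, v) \<in> diamond b" for u v
  proof (rule has_vector_derivative_transform[of _ _ _ "\<lambda>t. kernel u t"])
    have "\<bar>u\<bar> \<le> b" "\<bar>v\<bar> \<le> b" using uv by (auto simp: diamond_def)
    then have "Hv (u, v) = (Sv u v + Dv u v) / 2" by (simp add: Hv_def Dv)
    then show "((\<lambda>t. kernel u t) has_vector_derivative Hv (u, v)) (at v within {t. (u, t) \<in> diamond b})"
      unfolding kernel_def
      by (simp only:) (intro has_vector_derivative_divide has_vector_derivative_add
          has_vector_derivative_at_within[OF dSv] has_vector_derivative_at_within[OF dDv])
  qed (use uv in auto)
  moreover have "((\<lambda>s. Hv (s, v)) has_vector_derivative Q (u + v) * restrict (\<lambda>(u, v). kernel u v) (diamond b) (u, v))
      (at u within {s. (s, v) \<in> diamond b})"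
    if uv: "(u, v) \<in> diamond b" for u v
  proof -
    have uv': "\<bar>u\<bar> \<le> b" "\<bar>v\<bar> \<le> b" "u + v \<in> {-b..b}" using uv by (auto simp: diamond_def)
    have "((\<lambda>s. s + v) has_vector_derivative 1) (at u within UNIV)"
      by (auto intro!: derivative_eq_intros)
    from vector_diff_chain_within[OF this has_vector_derivative_at_within[OF da]]
    have dav: "((\<lambda>s. a (s + v)) has_vector_derivative a' (u + v)) (at u)" by (simp add: o_def)
    have "((\<lambda>s. Hv (s, v)) has_vector_derivative (a' (u + v) * D u v + a (u + v) * Dv u v +
        (a (u + v) * (a (u + v) * D u v) + a' (u + v) * S u v)) / 2) (at u)"
      unfolding Hv_def prod.case
      by (intro has_vector_derivative_divide has_vector_derivative_add dSvu has_vector_derivative_mult dav dSu)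
    also have "(a' (u + v) * D u v + a (u + v) * Dv u v + (a (u + v) * (a (u + v) * D u v) + a' (u + v) * S u v)) / 2
        = Q (u + v) * restrict (\<lambda>(u, v). kernel u v) (diamond b) (u, v)"
      using uv by (simp add: Q[OF uv'(3)] Dv[OF uv'(1,2)] kernel_def power2_eq_square field_simps)
    finally show ?thesis by (rule has_vector_derivative_at_within)
  qed
  ultimately show "\<exists>Hv. \<forall>(u, v)\<in>diamond b.
      ((\<lambda>t. restrict (\<lambda>(u, v). kernel u v) (diamond b) (u, t)) has_vector_derivative Hv (u, v)) (at v within {t. (u, t) \<in> diamond b}) \<and>
      ((\<lambda>s. Hv (s, v)) has_vector_derivative Q (u + v) * restrict (\<lambda>(u, v). kernel u v) (diamond b) (u, v)) (at u within {s. (s, v) \<in> diamond b})"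
    by blast
  fix u assume u: "u \<in> {-b..b}"
  have "(LBINT s=ereal 0..ereal u. Q s) = (S u 0 + a u) - (S 0 0 + a 0)"
  proof (rule LBINT_eq_diff)
    have seg: "closed_segment 0 u \<subseteq> {-b..b}" using u b by (simp add: subset_closed_segment closed_segment_subset)
    show "continuous_on (closed_segment 0 u) Q"
      by (subst continuous_on_cong[OF refl, of _ _ "\<lambda>x. a' x + (a x)\<^sup>2"])
         (use seg Q in \<open>auto intro!: continuous_intros continuous_on_subset[OF ca] continuous_on_subset[OF ca']\<close>)
    fix s assume "s \<in> closed_segment 0 u"
    then have "Q s = a s * a s + a' s" using Q seg by (auto simp: power2_eq_square)
    then show "((\<lambda>u. S u 0 + a u) has_vector_derivative Q s) (at s within closed_segment 0 u)"
      using has_vector_derivative_add[OF dSu[of 0 s] da[of s]]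
      by (simp add: Du0 has_vector_derivative_at_within)
  qed
  then show "restrict (\<lambda>(u, v). kernel u v) (diamond b) (u, 0) = a 0 / 2 + (LBINT s=ereal 0..ereal u. Q s) / 2"
    using u by (simp add: diamond_def abs_le_iff kernel_def Du0 S0 field_simps)
next
  fix v assume "v \<in> {-b..b}"
  then show "restrict (\<lambda>(u, v). kernel u v) (diamond b) (0, v) = a 0 / 2"
    by (simp add: diamond_def abs_le_iff kernel_def D0v S0)
qed simp

lemma goursat_H_eq_kernel:
  assumes Q: "\<And>x. x \<in> {-b..b} \<Longrightarrow> Q x = a' x + (a x)\<^sup>2" and uv: "(u, v) \<in> diamond b"
  shows "goursat_H b Q (a 0) (u, v) = kernel u v"
proof -
  have cQ: "continuous_on {-b..b} Q"
    by (subst continuous_on_cong[OF refl, of _ _ "\<lambda>x. a' x + (a x)\<^sup>2"])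
       (use Q in \<open>auto intro!: continuous_intros continuous_on_subset[OF ca] continuous_on_subset[OF ca']\<close>)
  have gs: "goursat_solution b Q (a 0) (restrict (\<lambda>(u, v). kernel u v) (diamond b))"
    by (rule goursat_solution_kernel[OF Q])
  have "goursat_H b Q (a 0) = restrict (\<lambda>(u, v). kernel u v) (diamond b)"
    unfolding goursat_H_def
    by (rule the_equality[of "goursat_solution b Q (a 0)", OF gs]) (rule goursat_solution_unique[OF b cQ _ gs])
  then show ?thesis using uv by simp
qed

end

section \<open>The intertwining relation\<close>

context first_order_goursat
begin

text \<open>The kernel of the reflected system, that is, for the potential \<open>a\<^sup>2 - a'\<close>.\<close>

definition dual_kernel :: "real \<Rightarrow> real \<Rightarrow> complex" where
  "dual_kernel u v = (S u v - D u v) / 2"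

text \<open>The transmutation operator after the substitution \<open>t = 2 s - x\<close>. The kernel is then evaluated
  along the segment \<open>u + v = x\<close>, on which \<open>a (u + v)\<close> is constant.\<close>

definition T :: "(real \<Rightarrow> complex) \<Rightarrow> real \<Rightarrow> complex" where
  "T \<phi> x = \<phi> x + 2 * prim (\<lambda>s. kernel s (x - s) * \<phi> (2 * s - x)) x"

definition T_dual :: "(real \<Rightarrow> complex) \<Rightarrow> real \<Rightarrow> complex" where
  "T_dual \<phi> x = \<phi> x + 2 * prim (\<lambda>s. dual_kernel s (x - s) * \<phi> (2 * s - x)) x"

lemma continuous_dual_kernel: "continuous_on UNIV (\<lambda>(u, v). dual_kernel u v)"
  using cS cD unfolding dual_kernel_def case_prod_unfold by (intro continuous_intros) auto

lemma continuous_on_antidiagonal: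
  fixes W :: "real \<Rightarrow> real \<Rightarrow> complex" and \<phi> :: "real \<Rightarrow> complex"
  assumes "continuous_on UNIV (\<lambda>(u, v). W u v)" "continuous_on UNIV \<phi>"
    "continuous_on A g" "continuous_on A h"
  shows "continuous_on A (\<lambda>z. W (g z) (h z - g z) * \<phi> (2 * g z - h z))"
  by (intro continuous_on_mult continuous_on_split[OF assms(1)] continuous_on_compose2[OF assms(2)]
      continuous_intros assms) auto

lemma T_0 [simp]: "T \<phi> 0 = \<phi> 0"
  by (simp add: T_def)

lemma continuous_on_T:
  assumes "continuous_on UNIV \<phi>"
  shows "continuous_on UNIV (T \<phi>)"
proof -
  have "continuous_on UNIV (\<lambda>(s, y). kernel s (y - s) * \<phi> (2 * s - y))"
    unfolding case_prod_unfold
    by (intro continuous_on_antidiagonal continuous_kernel assms continuous_intros)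
  from continuous_on_prim_param[OF this continuous_on_id continuous_on_id]
  show ?thesis unfolding T_def by (intro continuous_intros assms) simp
qed

lemma T_linear:
  assumes "continuous_on UNIV \<phi>" "continuous_on UNIV \<psi>"
  shows "T (\<lambda>x. \<phi> x + c * \<psi> x) x = T \<phi> x + c * T \<psi> x"
proof -
  have "prim (\<lambda>s. kernel s (x - s) * \<phi> (2 * s - x)) x + prim (\<lambda>s. c * (kernel s (x - s) * \<psi> (2 * s - x))) x
     = prim (\<lambda>s. kernel s (x - s) * \<phi> (2 * s - x) + c * (kernel s (x - s) * \<psi> (2 * s - x))) x"
    by (rule prim_add[symmetric])
       (intro continuous_on_antidiagonal continuous_on_mult_left continuous_kernel assms continuous_intros)+
  then have "prim (\<lambda>s. kernel s (x - s) * (\<phi> (2 * s - x) + c * \<psi> (2 * s - x))) x =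
      prim (\<lambda>s. kernel s (x - s) * \<phi> (2 * s - x)) x + c * prim (\<lambda>s. kernel s (x - s) * \<psi> (2 * s - x)) x"
    by (simp only: prim_cmult distrib_left mult.left_commute[of "kernel _ _" c])
  then show ?thesis by (simp add: T_def distrib_left mult.left_commute)
qed

text \<open>The intertwining relation \<open>(d/dx - a) T \<phi> = T_D \<phi>'\<close>. Differentiating \<open>T \<phi>\<close> under the integral
  produces a term with \<open>\<phi>\<close> and one with \<open>\<phi>'\<close>. Subtracting \<open>a T \<phi> + T_D \<phi>'\<close>, the coefficient of \<open>\<phi>'\<close> that
  remains is the sum of both kernels, which is \<open>S\<close>; an integration by parts of \<open>S \<phi>'\<close> along the segment
  \<open>u + v = x\<close>, where \<open>d/ds S(s, x - s) = a D - S_v\<close>, cancels everything.\<close>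

lemma T_has_vector_derivative:
  assumes d\<phi>: "\<And>x. (\<phi> has_vector_derivative \<phi>' x) (at x)" and c\<phi>': "continuous_on UNIV \<phi>'"
    and x: "x \<in> {-b..b}"
  shows "(T \<phi> has_vector_derivative a x * T \<phi> x + T_dual \<phi>' x) (at x)"
proof -
  have c\<phi>: "continuous_on UNIV \<phi>"
    by (rule continuous_on_vector_derivative) (use d\<phi> in simp)
  define Hv where "Hv u v = (Sv u v + Dv u v) / 2" for u v
  have cHv: "continuous_on UNIV (\<lambda>(u, v). Hv u v)"
    using cSv cDv unfolding Hv_def case_prod_unfold by (intro continuous_intros) auto
  have dH: "((\<lambda>t. kernel u t) has_vector_derivative Hv u v) (at v)" for u v
    unfolding kernel_def Hv_def by (intro has_vector_derivative_divide has_vector_derivative_add dSv dDv)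
  have lin: "((\<lambda>y. \<phi> (p * s + c * y)) has_vector_derivative c *\<^sub>R \<phi>' (p * s + c * y)) (at y)" for p s c y
  proof -
    have "((\<lambda>y. p * s + c * y) has_vector_derivative c) (at y within UNIV)"
      by (auto intro!: derivative_eq_intros simp flip: has_real_derivative_iff_has_vector_derivative)
    from vector_diff_chain_within[OF this has_vector_derivative_at_within[OF d\<phi>]]
    show ?thesis by (simp add: o_def)
  qed
  have dHy: "((\<lambda>y. kernel s (y - s)) has_vector_derivative Hv s (y - s)) (at y)" for s y
  proof -
    have "((\<lambda>y. y - s) has_vector_derivative 1) (at y within UNIV)"
      by (auto intro!: derivative_eq_intros)
    from vector_diff_chain_within[OF this has_vector_derivative_at_within[OF dH]]
    show ?thesis by (simp add: o_def)
  qed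
  define \<Psi> where "\<Psi> s y = kernel s (y - s) * \<phi> (2 * s - y)" for s y
  define \<Psi>' where "\<Psi>' s y = Hv s (y - s) * \<phi> (2 * s - y) - kernel s (y - s) * \<phi>' (2 * s - y)" for s y
  have dW: "((\<lambda>x. prim (\<lambda>s. \<Psi> s x) x) has_vector_derivative \<Psi> x x + prim (\<lambda>s. \<Psi>' s x) x) (at x)"
  proof (rule has_vector_derivative_prim_diag)
    show "((\<lambda>y. \<Psi> s y) has_vector_derivative \<Psi>' s y) (at y)" for s y
      unfolding \<Psi>_def \<Psi>'_def
      using has_vector_derivative_mult[OF dHy[of s y] lin[of 2 s "-1" y]] by (simp add: add.commute)
    show "continuous_on UNIV (\<lambda>(s, y). \<Psi> s y)" "continuous_on UNIV (\<lambda>(s, y). \<Psi>' s y)"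
      unfolding \<Psi>_def \<Psi>'_def case_prod_unfold
      by (intro continuous_on_diff continuous_on_antidiagonal cHv continuous_kernel c\<phi> c\<phi>' continuous_intros)+
  qed
  define h where "h s = S s (x - s) * \<phi> (2 * s - x)" for s
  define h' where "h' s = (a x * D s (x - s) - Sv s (x - s)) * \<phi> (2 * s - x) + 2 * (S s (x - s) * \<phi>' (2 * s - x))" for s
  have dh: "(h has_vector_derivative h' s) (at s)" for s
  proof -
    have "((\<lambda>t. S t (x - t)) has_vector_derivative 1 *\<^sub>R (a (s + (x - s)) * D s (x - s)) + (-1) *\<^sub>R Sv s (x - s)) (at s)"
      by (rule has_vector_derivative_two_var[where f = S and fy = Sv and g = "\<lambda>t. t" and h = "\<lambda>t. x - t"])
         (rule dSu dSv cSv | auto intro!: derivative_eq_intros)+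
    from has_vector_derivative_mult[OF this lin[of "-1" x 2 s]]
    show ?thesis unfolding h_def[abs_def] h'_def by (simp add: algebra_simps scaleR_conv_of_real)
  qed
  have ch': "continuous_on UNIV h'"
    unfolding h'_def left_diff_distrib mult.assoc
    by (intro continuous_on_add continuous_on_diff continuous_on_mult_left continuous_on_antidiagonal
        cSv cD cS c\<phi> c\<phi>' continuous_intros)
  have "h x - h 0 = prim h' x"
    by (rule prim_FTC[OF has_vector_derivative_at_within[OF dh] ch'])
  then have parts: "S x 0 * \<phi> x = prim h' x" by (simp add: h_def S0)
  define P1 where "P1 = (\<lambda>s. kernel s (x - s) * \<phi> (2 * s - x))"
  define P2 where "P2 = (\<lambda>s. dual_kernel s (x - s) * \<phi>' (2 * s - x))"
  define P3 where "P3 = (\<lambda>s. \<Psi>' s x)"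
  have c1: "continuous_on UNIV P1" and c2: "continuous_on UNIV P2" and c3: "continuous_on UNIV P3"
    unfolding P1_def P2_def P3_def \<Psi>'_def
    by (intro continuous_on_diff continuous_on_antidiagonal cHv continuous_dual_kernel continuous_kernel c\<phi> c\<phi>' continuous_intros)+
  have "prim h' x = prim (\<lambda>s. 2 * a x * P1 s + 2 * P2 s - 2 * P3 s) x"
  proof (rule prim_cong)
    fix s assume "s \<in> closed_segment 0 x"
    then have "\<bar>s\<bar> \<le> b" "\<bar>x - s\<bar> \<le> b"
      using x by (auto simp: closed_segment_eq_real_ivl split: if_splits)
    then have "Dv s (x - s) = a x * S s (x - s)" using Dv[of s "x - s"] by simp
    then show "h' s = 2 * a x * P1 s + 2 * P2 s - 2 * P3 s"
      by (simp add: h'_def P1_def P2_def P3_def \<Psi>'_def Hv_def kernel_def dual_kernel_def field_simps)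
  qed
  also have "\<dots> = prim (\<lambda>s. 2 * a x * P1 s + 2 * P2 s) x - prim (\<lambda>s. 2 * P3 s) x"
    by (rule prim_diff) (intro continuous_intros c1 c2 c3)+
  also have "prim (\<lambda>s. 2 * a x * P1 s + 2 * P2 s) x = prim (\<lambda>s. 2 * a x * P1 s) x + prim (\<lambda>s. 2 * P2 s) x"
    by (rule prim_add) (intro continuous_intros c1 c2)+
  finally have key: "S x 0 * \<phi> x = 2 * a x * prim P1 x + 2 * prim P2 x - 2 * prim P3 x"
    using parts by (simp only: prim_cmult)
  have "(T \<phi> has_vector_derivative \<phi>' x + 2 * (\<Psi> x x + prim P3 x)) (at x)"
    unfolding T_def[abs_def] P3_def
    by (intro has_vector_derivative_add d\<phi> has_vector_derivative_mult_right dW[unfolded \<Psi>_def[of _ _]])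
       (use dW in \<open>simp add: \<Psi>_def\<close>)
  also have "\<phi>' x + 2 * (\<Psi> x x + prim P3 x) = a x * T \<phi> x + T_dual \<phi>' x"
  proof -
    have "2 * \<Psi> x x = S x 0 * \<phi> x + a x * \<phi> x"
      by (simp add: \<Psi>_def kernel_def Du0 distrib_right)
    then show ?thesis unfolding T_def T_dual_def P1_def[symmetric] P2_def[symmetric]
      using key by (simp add: algebra_simps)
  qed
  finally show ?thesis .
qed

text \<open>The first form of the operator is suited to differentiation, the second one to estimates: there the
  argument of \<open>u\<close> is the variable of integration itself, so that bounds by powers can be integrated.\<close>

lemma trans_op_eq_T:
  assumes Q: "\<And>x. x \<in> {-b..b} \<Longrightarrow> Q x = a' x + (a x)\<^sup>2"
    and cu: "continuous_on UNIV u" and u: "\<And>x. x \<in> {-b..b} \<Longrightarrow> w x = u x" and x: "x \<in> {-b..b}"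
  shows "trans_op b Q (a 0) w x = T u x"
    and "trans_op b Q (a 0) w x = u x + (prim (\<lambda>t. kernel ((x + t) / 2) ((x - t) / 2) * u t) x
        - prim (\<lambda>t. kernel ((x + t) / 2) ((x - t) / 2) * u t) (- x))"
proof -
  define F where "F t = kernel ((x + t) / 2) ((x - t) / 2) * u t" for t
  have cF: "continuous_on UNIV F" unfolding F_def[abs_def]
    by (intro continuous_on_mult continuous_on_split[OF continuous_kernel] cu continuous_intros) auto
  have "(LBINT t=ereal (-x)..ereal x. trans_kernel b Q (a 0) x t * w t) = (LBINT t=ereal (-x)..ereal x. F t)"
  proof (rule interval_integral_cong)
    fix t assume "t \<in> einterval (min (ereal (- x)) (ereal x)) (max (ereal (- x)) (ereal x))"
    then have t: "\<bar>t\<bar> \<le> \<bar>x\<bar>" by (auto simp: einterval_def min_def max_def split: if_splits)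
    then have abs_sum: "\<bar>x + t\<bar> / 2 + \<bar>x - t\<bar> / 2 \<le> b"
      using x by (auto simp: abs_if field_simps split: if_splits)
    have "((x + t) / 2, (x - t) / 2) \<in> diamond b" "t \<in> {-b..b}"
      using t x abs_sum by (auto simp: diamond_def)
    then show "trans_kernel b Q (a 0) x t * w t = F t"
      using goursat_H_eq_kernel[OF Q] u by (simp add: trans_kernel_def F_def)
  qed
  then have e: "trans_op b Q (a 0) w x = u x + (LBINT t=ereal (-x)..ereal x. F t)"
    using x u by (simp add: trans_op_def)
  have "(LBINT t=ereal (-x)..ereal x. F t) = prim F x - prim F (-x)"
    by (rule LBINT_eq_diff) (use has_vector_derivative_prim[OF cF] continuous_on_subset[OF cF] in auto)
  with e show "trans_op b Q (a 0) w x = u x + (prim (\<lambda>t. kernel ((x + t) / 2) ((x - t) / 2) * u t) x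
        - prim (\<lambda>t. kernel ((x + t) / 2) ((x - t) / 2) * u t) (- x))"
    by (simp add: F_def[abs_def])
  define G where "G = prim (\<lambda>s. F (2 * s - x))"
  have dG: "(G has_vector_derivative F (2 * s - x)) (at s within A)" for s A unfolding G_def
    by (intro has_vector_derivative_prim continuous_on_compose2[OF cF] continuous_intros) auto
  have "(LBINT t=ereal (-x)..ereal x. F t) = 2 * G ((x + x) / 2) - 2 * G ((- x + x) / 2)"
  proof (rule LBINT_eq_diff)
    fix t
    have "((\<lambda>t. (t + x) / 2) has_vector_derivative (1 / 2)) (at t within A)" for A
      by (auto intro!: derivative_eq_intros simp flip: has_real_derivative_iff_has_vector_derivative)
    from vector_diff_chain_within[OF this dG]
    have "((\<lambda>t. G ((t + x) / 2)) has_vector_derivative (1 / 2) *\<^sub>R F (2 * ((t + x) / 2) - x)) (at t within A)" for A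
      by (simp add: o_def)
    moreover have "2 * ((t + x) / 2) - x = t" by (simp add: field_simps)
    ultimately have "((\<lambda>t. G ((t + x) / 2)) has_vector_derivative (1 / 2) *\<^sub>R F t) (at t within A)" for A
      by simp
    from has_vector_derivative_mult_right[OF this, of 2]
    show "((\<lambda>t. 2 * G ((t + x) / 2)) has_vector_derivative F t) (at t within closed_segment (- x) x)"
      by (simp add: scaleR_conv_of_real)
  qed (rule continuous_on_subset[OF cF], simp)
  also have "\<dots> = 2 * prim (\<lambda>s. kernel s (x - s) * u (2 * s - x)) x"
  proof -
    have "(x + (2 * s - x)) / 2 = s" "(x - (2 * s - x)) / 2 = x - s" for s by (simp_all add: field_simps)
    then have "F (2 * s - x) = kernel s (x - s) * u (2 * s - x)" for s by (simp only: F_def)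
    then show ?thesis by (simp add: G_def)
  qed
  finally show "trans_op b Q (a 0) w x = T u x" using e by (simp add: T_def)
qed

end

section \<open>Norms of operators on continuous functions\<close>

lemma C_space_restrict: "continuous_on {-b..b} u \<Longrightarrow> restrict u {-b..b} \<in> C_space b"
  by (simp add: C_space_def cong: continuous_on_cong_simp)

lemma unorm_cong: "(\<And>x. x \<in> {-b..b} \<Longrightarrow> u x = w x) \<Longrightarrow> unorm b u = unorm b w"
  unfolding unorm_def by (rule SUP_cong) auto

lemma unorm_scale:
  assumes b: "0 < b" and cu: "continuous_on {-b..b} u" and c: "0 < c"
  shows "unorm b (\<lambda>x. of_real c * u x) = c * unorm b u"
proof (rule antisym)
  show "unorm b (\<lambda>x. of_real c * u x) \<le> c * unorm b u"
    using unorm_cmult_le[OF b cu, of "of_real c"] c by simp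
  have "unorm b (\<lambda>x. of_real (inverse c) * (of_real c * u x)) \<le> inverse c * unorm b (\<lambda>x. of_real c * u x)"
    using unorm_cmult_le[OF b, of "\<lambda>x. of_real c * u x" "of_real (inverse c)"] cu c
    by (simp add: continuous_on_mult_left norm_inverse)
  then show "c * unorm b u \<le> unorm b (\<lambda>x. of_real c * u x)"
    using c by (simp add: field_simps)
qed

text \<open>The operator norm is defined as a supremum of reals and is meaningful only for a bounded operator,
  whence the assumption of some bound \<open>M\<close>.\<close>

lemma opnorm_bound:
  assumes b: "0 < b"
    and A: "\<And>u. u \<in> C_space b \<Longrightarrow> A u \<in> C_space b"
    and hom: "\<And>u c x. u \<in> C_space b \<Longrightarrow> x \<in> {-b..b} \<Longrightarrow> A (\<lambda>x\<in>{-b..b}. of_real c * u x) x = of_real c * A u x"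
    and bd: "\<And>u. u \<in> C_space b \<Longrightarrow> unorm b (A u) \<le> M * unorm b u"
    and u: "u \<in> C_space b"
  shows "unorm b (A u) \<le> opnorm b A * unorm b u" and "0 \<le> opnorm b A"
proof -
  have cont: "continuous_on {-b..b} u" if "u \<in> C_space b" for u using that by (simp add: C_space_def)
  have bdd: "bdd_above ((\<lambda>u. unorm b (A u)) ` {u \<in> C_space b. unorm b u \<le> 1})"
  proof (rule bdd_aboveI2)
    fix u assume u: "u \<in> {u \<in> C_space b. unorm b u \<le> 1}"
    then have "unorm b (A u) \<le> M * unorm b u" using bd by simp
    also have "\<dots> \<le> \<bar>M\<bar> * unorm b u"
      using u unorm_nonneg[OF b cont] by (intro mult_right_mono) auto
    also have "\<dots> \<le> \<bar>M\<bar> * 1" using u by (intro mult_left_mono) auto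
    finally show "unorm b (A u) \<le> \<bar>M\<bar>" by simp
  qed
  have up: "unorm b (A u) \<le> opnorm b A" if "u \<in> C_space b" "unorm b u \<le> 1" for u
    unfolding opnorm_def using that by (intro cSUP_upper bdd) auto
  have z: "(\<lambda>x\<in>{-b..b}. 0) \<in> C_space b" by (intro C_space_restrict continuous_intros)
  have "unorm b (\<lambda>x\<in>{-b..b}. 0) \<le> 0" using b by (intro unorm_least) auto
  then have "unorm b (A (\<lambda>x\<in>{-b..b}. 0)) \<le> opnorm b A" using z by (intro up) auto
  then show "0 \<le> opnorm b A" using unorm_nonneg[OF b cont[OF A[OF z]]] by linarith
  show "unorm b (A u) \<le> opnorm b A * unorm b u"
  proof (cases "unorm b u = 0")
    case True
    then show ?thesis using bd[OF u] by simp
  next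
    case False
    then have p: "0 < unorm b u" using unorm_nonneg[OF b cont[OF u]] by simp
    define c where "c = inverse (unorm b u)"
    have c: "0 < c" using p by (simp add: c_def)
    define v where "v = (\<lambda>x\<in>{-b..b}. of_real c * u x)"
    have v: "v \<in> C_space b" unfolding v_def
      by (intro C_space_restrict continuous_intros cont u)
    have "unorm b v = unorm b (\<lambda>x. of_real c * u x)"
      by (rule unorm_cong) (simp add: v_def)
    then have "unorm b v = c * unorm b u"
      using unorm_scale[OF b cont[OF u] c] by simp
    then have "unorm b v = 1" using p by (simp add: c_def)
    then have "unorm b (A v) \<le> opnorm b A" using v up by simp
    moreover have "unorm b (A v) = unorm b (\<lambda>x. of_real c * A u x)"
      unfolding v_def by (rule unorm_cong) (rule hom[OF u])
    moreover note unorm_scale[OF b cont[OF A[OF u]] c]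
    ultimately have "c * unorm b (A u) \<le> opnorm b A" by simp
    then show ?thesis using p by (simp add: c_def field_simps)
  qed
qed

section \<open>The transmutation operator as an isomorphism\<close>

text \<open>Here \<open>F\<close> is the solution \<open>f\<close> or its reciprocal, with logarithmic derivative \<open>a\<close>. The potential \<open>Q\<close> is a
  separate parameter, prescribed on \<open>[-b,b]\<close> only, because \<open>a\<close> is an extension of that logarithmic
  derivative beyond the interval.\<close>

locale transmutation = first_order_goursat +
  fixes F Q :: "real \<Rightarrow> complex"
  assumes Q: "\<And>x. x \<in> {-b..b} \<Longrightarrow> Q x = a' x + (a x)\<^sup>2"
    and dF: "\<And>x. x \<in> {-b..b} \<Longrightarrow> (F has_vector_derivative a x * F x) (at x within {-b..b})"
    and F_nz: "\<And>x. x \<in> {-b..b} \<Longrightarrow> F x \<noteq> 0"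
    and F0: "F 0 = 1"
begin

definition Op :: "(real \<Rightarrow> complex) \<Rightarrow> real \<Rightarrow> complex" where
  "Op = trans_op b Q (a 0)"

abbreviation "I \<equiv> {-b..b}"

lemma I0: "0 \<in> I" using b by simp

lemma Op_eq_T:
  assumes "continuous_on UNIV u" "\<And>x. x \<in> I \<Longrightarrow> w x = u x" "x \<in> I"
  shows "Op w x = T u x"
  unfolding Op_def by (rule trans_op_eq_T(1)[OF Q assms])

lemma Op_eq_T_clamp:
  assumes "continuous_on I u" "x \<in> I"
  shows "Op u x = T (\<lambda>x. u (clip b x)) x"
  using continuous_on_clip_compose[OF b assms(1)] by (rule Op_eq_T) (use assms in auto)

lemma Op_ext: "Op u \<in> extensional I"
  by (simp add: Op_def trans_op_def)

lemma Op_mem: "continuous_on I u \<Longrightarrow> Op u \<in> C_space b"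
proof -
  assume u: "continuous_on I u"
  have "continuous_on I (Op u)"
    by (subst continuous_on_cong[OF refl Op_eq_T_clamp[OF u]])
       (use continuous_on_subset[OF continuous_on_T[OF continuous_on_clip_compose[OF b u]]] in auto)
  then show ?thesis using Op_ext by (simp add: C_space_def)
qed

lemma Op_linear:
  assumes "continuous_on I u" "continuous_on I w" "x \<in> I"
  shows "Op (\<lambda>x. u x + c * w x) x = Op u x + c * Op w x"
proof -
  have "Op (\<lambda>x. u x + c * w x) x = T (\<lambda>x. u (clip b x) + c * w (clip b x)) x"
    using assms by (intro Op_eq_T_clamp continuous_intros)
  also have "\<dots> = Op u x + c * Op w x"
    using T_linear[OF assms(1,2)[THEN continuous_on_clip_compose[OF b]]] Op_eq_T_clamp assms by simp
  finally show ?thesis .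
qed

lemma Op_cong:
  assumes e: "\<And>x. x \<in> I \<Longrightarrow> u x = w x" and w: "continuous_on I w" and x: "x \<in> I"
  shows "Op u x = Op w x"
proof -
  have "Op u x = T (\<lambda>x. w (clip b x)) x"
    using continuous_on_clip_compose[OF b w] by (rule Op_eq_T) (use e x in auto)
  then show ?thesis using Op_eq_T_clamp[OF w x] by simp
qed

lemma Op_scale:
  assumes "continuous_on I u" "x \<in> I"
  shows "Op (\<lambda>x\<in>I. c * u x) x = c * Op u x"
proof -
  have "Op (\<lambda>x\<in>I. c * u x) x = Op (\<lambda>x. u x + (c - 1) * u x) x"
    using assms by (intro Op_cong continuous_intros) (auto simp: algebra_simps)
  then show ?thesis using Op_linear[OF assms(1,1,2), of "c - 1"] by (simp add: algebra_simps)
qed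

text \<open>The integral part of the operator with the sign for which \<open>Op u = g\<close> reads \<open>u = g + V u\<close>.\<close>

definition V :: "(real \<Rightarrow> complex) \<Rightarrow> real \<Rightarrow> complex" where
  "V u x = u (clip b x) - T (\<lambda>x. u (clip b x)) x"

lemma Op_eq_V: "continuous_on I u \<Longrightarrow> x \<in> I \<Longrightarrow> Op u x = u x - V u x"
  using Op_eq_T_clamp by (simp add: V_def)

lemma volterra_V: "\<exists>M. volterra I (\<lambda>x. \<bar>x\<bar>) b M V"
proof -
  have "continuous_on ({-b..b} \<times> {-b..b}) (\<lambda>(u, v). kernel u v)"
    by (rule continuous_on_subset[OF continuous_kernel]) simp
  from compact_norm_bound[OF compact_Times[OF compact_Icc compact_Icc] this]
  obtain B where B0: "0 \<le> B" and B: "\<And>z. z \<in> {-b..b} \<times> {-b..b} \<Longrightarrow> norm (case z of (u, v) \<Rightarrow> kernel u v) \<le> B"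
    by blast
  have "volterra I (\<lambda>x. \<bar>x\<bar>) b (2 * B) V"
  proof
    fix u w :: "real \<Rightarrow> complex" and x assume u: "continuous_on I u"
    note cu = continuous_on_clip_compose[OF b u]
    show "continuous_on I (V u)" unfolding V_def
      by (intro continuous_on_diff continuous_on_subset[OF continuous_on_T[OF cu]] continuous_on_subset[OF cu]) auto
    { assume w: "continuous_on I w" and x: "x \<in> I"
      show "V (\<lambda>y. u y - w y) x = V u x - V w x"
        using T_linear[OF cu continuous_on_clip_compose[OF b w], of "-1" x]
        by (simp add: V_def algebra_simps) }
    { fix C n assume C: "0 \<le> C" and bd: "\<And>y. y \<in> I \<Longrightarrow> norm (u y) \<le> C * \<bar>y\<bar> ^ n" and x: "x \<in> I"
      define G where "G t = kernel ((x + t) / 2) ((x - t) / 2) * u (clip b t)" for t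
      have cG: "continuous_on UNIV G" unfolding G_def[abs_def]
        by (intro continuous_on_mult continuous_on_split[OF continuous_kernel] cu continuous_intros) auto
      have "norm (G t) \<le> (B * C) * \<bar>t\<bar> ^ n" if "\<bar>t\<bar> \<le> \<bar>x\<bar>" for t
      proof -
        have t: "t \<in> I" "((x + t) / 2, (x - t) / 2) \<in> {-b..b} \<times> {-b..b}"
          using that x by (auto simp: abs_le_iff)
        have "norm (kernel ((x + t) / 2) ((x - t) / 2) * u t) \<le> B * (C * \<bar>t\<bar> ^ n)"
          unfolding norm_mult using B[OF t(2)] bd[OF t(1)] B0 by (intro mult_mono) auto
        then show ?thesis using t(1) by (simp add: G_def)
      qed
      then have g: "norm (prim G y) \<le> B * C * \<bar>y\<bar> ^ Suc n / Suc n" if "\<bar>y\<bar> = \<bar>x\<bar>" for y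
        using that segment_abs_le by (intro prim_growth[OF cG]) auto
      have "V u x = - (prim G x - prim G (- x))"
        using trans_op_eq_T[OF Q cu _ x, of "\<lambda>x. u (clip b x)"] x by (simp add: V_def G_def[abs_def])
      then have "norm (V u x) \<le> norm (prim G x) + norm (prim G (- x))"
        by (metis norm_minus_cancel norm_triangle_ineq4)
      also have "\<dots> \<le> B * C * \<bar>x\<bar> ^ Suc n / Suc n + B * C * \<bar>x\<bar> ^ Suc n / Suc n"
        using g[of x] g[of "- x"] by (intro add_mono) auto
      finally show "norm (V u x) \<le> 2 * B * C * \<bar>x\<bar> ^ Suc n / real (Suc n)" by simp }
  qed (use b B0 in auto)
  then show ?thesis by blast
qed

text \<open>Bijectivity on \<open>C[-b,b]\<close> and boundedness in both directions, from the solution theory of the Volterra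
  equation \<open>u = g + V u\<close>.\<close>

lemma Op_inverse:
  obtains M where "\<And>g. g \<in> C_space b \<Longrightarrow> \<exists>!u. u \<in> C_space b \<and> Op u = g"
    "\<And>u. u \<in> C_space b \<Longrightarrow> unorm b u \<le> M * unorm b (Op u)"
    "\<And>u. u \<in> C_space b \<Longrightarrow> unorm b (Op u) \<le> M * unorm b u"
proof -
  obtain M where "volterra I (\<lambda>x. \<bar>x\<bar>) b M V" using volterra_V by blast
  then interpret volterra I "\<lambda>x. \<bar>x\<bar>" b M V .
  have ce: "continuous_on I u" if "u \<in> C_space b" for u using that by (simp add: C_space_def)
  have bd: "bounded (u ` I)" if "u \<in> C_space b" for u
    using ce[OF that] by (intro compact_imp_bounded compact_continuous_image) auto
  have inj: "u = w" if u: "u \<in> C_space b" and w: "w \<in> C_space b" and e: "\<And>x. x \<in> I \<Longrightarrow> Op u x = Op w x" for u w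
  proof (rule extensionalityI)
    fix x assume x: "x \<in> I"
    show "u x = w x"
    proof (rule unique[OF ce[OF u] ce[OF w] bd[OF u] bd[OF w] _ _ x, of "Op u"])
      fix y assume y: "y \<in> I"
      show "u y = Op u y + V u y" using Op_eq_V[OF ce[OF u] y] by simp
      show "w y = Op u y + V w y" using Op_eq_V[OF ce[OF w] y] e[OF y] by simp
    qed
  qed (use u w in \<open>auto simp: C_space_def\<close>)
  have sol: "\<exists>u. u \<in> C_space b \<and> Op u = g \<and> unorm b u \<le> exp (M * b) * unorm b g" if g: "g \<in> C_space b" for g
  proof -
    obtain w where w: "continuous_on I w" "\<And>x. x \<in> I \<Longrightarrow> w x = g x + V w x"
      "\<And>x. x \<in> I \<Longrightarrow> norm (w x) \<le> unorm b g * exp (M * b)"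
      using exists[OF ce[OF g] unorm_upper[OF ce[OF g]] unorm_nonneg[OF b ce[OF g]]] by blast
    define u where "u = restrict w I"
    have u: "u \<in> C_space b" unfolding u_def by (rule C_space_restrict[OF w(1)])
    have "Op u = g"
    proof (rule extensionalityI[OF Op_ext])
      show "g \<in> extensional I" using g by (simp add: C_space_def)
      fix x assume x: "x \<in> I"
      have "Op u x = Op w x" using x w(1) by (intro Op_cong) (auto simp: u_def)
      then show "Op u x = g x" using Op_eq_V[OF w(1) x] w(2)[OF x] by simp
    qed
    moreover have "unorm b u \<le> exp (M * b) * unorm b g"
      using b w(3) by (intro unorm_least) (auto simp: u_def mult.commute)
    ultimately show ?thesis using u by blast
  qed
  show thesis
  proof (rule that[of "max (exp (M * b)) (1 + M * b)"])
    fix u assume u: "u \<in> C_space b"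
    note n0 = unorm_nonneg[OF b ce[OF u]]
    have oc: "Op u \<in> C_space b" using Op_mem ce u by blast
    obtain u' where u': "u' \<in> C_space b" "Op u' = Op u" "unorm b u' \<le> exp (M * b) * unorm b (Op u)"
      using sol[OF oc] by blast
    have "u' = u" using inj[OF u'(1) u] u'(2) by simp
    then have "unorm b u \<le> exp (M * b) * unorm b (Op u)" using u' by simp
    also have "\<dots> \<le> max (exp (M * b)) (1 + M * b) * unorm b (Op u)"
      using unorm_nonneg[OF b ce[OF oc]] by (intro mult_right_mono) auto
    finally show "unorm b u \<le> max (exp (M * b)) (1 + M * b) * unorm b (Op u)" .
    have "unorm b (Op u) \<le> (1 + M * b) * unorm b u"
    proof (rule unorm_least[OF b])
      fix x assume x: "x \<in> I"
      have "norm (V u x) \<le> M * unorm b u * \<bar>x\<bar> ^ Suc 0 / Suc 0"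
        by (rule est[OF ce[OF u] n0 _ x]) (use unorm_upper[OF ce[OF u]] in auto)
      also have "\<dots> \<le> M * unorm b u * b" using x M n0 by (auto intro!: mult_left_mono)
      finally have "norm (V u x) \<le> M * b * unorm b u" by (simp add: mult_ac)
      moreover have "norm (Op u x) \<le> norm (u x) + norm (V u x)"
        unfolding Op_eq_V[OF ce[OF u] x] by (rule norm_triangle_ineq4)
      moreover have "norm (u x) \<le> unorm b u" by (rule unorm_upper[OF ce[OF u] x])
      ultimately show "norm (Op u x) \<le> (1 + M * b) * unorm b u"
        unfolding distrib_right by linarith
    qed
    also have "\<dots> \<le> max (exp (M * b)) (1 + M * b) * unorm b u"
      using n0 by (intro mult_right_mono) auto
    finally show "unorm b (Op u) \<le> max (exp (M * b)) (1 + M * b) * unorm b u" .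
  next
    fix g assume "g \<in> C_space b"
    then show "\<exists>!u. u \<in> C_space b \<and> Op u = g" using sol inj by metis
  qed
qed

lemma op_inv_Op:
  shows "g \<in> C_space b \<Longrightarrow> op_inv b Op g \<in> C_space b"
    and "g \<in> C_space b \<Longrightarrow> Op (op_inv b Op g) = g"
    and "u \<in> C_space b \<Longrightarrow> op_inv b Op (Op u) = u"
proof -
  obtain M where M: "\<And>g. g \<in> C_space b \<Longrightarrow> \<exists>!u. u \<in> C_space b \<and> Op u = g"
    using Op_inverse by metis
  { assume "g \<in> C_space b"
    then have "g \<in> Op ` C_space b" using M by blast
    then show "op_inv b Op g \<in> C_space b" "Op (op_inv b Op g) = g"
      unfolding op_inv_def by (rule inv_into_into, rule f_inv_into_f) }
  have "inj_on Op (C_space b)"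
  proof (rule inj_onI)
    fix u w assume "u \<in> C_space b" "w \<in> C_space b" "Op u = Op w"
    moreover from this have "Op w \<in> C_space b" using Op_mem by (simp add: C_space_def)
    ultimately show "u = w" using M[of "Op w"] by blast
  qed
  then show "u \<in> C_space b \<Longrightarrow> op_inv b Op (Op u) = u"
    unfolding op_inv_def by (simp add: inv_into_f_f)
qed

lemma opnorm_Op:
  shows "u \<in> C_space b \<Longrightarrow> unorm b (Op u) \<le> opnorm b Op * unorm b u"
    and "g \<in> C_space b \<Longrightarrow> unorm b (op_inv b Op g) \<le> opnorm b (op_inv b Op) * unorm b g"
    and "0 \<le> opnorm b Op" and "0 \<le> opnorm b (op_inv b Op)"
proof -
  obtain M where M: "\<And>u. u \<in> C_space b \<Longrightarrow> unorm b u \<le> M * unorm b (Op u)"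
    "\<And>u. u \<in> C_space b \<Longrightarrow> unorm b (Op u) \<le> M * unorm b u"
    using Op_inverse by metis
  have ce: "continuous_on I u" if "u \<in> C_space b" for u using that by (simp add: C_space_def)
  have z: "(\<lambda>x\<in>I. 0) \<in> C_space b" by (intro C_space_restrict continuous_intros)
  have A1: "\<And>u. u \<in> C_space b \<Longrightarrow> Op u \<in> C_space b" using Op_mem ce by blast
  have A2: "Op (\<lambda>x\<in>I. of_real c * u x) x = of_real c * Op u x" if "u \<in> C_space b" "x \<in> I" for u c x
    using Op_scale[OF ce] that by blast
  show "u \<in> C_space b \<Longrightarrow> unorm b (Op u) \<le> opnorm b Op * unorm b u"
    by (rule opnorm_bound(1)[OF b A1 A2 M(2)])
  show "0 \<le> opnorm b Op" by (rule opnorm_bound(2)[OF b A1 A2 M(2) z])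
  have B2: "op_inv b Op (\<lambda>x\<in>I. of_real c * g x) x = of_real c * op_inv b Op g x"
    if g: "g \<in> C_space b" and x: "x \<in> I" for g c x
  proof -
    note G = op_inv_Op(1)[OF g]
    define w where "w = (\<lambda>x\<in>I. of_real c * op_inv b Op g x)"
    have w: "w \<in> C_space b" unfolding w_def by (intro C_space_restrict continuous_intros ce G)
    have "Op w = (\<lambda>x\<in>I. of_real c * g x)"
    proof (rule extensionalityI[OF Op_ext])
      fix x assume x: "x \<in> I"
      have "Op w x = of_real c * Op (op_inv b Op g) x"
        unfolding w_def by (rule Op_scale[OF ce[OF G] x])
      then show "Op w x = (\<lambda>x\<in>I. of_real c * g x) x" using x op_inv_Op(2)[OF g] by simp
    qed simp
    then have "op_inv b Op (\<lambda>x\<in>I. of_real c * g x) = w" using op_inv_Op(3)[OF w] by simp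
    then show ?thesis using x by (simp add: w_def)
  qed
  have B3: "unorm b (op_inv b Op g) \<le> M * unorm b g" if "g \<in> C_space b" for g
    using M(1)[OF op_inv_Op(1)[OF that]] op_inv_Op(2)[OF that] by simp
  show "g \<in> C_space b \<Longrightarrow> unorm b (op_inv b Op g) \<le> opnorm b (op_inv b Op) * unorm b g"
    by (rule opnorm_bound(1)[OF b op_inv_Op(1) B2 B3])
  show "0 \<le> opnorm b (op_inv b Op)" by (rule opnorm_bound(2)[OF b op_inv_Op(1) B2 B3 z])
qed

end

section \<open>Formal powers, f-derivatives and best approximation\<close>

text \<open>Passing from \<open>F\<close> to its reciprocal exchanges the two families of formal powers. Therefore the
  functions \<open>\<psi>_k\<close> are the \<open>\<phi>_k\<close> of the reciprocal, and need no definition of their own.\<close>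

lemma Xtilde_inverse: "Xtilde (\<lambda>x. inverse (F x)) n = X F n"
  and X_inverse: "X (\<lambda>x. inverse (F x)) n = Xtilde F n"
proof -
  have e: "(inverse z) powi m = z powi (- m)" for z :: complex and m
    by (simp add: power_int_inverse power_int_minus)
  have "Xtilde (\<lambda>x. inverse (F x)) n = X F n \<and> X (\<lambda>x. inverse (F x)) n = Xtilde F n"
    by (induction n) (simp_all add: power_inverse e)
  then show "Xtilde (\<lambda>x. inverse (F x)) n = X F n" "X (\<lambda>x. inverse (F x)) n = Xtilde F n" by auto
qed

text \<open>The parity distinction in the definition disappears if each step also inverts \<open>F\<close>. This is the
  integrated form of \<open>F d/dx (\<phi>_{k+1} / F) = (k+1) \<psi>_k\<close>.\<close>

lemma phi_Suc:
  "phi F (Suc k) x = F x * (of_nat (Suc k) * (LBINT s=ereal 0..ereal x. phi (\<lambda>x. inverse (F x)) k s * inverse (F s)))"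
proof (cases "odd k")
  case True
  then have "phi (\<lambda>x. inverse (F x)) k s * inverse (F s) = Xtilde F k s * ((F s)\<^sup>2) powi ((- 1) ^ k)" for s
    by (simp add: phi_def X_inverse power_int_minus power2_eq_square mult_ac)
  then show ?thesis using True by (simp add: phi_def)
next
  case False
  then have "phi (\<lambda>x. inverse (F x)) k s * inverse (F s) = X F k s * ((F s)\<^sup>2) powi ((- 1) ^ Suc k)" for s
    by (simp add: phi_def Xtilde_inverse power_int_minus power2_eq_square mult_ac)
  then show ?thesis using False by (simp add: phi_def)
qed

context transmutation
begin

text \<open>The potential of the reflected problem is again a parameter, so that it can be given in
  the form in which \<open>T_D\<close> is defined.\<close>

lemma reflect_transmutation:
  assumes QD: "\<And>x. x \<in> I \<Longrightarrow> QD x = - a' x + (a x)\<^sup>2"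
  shows "transmutation b (\<lambda>x. - a x) (\<lambda>x. - a' x) S (\<lambda>u v. - D u v) Sv (\<lambda>u v. - Dv u v)
    (\<lambda>x. inverse (F x)) QD"
proof -
  have "((\<lambda>x. inverse (F x)) has_vector_derivative - a x * inverse (F x)) (at x within I)" if x: "x \<in> I" for x
  proof -
    have "(inverse has_field_derivative - (inverse (F x) ^ Suc (Suc 0))) (at (F x) within F ` I)"
      by (rule DERIV_inverse[OF F_nz[OF x]])
    from field_vector_diff_chain_within[OF dF[OF x] this]
    have "((\<lambda>x. inverse (F x)) has_vector_derivative a x * F x * - (inverse (F x) ^ Suc (Suc 0))) (at x within I)"
      by (simp add: o_def)
    then show ?thesis by (rule has_vector_derivative_eq_rhs) (use F_nz[OF x] in simp)
  qed
  then show ?thesis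
    using reflect F_nz F0 QD unfolding transmutation_def transmutation_axioms_def by simp
qed

lemma T_reflect: "first_order_goursat.T S (\<lambda>u v. - D u v) = T_dual"
  by (intro ext) (simp add: first_order_goursat.T_def[OF reflect] first_order_goursat.kernel_def[OF reflect]
      T_dual_def dual_kernel_def)

lemma T_dual_reflect: "first_order_goursat.T_dual S (\<lambda>u v. - D u v) = T"
  by (intro ext) (simp add: first_order_goursat.T_dual_def[OF reflect] first_order_goursat.dual_kernel_def[OF reflect]
      T_def kernel_def)

lemma T_dual_cmult: "T_dual (\<lambda>x. c * \<phi> x) x = c * T_dual \<phi> x"
  by (simp add: T_dual_def prim_cmult mult.left_commute[of _ c] distrib_left)

lemma continuous_on_F: "continuous_on I F"
  by (rule continuous_on_vector_derivative[OF dF])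

text \<open>The intertwining relation with \<open>d/dx - a\<close> written as \<open>F d/dx (1/F)\<close>.\<close>

lemma T_div_has_vector_derivative:
  assumes "\<And>x. (\<phi> has_vector_derivative \<phi>' x) (at x)" "continuous_on UNIV \<phi>'" "x \<in> I"
  shows "((\<lambda>x. T \<phi> x * inverse (F x)) has_vector_derivative T_dual \<phi>' x * inverse (F x)) (at x within I)"
proof -
  interpret R: transmutation b "\<lambda>x. - a x" "\<lambda>x. - a' x" S "\<lambda>u v. - D u v" Sv "\<lambda>u v. - Dv u v"
    "\<lambda>x. inverse (F x)" "\<lambda>x. - a' x + (a x)\<^sup>2"
    by (rule reflect_transmutation) simp
  have "((\<lambda>x. T \<phi> x * inverse (F x)) has_vector_derivative
      T \<phi> x * (- a x * inverse (F x)) + (a x * T \<phi> x + T_dual \<phi>' x) * inverse (F x)) (at x within I)"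
    by (intro has_vector_derivative_mult R.dF has_vector_derivative_at_within[OF T_has_vector_derivative] assms)
  then show ?thesis by (simp add: algebra_simps)
qed

text \<open>By the intertwining relation \<open>T x^{k+1} / F\<close> has the derivative \<open>(k+1) T_D x^k / F\<close>, and it vanishes
  at \<open>0\<close>; the recursion for \<open>\<phi>_{k+1}\<close> says the same.\<close>

lemma T_monomial_Suc:
  assumes IH: "\<And>x. x \<in> I \<Longrightarrow> T_dual (\<lambda>x. of_real x ^ k) x = phi (\<lambda>x. inverse (F x)) k x" and x: "x \<in> I"
  shows "T (\<lambda>x. of_real x ^ Suc k) x = phi F (Suc k) x"
proof -
  define h where "h y = T (\<lambda>x. of_real x ^ Suc k) y * inverse (F y)" for y
  have seg: "closed_segment 0 x \<subseteq> I" using x I0 by (simp add: closed_segment_subset)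
  have d1: "((\<lambda>x. complex_of_real x ^ Suc k) has_vector_derivative of_nat (Suc k) * of_real y ^ k) (at y)" for y
  proof -
    have "((\<lambda>z. z ^ Suc k) has_field_derivative of_nat (Suc k) * complex_of_real y ^ k) (at (of_real y) within range of_real)"
      by (auto intro!: derivative_eq_intros simp del: power_Suc)
    from field_vector_diff_chain_within[OF has_vector_derivative_of_real[OF DERIV_ident] this]
    show ?thesis by (simp add: o_def)
  qed
  have dh: "(h has_vector_derivative of_nat (Suc k) * (phi (\<lambda>x. inverse (F x)) k y * inverse (F y))) (at y within I)"
    if y: "y \<in> I" for y
  proof -
    have "(h has_vector_derivative T_dual (\<lambda>x. of_nat (Suc k) * of_real x ^ k) y * inverse (F y)) (at y within I)"
      unfolding h_def by (rule T_div_has_vector_derivative[OF d1 _ y]) (intro continuous_intros)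
    then show ?thesis using IH[OF y] by (simp only: T_dual_cmult mult.assoc)
  qed
  have c: "continuous_on I (\<lambda>y. phi (\<lambda>x. inverse (F x)) k y * inverse (F y))"
    by (intro continuous_on_mult continuous_on_phi b continuous_on_inverse continuous_on_F) (use F_nz in auto)
  have "(LBINT s=ereal 0..ereal x. of_nat (Suc k) * (phi (\<lambda>x. inverse (F x)) k s * inverse (F s))) = h x - h 0"
  proof (rule LBINT_eq_diff)
    show "continuous_on (closed_segment 0 x) (\<lambda>s. of_nat (Suc k) * (phi (\<lambda>x. inverse (F x)) k s * inverse (F s)))"
      by (intro continuous_on_mult_left continuous_on_subset[OF c seg])
    fix s assume "s \<in> closed_segment 0 x"
    then show "(h has_vector_derivative of_nat (Suc k) * (phi (\<lambda>x. inverse (F x)) k s * inverse (F s)))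
        (at s within closed_segment 0 x)"
      using seg by (intro has_vector_derivative_within_subset[OF dh seg]) blast
  qed
  also have "h 0 = 0" by (simp add: h_def)
  finally have "of_nat (Suc k) * (LBINT s=ereal 0..ereal x. phi (\<lambda>x. inverse (F x)) k s * inverse (F s)) = h x"
    by (simp only: interval_lebesgue_integral_mult_right diff_zero)
  then show ?thesis unfolding phi_Suc using F_nz[OF x] by (simp only: h_def) simp
qed

lemma T_one: "x \<in> I \<Longrightarrow> T (\<lambda>x. 1) x = F x"
proof -
  assume x: "x \<in> I"
  have seg: "closed_segment 0 x \<subseteq> I" using x I0 by (simp add: closed_segment_subset)
  have "((\<lambda>x. T (\<lambda>x. 1) x * inverse (F x)) has_vector_derivative 0) (at y within closed_segment 0 x)" if "y \<in> closed_segment 0 x" for y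
  proof -
    have y: "y \<in> I" using seg that by blast
    have "((\<lambda>x. T (\<lambda>x. 1) x * inverse (F x)) has_vector_derivative T_dual (\<lambda>x. 0) y * inverse (F y)) (at y within I)"
      by (rule T_div_has_vector_derivative[OF _ _ y]) auto
    from has_vector_derivative_within_subset[OF this seg] show ?thesis by (simp add: T_dual_def)
  qed
  from prim_FTC[OF this continuous_on_const] have "T (\<lambda>x. 1) x * inverse (F x) = 1"
    using F0 by simp
  then show ?thesis using F_nz[OF x] by (simp add: field_simps)
qed

text \<open>The induction step for one operator uses the induction hypothesis for the other one.\<close>

lemma T_monomial:
  "(\<forall>x\<in>I. T (\<lambda>x. of_real x ^ k) x = phi F k x) \<and> (\<forall>x\<in>I. T_dual (\<lambda>x. of_real x ^ k) x = phi (\<lambda>x. inverse (F x)) k x)"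
proof -
  interpret R: transmutation b "\<lambda>x. - a x" "\<lambda>x. - a' x" S "\<lambda>u v. - D u v" Sv "\<lambda>u v. - Dv u v"
    "\<lambda>x. inverse (F x)" "\<lambda>x. - a' x + (a x)\<^sup>2"
    by (rule reflect_transmutation) simp
  show ?thesis
  proof (induction k)
    case 0
    then show ?case using T_one R.T_one by (simp add: T_reflect phi_def)
  next
    case (Suc k)
    then show ?case
      using T_monomial_Suc[of k] R.T_monomial_Suc[of k] unfolding T_reflect T_dual_reflect by simp
  qed
qed

lemma T_polynomial:
  assumes x: "x \<in> I"
  shows "T (\<lambda>x. \<Sum>k\<le>n. c k * of_real x ^ k) x = (\<Sum>k\<le>n. c k * phi F k x)"
proof (induction n)
  case 0
  have "T (\<lambda>x. 0 + c 0 * of_real x ^ 0) x = T (\<lambda>x. 0) x + c 0 * T (\<lambda>x. of_real x ^ 0) x"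
    by (rule T_linear) (intro continuous_intros)+
  then show ?case using T_monomial[of 0] x by (simp add: T_def)
next
  case (Suc n)
  have "T (\<lambda>x. (\<Sum>k\<le>n. c k * of_real x ^ k) + c (Suc n) * of_real x ^ Suc n) x =
      T (\<lambda>x. \<Sum>k\<le>n. c k * of_real x ^ k) x + c (Suc n) * T (\<lambda>x. of_real x ^ Suc n) x"
    by (rule T_linear) (intro continuous_intros)+
  then show ?case using Suc T_monomial[of "Suc n"] x by simp
qed

text \<open>The inverse operators turn the derivation \<open>F d/dx (1/F)\<close>, here taking \<open>g\<close> to \<open>e\<close>, into \<open>d/dx\<close>. The function
  \<open>\<phi>\<close> with derivative \<open>T_D^{-1} e\<close> and the initial value of \<open>g\<close> satisfies \<open>F d/dx (T \<phi> / F) = e\<close> and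
  \<open>T \<phi> (0) = g(0)\<close>, hence \<open>T \<phi> = g\<close>.\<close>

lemma op_inv_has_vector_derivative:
  assumes QD: "\<And>x. x \<in> I \<Longrightarrow> QD x = - a' x + (a x)\<^sup>2"
    and cg: "continuous_on I g" and ce: "continuous_on I e"
    and d: "\<And>x. x \<in> I \<Longrightarrow> ((\<lambda>x. g x * inverse (F x)) has_vector_derivative e x * inverse (F x)) (at x within I)"
    and x: "x \<in> I"
  shows "(op_inv b Op (restrict g I) has_vector_derivative
      op_inv b (trans_op b QD (- a 0)) (restrict e I) x) (at x within I)"
proof -
  interpret R: transmutation b "\<lambda>x. - a x" "\<lambda>x. - a' x" S "\<lambda>u v. - D u v" Sv "\<lambda>u v. - Dv u v"
    "\<lambda>x. inverse (F x)" QD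
    by (rule reflect_transmutation[OF QD])
  define E where "E = op_inv b R.Op (restrict e I)"
  have e: "restrict e I \<in> C_space b" by (rule C_space_restrict[OF ce])
  have E: "E \<in> C_space b" "R.Op E = restrict e I"
    unfolding E_def by (rule R.op_inv_Op[OF e])+
  then have cE: "continuous_on I E" by (simp add: C_space_def)
  define \<phi>' where "\<phi>' = (\<lambda>x. E (clip b x))"
  have c\<phi>': "continuous_on UNIV \<phi>'" unfolding \<phi>'_def by (rule continuous_on_clip_compose[OF b cE])
  define \<phi> where "\<phi> = (\<lambda>x. g 0 + prim \<phi>' x)"
  have d\<phi>: "(\<phi> has_vector_derivative \<phi>' x) (at x within A)" for x A
    unfolding \<phi>_def using has_vector_derivative_add[OF has_vector_derivative_const has_vector_derivative_prim[OF c\<phi>']] by simp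
  have c\<phi>: "continuous_on A \<phi>" for A by (rule continuous_on_vector_derivative[OF d\<phi>])
  have Te: "T_dual \<phi>' y = e y" if y: "y \<in> I" for y
    using R.Op_eq_T_clamp[OF cE y] y E(2) by (simp add: T_reflect \<phi>'_def)
  have Tg: "T \<phi> y = g y" if y: "y \<in> I" for y
  proof -
    have seg: "closed_segment 0 y \<subseteq> I" using y I0 by (simp add: closed_segment_subset)
    have "((\<lambda>x. T \<phi> x * inverse (F x) - g x * inverse (F x)) has_vector_derivative 0) (at s within closed_segment 0 y)"
      if s: "s \<in> closed_segment 0 y" for s
    proof -
      have sI: "s \<in> I" using s seg by blast
      have "((\<lambda>x. T \<phi> x * inverse (F x) - g x * inverse (F x)) has_vector_derivative
          T_dual \<phi>' s * inverse (F s) - e s * inverse (F s)) (at s within I)"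
        by (intro has_vector_derivative_diff d sI T_div_has_vector_derivative d\<phi> c\<phi>')
      from has_vector_derivative_within_subset[OF this seg] show ?thesis using Te[OF sI] by simp
    qed
    from prim_FTC[OF this continuous_on_const] have "T \<phi> y * inverse (F y) = g y * inverse (F y)"
      by (simp add: \<phi>_def)
    then show ?thesis using F_nz[OF y] by simp
  qed
  have "Op (restrict \<phi> I) = restrict g I"
  proof (rule extensionalityI[OF Op_ext])
    fix y assume y: "y \<in> I"
    have "Op (restrict \<phi> I) y = T \<phi> y" using y by (intro Op_eq_T c\<phi>) auto
    then show "Op (restrict \<phi> I) y = restrict g I y" using Tg[OF y] y by simp
  qed simp
  then have inv: "op_inv b Op (restrict g I) = restrict \<phi> I"
    using op_inv_Op(3)[OF C_space_restrict[OF c\<phi>]] by metis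
  have "op_inv b (trans_op b QD (- a 0)) (restrict e I) x = \<phi>' x"
    using x by (simp add: E_def[symmetric] R.Op_def[symmetric] \<phi>'_def)
  moreover have "(restrict \<phi> I has_vector_derivative \<phi>' x) (at x within I)"
    by (rule has_vector_derivative_transform[OF x _ d\<phi>]) simp
  ultimately show ?thesis unfolding inv by simp
qed

text \<open>Transport of polynomial approximation: \<open>T p\<close> is a combination of \<open>\<phi>_0, \<dots>, \<phi>_n\<close>, and the error is the
  image under \<open>T\<close> of the error of \<open>p\<close>.\<close>

lemma best_approx_le:
  assumes cg: "continuous_on I g" and p: "degree p \<le> n"
    and bd: "\<And>x. x \<in> I \<Longrightarrow> norm (op_inv b Op (restrict g I) x - poly p (of_real x)) \<le> \<delta>"
  shows "best_approx b F n g \<le> opnorm b Op * \<delta>"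
proof -
  define u where "u = op_inv b Op (restrict g I)"
  have g: "restrict g I \<in> C_space b" by (rule C_space_restrict[OF cg])
  have u: "u \<in> C_space b" "Op u = restrict g I" unfolding u_def by (rule op_inv_Op[OF g])+
  then have cu: "continuous_on I u" by (simp add: C_space_def)
  have pe: "poly p (of_real x) = (\<Sum>k\<le>n. coeff p k * of_real x ^ k)" for x
  proof -
    have "(\<Sum>k\<le>degree p. coeff p k * of_real x ^ k) = (\<Sum>k\<le>n. coeff p k * of_real x ^ k)"
      by (rule sum.mono_neutral_left) (use p in \<open>auto simp: coeff_eq_0\<close>)
    then show ?thesis by (simp add: poly_altdef)
  qed
  define h where "h x = (\<Sum>k\<le>n. coeff p k * phi F k x)" for x
  have h: "h \<in> Phi F n"
    unfolding Phi_def by (rule range_eqI[of _ _ "coeff p"]) (simp add: h_def fun_eq_iff)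
  define w where "w = (\<lambda>x. u x + (- 1) * poly p (of_real x))"
  have cp: "continuous_on A (\<lambda>x. poly p (complex_of_real x))" for A by (intro continuous_intros)
  have cw: "continuous_on I w" unfolding w_def by (intro continuous_intros cu)
  have gh: "g x - h x = Op (restrict w I) x" if x: "x \<in> I" for x
  proof -
    have "Op (restrict w I) x = Op w x" by (rule Op_cong[OF _ cw x]) simp
    also have "\<dots> = Op u x + (- 1) * Op (\<lambda>x. poly p (of_real x)) x"
      unfolding w_def by (rule Op_linear[OF cu cp x])
    also have "Op (\<lambda>x. poly p (of_real x)) x = T (\<lambda>x. poly p (of_real x)) x"
      by (rule Op_eq_T[OF cp _ x]) simp
    also have "\<dots> = h x" unfolding pe h_def by (rule T_polynomial[OF x])
    finally have e: "Op (restrict w I) x = Op u x + (- 1) * h x" .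
    have "Op u x = g x" using u(2) x by simp
    then show ?thesis unfolding e by simp
  qed
  have ch: "continuous_on I h" unfolding h_def
    by (intro continuous_intros continuous_on_phi b continuous_on_F F_nz)
  have "best_approx b F n g \<le> unorm b (\<lambda>x. g x - h x)"
    unfolding best_approx_def
  proof (rule cINF_lower[OF bdd_belowI2[of _ 0] h])
    fix h' assume "h' \<in> Phi F n"
    then have "continuous_on I h'" unfolding Phi_def
      by (auto intro!: continuous_intros continuous_on_phi b continuous_on_F F_nz)
    then show "0 \<le> unorm b (\<lambda>x. g x - h' x)" by (intro unorm_nonneg b continuous_intros cg)
  qed
  also have "\<dots> = unorm b (Op (restrict w I))" by (rule unorm_cong[OF gh])
  also have "\<dots> \<le> opnorm b Op * unorm b (restrict w I)"
    by (rule opnorm_Op(1)[OF C_space_restrict[OF cw]])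
  also have "\<dots> \<le> opnorm b Op * \<delta>"
    using bd b by (intro mult_left_mono unorm_least opnorm_Op(3)) (auto simp: w_def u_def)
  finally show ?thesis .
qed

end

section \<open>Approximation of the sawtooth in the mean\<close>

text \<open>A closed form of the error in interpolating \<open>sin x / (2 (cosh t - cos x))\<close> at the zeros of \<open>sin (N x)\<close>
  by a sine polynomial of degree less than \<open>N\<close>: after division by \<open>sinh (N t)\<close> the sum on the left is the
  interpolant and the last term the error, whose sign is visibly that of \<open>sin (N x)\<close>. The product formulas for \<open>cosh\<close> and
  \<open>cos\<close> make the sum telescope.\<close>

lemma sinh_sin_sum:
  fixes t x :: real
  shows "2 * (cosh t - cos x) * (\<Sum>k<N. sinh ((real N - real k) * t) * sin (real k * x)) =
    sin x * sinh (real N * t) - sin (real N * x) * sinh t"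
proof -
  define U where "U k = sinh ((real N - real k + 1) * t) * sin (real k * x)
      - sinh ((real N - real k) * t) * sin ((real k - 1) * x)" for k :: nat
  have "2 * (cosh t - cos x) * (sinh ((real N - real k) * t) * sin (real k * x)) = U k - U (Suc k)" for k
  proof -
    define p r where "p = (real N - real k) * t" and "r = real k * x"
    have "U k = sinh (p + t) * sin r - sinh p * sin (r - x)"
      by (simp add: U_def p_def r_def algebra_simps)
    moreover have "U (Suc k) = sinh p * sin (r + x) - sinh (p - t) * sin r"
      by (simp add: U_def p_def r_def algebra_simps)
    ultimately show ?thesis
      unfolding p_def[symmetric] r_def[symmetric]
      by (simp add: sinh_add sinh_diff sin_add sin_diff algebra_simps)
  qed
  then have "2 * (cosh t - cos x) * (\<Sum>k<N. sinh ((real N - real k) * t) * sin (real k * x)) = U 0 - U N"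
    by (simp add: sum_distrib_left sum_lessThan_telescope')
  also have "\<dots> = sin x * sinh (real N * t) - sin (real N * x) * sinh t"
    by (simp add: U_def algebra_simps)
  finally show ?thesis .
qed

lemma arctan_tan_half:
  assumes "0 < x" "x < pi"
  shows "arctan ((1 - cos x) / sin x) = x / 2"
proof -
  have s: "sin (x/2) > 0" "cos (x/2) > 0" using assms by (auto intro!: sin_gt_zero cos_gt_zero_pi)
  have "1 - cos x = 2 * sin (x/2) * sin (x/2)" using cos_double_sin[of "x/2"] by (simp add: power2_eq_square)
  moreover have "sin x = 2 * sin (x/2) * cos (x/2)" using sin_double[of "x/2"] by simp
  ultimately have "(1 - cos x) / sin x = tan (x/2)" using s by (simp add: tan_def)
  then show ?thesis using assms by (simp add: arctan_tan)
qed

text \<open>The sawtooth is the integral over \<open>t > 0\<close> of the functions \<open>sin x / (2 (cosh t - cos x))\<close>, whose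
  primitive in \<open>t\<close> is \<open>arctan ((exp t - cos x) / sin x)\<close>. The sign of the interpolation error is the same for every \<open>t\<close> and so
  passes to the integral. Improper integrals are avoided by integrating over \<open>[1/(m+1), m+1]\<close> and letting
  \<open>m\<close> tend to infinity; the coefficients converge, being increasing in \<open>m\<close> and bounded by the integral of \<open>exp (-t)\<close>.\<close>

lemma sawtooth_interpolation:
  assumes N: "0 < N"
  obtains c :: "nat \<Rightarrow> real" where
    "\<And>x. 0 < x \<Longrightarrow> x < pi \<Longrightarrow>
      0 \<le> ((pi - x) / 2 - (\<Sum>k\<in>{1..<N}. c k * sin (real k * x))) * sin (real N * x)"
proof -
  \<comment> \<open>The coefficient of \<open>sin (k x)\<close> in the interpolant for the parameter \<open>t\<close>.\<close>
  define \<beta> where "\<beta> k t = sinh ((real N - real k) * t) / sinh (real N * t)" for k t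
  define \<delta> where "\<delta> m = 1 / real (Suc m)" for m
  define L where "L m = real (Suc m)" for m
  define c where "c m k = integral {\<delta> m..L m} (\<beta> k)" for m k
  have \<delta>: "0 < \<delta> m" "\<delta> m \<le> L m" for m
    by (auto simp: \<delta>_def L_def field_simps)
  have c\<beta>: "continuous_on {\<delta> m..L m} (\<beta> k)" for m k
  proof -
    have "sinh (real N * t) \<noteq> 0" if "t \<in> {\<delta> m..L m}" for t
      using that \<delta>[of m] N by auto
    then show ?thesis unfolding \<beta>_def[abs_def]
      by (intro continuous_intros) auto
  qed
  have \<beta>0: "0 \<le> \<beta> k t" and \<beta>1: "\<beta> k t \<le> exp (- t)" if k: "k \<in> {1..<N}" and t: "0 < t" for k t
  proof -
    have p: "0 < sinh (real N * t)" using N t by simp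
    show "0 \<le> \<beta> k t" unfolding \<beta>_def using p k t by (intro divide_nonneg_pos) auto
    have "sinh ((real N - real k) * t) \<le> exp (- (real k * t)) * sinh (real N * t)"
    proof -
      have "exp (- (real k * t)) * exp (real N * t) = exp ((real N - real k) * t)"
        by (simp add: exp_add[symmetric] algebra_simps)
      moreover have "exp (- (real k * t)) * exp (- (real N * t)) \<le> exp (- ((real N - real k) * t))"
        using t by (simp add: exp_add[symmetric] algebra_simps)
      ultimately show ?thesis by (simp add: sinh_field_def right_diff_distrib diff_divide_distrib)
    qed
    also have "\<dots> \<le> exp (- t) * sinh (real N * t)"
      using k t p by (intro mult_right_mono) (auto simp: less_imp_le)
    finally show "\<beta> k t \<le> exp (- t)" unfolding \<beta>_def using p by (simp add: field_simps)
  qed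
  have "\<exists>l. (\<lambda>m. c m k) \<longlonglongrightarrow> l" if k: "k \<in> {1..<N}" for k
  proof -
    have "incseq (\<lambda>m. c m k)"
    proof (rule incseq_SucI)
      fix m
      have "{\<delta> m..L m} \<subseteq> {\<delta> (Suc m)..L (Suc m)}" by (auto simp: \<delta>_def L_def frac_le)
      then show "c m k \<le> c (Suc m) k" unfolding c_def
        using \<beta>0[OF k] \<delta>[of "Suc m"]
        by (intro integral_subset_le integrable_continuous_real c\<beta>) force+
    qed
    moreover have "c m k \<le> 1" for m
    proof -
      have "((\<lambda>t. exp (- t)) has_integral ((- exp (- L m)) - (- exp (- \<delta> m)))) {\<delta> m..L m}"
        by (intro fundamental_theorem_of_calculus)
           (use \<delta> in \<open>auto intro!: derivative_eq_intros simp flip: has_real_derivative_iff_has_vector_derivative\<close>)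
      moreover have "exp (- \<delta> m) - exp (- L m) \<le> 1 - 0" using \<delta>(1)[of m] by (intro diff_mono) auto
      ultimately have "integral {\<delta> m..L m} (\<lambda>t. exp (- t)) \<le> 1"
        by (simp add: integral_unique)
      moreover have "c m k \<le> integral {\<delta> m..L m} (\<lambda>t. exp (- t))"
        unfolding c_def using \<delta>[of m]
        by (intro integral_le integrable_continuous_real c\<beta> continuous_intros \<beta>1[OF k]) auto
      ultimately show ?thesis by simp
    qed
    ultimately show ?thesis by (meson incseq_convergent)
  qed
  then obtain c' where c': "\<And>k. k \<in> {1..<N} \<Longrightarrow> (\<lambda>m. c m k) \<longlonglongrightarrow> c' k" by metis
  have frac: "X / A - B = Y / (A * s)" if "0 < A" "0 < s" "A * (s * B) = X * s - Y" for A s B X Y :: real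
  proof -
    have Y: "Y = s * (X - A * B)" using that(3) by (simp add: algebra_simps)
    show ?thesis unfolding Y using that(1,2) by (simp add: field_simps)
  qed
  show thesis
  proof
    fix x :: real assume x: "0 < x" "x < pi"
    have sx: "0 < sin x" using x by (rule sin_gt_zero)
    define A where "A t = arctan ((exp t - cos x) / sin x)" for t
    have dA: "(A has_real_derivative sin x / (2 * (cosh t - cos x))) (at t within S)" for t S
    proof -
      have e1: "1 + ((exp t - cos x) / sin x)\<^sup>2 = (1 - 2 * exp t * cos x + (exp t)\<^sup>2) / (sin x)\<^sup>2"
        using sx sin_cos_squared_add[of x] by (simp add: field_simps power2_eq_square) 
      have e2: "2 * (cosh t - cos x) * exp t = 1 - 2 * exp t * cos x + (exp t)\<^sup>2"
        by (simp add: cosh_field_def exp_minus field_simps power2_eq_square)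
      have ne: "1 + ((exp t - cos x) / sin x)\<^sup>2 > 0" by (simp add: add_pos_nonneg)
      then have ne': "1 - 2 * exp t * cos x + (exp t)\<^sup>2 \<noteq> 0" unfolding e1 by auto
      have "(A has_real_derivative inverse (1 + ((exp t - cos x) / sin x)\<^sup>2) * (exp t / sin x)) (at t within S)"
        unfolding A_def[abs_def] using sx by (auto intro!: derivative_eq_intros)
      also have "inverse (1 + ((exp t - cos x) / sin x)\<^sup>2) * (exp t / sin x) = sin x / (2 * (cosh t - cos x))"
      proof -
        have "2 * (cosh t - cos x) \<noteq> 0" using e2 ne' by auto
        then show ?thesis unfolding e1 e2[symmetric] using sx by (simp add: field_simps power2_eq_square)
      qed
      finally show ?thesis .
    qed
    have fin: "0 \<le> ((A (L m) - A (\<delta> m)) - (\<Sum>k\<in>{1..<N}. c m k * sin (real k * x))) * sin (real N * x)" for m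
    proof -
      have i1: "((\<lambda>t. sin x / (2 * (cosh t - cos x))) has_integral (A (L m) - A (\<delta> m))) {\<delta> m..L m}"
        by (intro fundamental_theorem_of_calculus)
           (use \<delta> dA in \<open>auto simp flip: has_real_derivative_iff_has_vector_derivative\<close>)
      have i2: "((\<lambda>t. \<Sum>k\<in>{1..<N}. \<beta> k t * sin (real k * x)) has_integral
          (\<Sum>k\<in>{1..<N}. c m k * sin (real k * x))) {\<delta> m..L m}"
        unfolding c_def
        by (intro has_integral_sum has_integral_mult_left integrable_integral integrable_continuous_real c\<beta>) auto
      have i3: "((\<lambda>t. (sin x / (2 * (cosh t - cos x)) - (\<Sum>k\<in>{1..<N}. \<beta> k t * sin (real k * x))) * sin (real N * x))
        has_integral ((A (L m) - A (\<delta> m)) - (\<Sum>k\<in>{1..<N}. c m k * sin (real k * x))) * sin (real N * x)) {\<delta> m..L m}"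
        by (intro has_integral_mult_left has_integral_diff i1 i2)
      show ?thesis
      proof (rule has_integral_nonneg[OF i3])
        fix t assume "t \<in> {\<delta> m..L m}"
        then have t: "0 < t" using \<delta>[of m] by auto
        have p: "0 < sinh (real N * t)" "0 < sinh t" using N t by auto
        have "1 < cosh t" using t cosh_real_strict_mono[of 0 t] by simp
        then have "cos x < cosh t" using cos_le_one[of x] by (rule le_less_trans[rotated])
        then have q: "0 < 2 * (cosh t - cos x)" by simp
        have "(\<Sum>k<N. sinh ((real N - real k) * t) * sin (real k * x)) =
            (\<Sum>k\<in>{1..<N}. sinh ((real N - real k) * t) * sin (real k * x))"
          by (rule sum.mono_neutral_right) (use N in \<open>auto simp: not_le\<close>)
        also have "\<dots> = sinh (real N * t) * (\<Sum>k\<in>{1..<N}. \<beta> k t * sin (real k * x))"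
          using p by (simp add: \<beta>_def sum_distrib_left)
        finally have "2 * (cosh t - cos x) * (sinh (real N * t) * (\<Sum>k\<in>{1..<N}. \<beta> k t * sin (real k * x)))
            = sin x * sinh (real N * t) - sin (real N * x) * sinh t"
          using sinh_sin_sum[of t x N] by simp
        then have "sin x / (2 * (cosh t - cos x)) - (\<Sum>k\<in>{1..<N}. \<beta> k t * sin (real k * x))
            = sin (real N * x) * sinh t / (2 * (cosh t - cos x) * sinh (real N * t))"
          using frac[OF q p(1)] by simp
        then have "(sin x / (2 * (cosh t - cos x)) - (\<Sum>k\<in>{1..<N}. \<beta> k t * sin (real k * x))) * sin (real N * x)
            = (sin (real N * x))\<^sup>2 * (sinh t / (2 * (cosh t - cos x) * sinh (real N * t)))"
          by (simp add: power2_eq_square)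
        also have "\<dots> \<ge> 0" using p q by (intro mult_nonneg_nonneg divide_nonneg_pos) auto
        finally show "0 \<le> (sin x / (2 * (cosh t - cos x)) - (\<Sum>k\<in>{1..<N}. \<beta> k t * sin (real k * x))) * sin (real N * x)" .
      qed
    qed
    have lL: "(\<lambda>m. A (L m)) \<longlonglongrightarrow> pi / 2"
    proof -
      have "filterlim L at_top sequentially" unfolding L_def
        by (rule filterlim_compose[OF filterlim_real_sequentially filterlim_Suc])
      then have "filterlim (\<lambda>m. exp (L m)) at_top sequentially"
        by (rule filterlim_compose[OF exp_at_top])
      then have "filterlim (\<lambda>m. - cos x + exp (L m)) at_top sequentially"
        by (rule filterlim_tendsto_add_at_top[OF tendsto_const])
      then have "filterlim (\<lambda>m. inverse (sin x) * (- cos x + exp (L m))) at_top sequentially"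
        by (rule filterlim_tendsto_pos_mult_at_top[OF tendsto_const, rotated]) (use sx in auto)
      then have "(\<lambda>m. arctan (inverse (sin x) * (- cos x + exp (L m)))) \<longlonglongrightarrow> pi / 2"
        by (rule filterlim_compose[OF tendsto_arctan_at_top])
      then show ?thesis by (simp add: A_def field_simps)
    qed
    have l\<delta>: "(\<lambda>m. A (\<delta> m)) \<longlonglongrightarrow> x / 2"
    proof -
      have "\<delta> \<longlonglongrightarrow> 0" unfolding \<delta>_def[abs_def] using LIMSEQ_inverse_real_of_nat by (simp add: inverse_eq_divide)
      then have "(\<lambda>m. A (\<delta> m)) \<longlonglongrightarrow> arctan ((exp 0 - cos x) / sin x)"
        unfolding A_def using sx by (intro tendsto_intros) auto
      then show ?thesis using arctan_tan_half[OF x] by simp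
    qed
    have "(\<lambda>m. ((A (L m) - A (\<delta> m)) - (\<Sum>k\<in>{1..<N}. c m k * sin (real k * x))) * sin (real N * x))
      \<longlonglongrightarrow> ((pi / 2 - x / 2) - (\<Sum>k\<in>{1..<N}. c' k * sin (real k * x))) * sin (real N * x)"
      by (intro tendsto_intros lL l\<delta> c')
    then have "0 \<le> ((pi / 2 - x / 2) - (\<Sum>k\<in>{1..<N}. c' k * sin (real k * x))) * sin (real N * x)"
      by (rule LIMSEQ_le_const) (use fin in auto)
    then show "0 \<le> ((pi - x) / 2 - (\<Sum>k\<in>{1..<N}. c' k * sin (real k * x))) * sin (real N * x)"
      by (simp add: diff_divide_distrib)
  qed
qed

text \<open>Orthogonality of \<open>sin (k x)\<close> to the sign of \<open>sin (N x)\<close> on \<open>[0, \<pi>]\<close>: the left-hand side is, up to a factor,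
  the integral of their product, split at the zeros of \<open>sin (N x)\<close>.\<close>

lemma alternating_cos_differences:
  assumes "k \<in> {1..<N}"
  shows "(\<Sum>i<N. (-1) ^ i * (cos (real (Suc i) * (real k * pi / N)) - cos (real i * (real k * pi / N)))) = (0::real)"
proof -
  define \<theta> where "\<theta> = real k * pi / N"
  have "0 < \<theta>" "\<theta> < pi" using assms by (auto simp: \<theta>_def field_simps)
  then have c: "cos (\<theta> / 2) > 0" by (intro cos_gt_zero_pi) auto
  have "cos (\<theta>/2) * ((-1) ^ i * (cos (real (Suc i) * \<theta>) - cos (real i * \<theta>))) =
      - sin (\<theta>/2) * ((-1) ^ i * sin (real i * \<theta>) - (-1) ^ Suc i * sin (real (Suc i) * \<theta>))" for i
  proof -
    define p h where "p = real i * \<theta>" and "h = \<theta>/2"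
    have e: "real (Suc i) * \<theta> = p + 2 * h" by (simp add: p_def h_def algebra_simps)
    have s2: "sin (2 * h) = 2 * sin h * cos h" by (rule sin_double)
    have c2: "cos (2 * h) = 1 - 2 * sin h * sin h" using cos_double_sin[of h] by (simp add: power2_eq_square)
    have c3: "cos h * cos h = 1 - sin h * sin h" using sin_cos_squared_add[of h] by (simp add: power2_eq_square)
    have "cos h * (cos (p + 2 * h) - cos p) = - sin h * (sin p + sin (p + 2 * h))"
      unfolding cos_add sin_add s2 c2 using c3 by algebra
    then have "cos h * (w * (cos (p + 2 * h) - cos p)) = - sin h * (w * sin p - (- 1 * w) * sin (p + 2 * h))" for w
      by algebra
    then show ?thesis unfolding e p_def[symmetric] h_def[symmetric] power_Suc .
  qed
  then have "cos (\<theta>/2) * (\<Sum>i<N. (-1) ^ i * (cos (real (Suc i) * \<theta>) - cos (real i * \<theta>))) =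
      - sin (\<theta>/2) * (\<Sum>i<N. (-1) ^ i * sin (real i * \<theta>) - (-1) ^ Suc i * sin (real (Suc i) * \<theta>))"
    by (simp only: sum_distrib_left)
  also have "(\<Sum>i<N. (-1) ^ i * sin (real i * \<theta>) - (-1) ^ Suc i * sin (real (Suc i) * \<theta>))
      = - ((-1) ^ N * sin (real N * \<theta>))"
    using sum_lessThan_telescope'[of "\<lambda>i. (-1) ^ i * sin (real i * \<theta>)" N] by simp
  also have "real N * \<theta> = real k * pi" using assms by (simp add: \<theta>_def)
  finally show ?thesis using c by (simp add: \<theta>_def)
qed

lemma alternating_odd_sum: "(\<Sum>i<N. (-1) ^ i * (2 * real i + 1)) = - ((-1) ^ N * real N)"
  by (induction N) (auto simp: algebra_simps)

lemma alternating_sum: "(\<Sum>i<N. (-1) ^ i) = (1 - (-1) ^ N) / (2::real)"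
  by (induction N) (auto simp: field_simps)

text \<open>Given the sign pattern, the integral of the absolute error is the alternating sum of the integrals
  of the error over the intervals of length \<open>\<pi>/N\<close>. The sine terms drop out by orthogonality, and
  what is left depends on the sawtooth alone.\<close>

lemma sawtooth_L1:
  assumes N: "0 < N"
    and sgn: "\<And>x. 0 < x \<Longrightarrow> x < pi \<Longrightarrow>
      0 \<le> ((pi - x) / 2 - (\<Sum>k\<in>{1..<N}. c k * sin (real k * x))) * sin (real N * x)"
  shows "((\<lambda>x. \<bar>(pi - x) / 2 - (\<Sum>k\<in>{1..<N}. c k * sin (real k * x))\<bar>) has_integral pi\<^sup>2 / (4 * N)) {0..pi}"
proof -
  define e where "e x = (pi - x) / 2 - (\<Sum>k\<in>{1..<N}. c k * sin (real k * x))" for x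
  define E where "E x = pi * x / 2 - x\<^sup>2 / 4 + (\<Sum>k\<in>{1..<N}. c k / k * cos (real k * x))" for x
  define p where "p i = real i * pi / N" for i
  have dE: "(E has_real_derivative e x) (at x within S)" for x S
    unfolding E_def[abs_def] e_def
    by (auto intro!: derivative_eq_intros sum.cong simp: field_simps sum_negf)
  have piece: "((\<lambda>x. \<bar>e x\<bar>) has_integral (-1) ^ i * (E (p (Suc i)) - E (p i))) {p i..p (Suc i)}"
    if i: "i < N" for i
  proof -
    have le: "p i \<le> p (Suc i)" by (auto simp: p_def intro!: divide_right_mono)
    have "((\<lambda>x. (-1) ^ i * e x) has_integral (-1) ^ i * (E (p (Suc i)) - E (p i))) {p i..p (Suc i)}"
      by (intro has_integral_mult_right fundamental_theorem_of_calculus le)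
         (auto simp flip: has_real_derivative_iff_has_vector_derivative intro: dE)
    then show ?thesis
    proof (rule has_integral_spike_finite[of "{p i, p (Suc i)}", rotated 2])
      fix x assume "x \<in> {p i..p (Suc i)} - {p i, p (Suc i)}"
      then have x: "p i < x" "x < p (Suc i)" by auto
      define y where "y = real N * x - real i * pi"
      have y: "0 < y" "y < pi" using x N by (auto simp: p_def y_def field_simps)
      have "real N * x = y + real i * pi" by (simp add: y_def)
      then have s: "sin (real N * x) = (-1) ^ i * sin y" by (simp add: sin_add)
      have sy: "0 < sin y" using y by (rule sin_gt_zero)
      have "0 \<le> p i" by (simp add: p_def)
      moreover have "p (Suc i) \<le> pi"
      proof -
        have "real (Suc i) * pi \<le> real N * pi" using i by (intro mult_right_mono) auto
        then show ?thesis using N by (simp add: p_def field_simps)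
      qed
      ultimately have "0 < x" "x < pi" using x by auto
      then have "0 \<le> e x * ((-1) ^ i * sin y)" using sgn[of x] s by (simp add: e_def)
      then have "0 \<le> sin y * ((-1) ^ i * e x)" by (simp add: mult_ac)
      then have "0 \<le> (-1) ^ i * e x" using sy by (simp add: zero_le_mult_iff)
      moreover have "\<bar>(-1) ^ i * e x\<bar> = \<bar>e x\<bar>" by (simp add: abs_mult)
      ultimately show "\<bar>e x\<bar> = (-1) ^ i * e x" by linarith
    qed simp
  qed
  have "((\<lambda>x. \<bar>e x\<bar>) has_integral (\<Sum>i<j. (-1) ^ i * (E (p (Suc i)) - E (p i)))) {0..p j}" if "j \<le> N" for j
    using that
  proof (induction j)
    case 0
    then show ?case by (simp add: p_def has_integral_refl)
  next
    case (Suc j)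
    have "((\<lambda>x. \<bar>e x\<bar>) has_integral (\<Sum>i<j. (-1) ^ i * (E (p (Suc i)) - E (p i)))
        + (-1) ^ j * (E (p (Suc j)) - E (p j))) {0..p (Suc j)}"
      by (rule has_integral_combine[OF _ _ Suc.IH piece])
         (use Suc.prems in \<open>auto simp: p_def intro!: divide_right_mono\<close>)
    then show ?case by simp
  qed
  from this[of N] have I: "((\<lambda>x. \<bar>e x\<bar>) has_integral (\<Sum>i<N. (-1) ^ i * (E (p (Suc i)) - E (p i)))) {0..pi}"
    using N by (simp add: p_def)
  have "(\<Sum>i<N. (-1) ^ i * (E (p (Suc i)) - E (p i))) =
      (\<Sum>i<N. (-1) ^ i * (pi\<^sup>2 / (2 * N)) - pi\<^sup>2 / (4 * (real N)\<^sup>2) * ((-1) ^ i * (2 * real i + 1))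
        + (\<Sum>k\<in>{1..<N}. c k / k * ((-1) ^ i * (cos (real (Suc i) * (real k * pi / N)) - cos (real i * (real k * pi / N))))))"
  proof (rule sum.cong[OF refl])
    fix i
    have "E (p (Suc i)) - E (p i) = (pi * (p (Suc i) - p i) / 2 - ((p (Suc i))\<^sup>2 - (p i)\<^sup>2) / 4) +
      (\<Sum>k\<in>{1..<N}. c k / k * (cos (real k * p (Suc i)) - cos (real k * p i)))"
      by (simp add: E_def right_diff_distrib sum_subtractf) (simp add: field_simps)
    moreover have "p (Suc i) - p i = pi / N" using N by (simp add: p_def field_simps)
    moreover have "(p (Suc i))\<^sup>2 - (p i)\<^sup>2 = pi\<^sup>2 * (2 * real i + 1) / (real N)\<^sup>2"
      using N by (simp add: p_def power_divide power_mult_distrib power2_eq_square field_simps)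
    ultimately have "E (p (Suc i)) - E (p i) = pi\<^sup>2 / (2 * N) - pi\<^sup>2 / (4 * (real N)\<^sup>2) * (2 * real i + 1)
      + (\<Sum>k\<in>{1..<N}. c k / k * (cos (real (Suc i) * (real k * pi / N)) - cos (real i * (real k * pi / N))))"
      by (simp add: p_def power2_eq_square mult_ac)
    then show "(-1) ^ i * (E (p (Suc i)) - E (p i)) = (-1) ^ i * (pi\<^sup>2 / (2 * N)) - pi\<^sup>2 / (4 * (real N)\<^sup>2) * ((-1) ^ i * (2 * real i + 1))
        + (\<Sum>k\<in>{1..<N}. c k / k * ((-1) ^ i * (cos (real (Suc i) * (real k * pi / N)) - cos (real i * (real k * pi / N)))))"
      by (simp only: distrib_left right_diff_distrib sum_distrib_left) (simp only: mult_ac)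
  qed
  also have "\<dots> = (1 - (-1) ^ N) / 2 * (pi\<^sup>2 / (2 * N)) + pi\<^sup>2 / (4 * (real N)\<^sup>2) * ((-1) ^ N * real N) +
      (\<Sum>i<N. \<Sum>k\<in>{1..<N}. c k / k * ((-1) ^ i * (cos (real (Suc i) * (real k * pi / N)) - cos (real i * (real k * pi / N)))))"
    by (simp only: sum.distrib sum_subtractf sum_distrib_right[symmetric] sum_distrib_left[symmetric]
        alternating_sum alternating_odd_sum)
  also have "(\<Sum>i<N. \<Sum>k\<in>{1..<N}. c k / k * ((-1) ^ i * (cos (real (Suc i) * (real k * pi / N)) - cos (real i * (real k * pi / N)))))
    = (\<Sum>k\<in>{1..<N}. c k / k * (\<Sum>i<N. (-1) ^ i * (cos (real (Suc i) * (real k * pi / N)) - cos (real i * (real k * pi / N)))))"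
    by (subst sum.swap) (simp only: sum_distrib_left)
  also have "\<dots> = 0" by (intro sum.neutral ballI) (simp only: alternating_cos_differences mult_zero_right)
  also have "(1 - (-1) ^ N) / 2 * (pi\<^sup>2 / (2 * N)) + pi\<^sup>2 / (4 * (real N)\<^sup>2) * ((-1) ^ N * real N) + 0 = pi\<^sup>2 / (4 * N)"
    using N by (simp add: field_simps power2_eq_square)
  finally show ?thesis using I by (simp add: e_def[abs_def])
qed

section \<open>Jackson's theorem for algebraic polynomials\<close>

text \<open>The convolution of \<open>cos (m s)\<close> with a \<open>2 \<pi>\<close>-periodic function is a combination of \<open>cos (m x)\<close> and \<open>sin (m x)\<close>; for an
  even function the sine is absent. The coefficients are integrals of a periodic function over a full period ending at
  \<open>x + \<pi>\<close>, hence independent of \<open>x\<close>.\<close>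

lemma even_periodic_convolution_cos:
  fixes F :: "real \<Rightarrow> complex" and m :: nat
  assumes c: "continuous_on UNIV F" and per: "\<And>x. F (x + 2 * pi) = F x" and ev: "\<And>x. F (- x) = F x"
  obtains \<alpha> where "\<And>x. ((\<lambda>s. of_real (cos (real m * s)) * (F (x - s) + F (x + s))) has_integral
      \<alpha> * of_real (cos (real m * x))) {0..pi}"
proof -
  define P where "P = prim (\<lambda>s. of_real (cos (real m * s)) * F s)"
  define Q where "Q = prim (\<lambda>s. of_real (sin (real m * s)) * F s)"
  have dP: "(P has_vector_derivative of_real (cos (real m * s)) * F s) (at s within S)"
    and dQ: "(Q has_vector_derivative of_real (sin (real m * s)) * F s) (at s within S)" for s S
    unfolding P_def Q_def by (intro has_vector_derivative_prim continuous_intros c)+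
  have mpi: "real m * (x + pi) = real m * (x - pi) + 2 * real m * pi" for x
    by (simp add: algebra_simps)
  have pc: "cos (real m * (x + pi)) = cos (real m * (x - pi))"
    and ps: "sin (real m * (x + pi)) = sin (real m * (x - pi))" for x
    unfolding mpi by (simp_all only: cos_add sin_add cos_2npi sin_2npi)
  have pF: "F (x + pi) = F (x - pi)" for x using per[of "x - pi"] by (simp add: algebra_simps)
  have const: "G (x + pi) - G (x - pi) = G (0 + pi) - G (0 - pi)"
    if d: "\<And>s S. (G has_vector_derivative G' s) (at s within S)" and e: "\<And>x. G' (x + pi) = G' (x - pi)"
    for G G' :: "real \<Rightarrow> complex" and x
  proof -
    have "((\<lambda>x. G (pi + x) - G ((- pi) + x)) has_vector_derivative 0) (at x within UNIV)" for x
      using has_vector_derivative_diff[OF has_vector_derivative_shift(1)[of G G' pi x UNIV, OF d] has_vector_derivative_shift(1)[of G G' "- pi" x UNIV, OF d]] e[of x]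
      by (simp add: add.commute)
    then obtain z where "\<And>x. G (pi + x) - G ((- pi) + x) = z"
      using has_vector_derivative_zero_constant[of UNIV "\<lambda>x. G (pi + x) - G ((- pi) + x)"] by auto
    then have "G (pi + x) - G ((- pi) + x) = G (pi + 0) - G ((- pi) + 0)" by metis
    then show ?thesis by (simp add: add.commute)
  qed
  define \<alpha> where "\<alpha> = P pi - P (- pi)"
  have P: "P (x + pi) - P (x - pi) = \<alpha>" for x
    using const[of P, OF dP] pc pF by (simp add: \<alpha>_def)
  have Qe: "Q (- x) = Q x" for x by (simp add: Q_def prim_def ev)
  have Q: "Q (x + pi) - Q (x - pi) = 0" for x
    using const[of Q, OF dQ] ps pF Qe by simp
  have "((\<lambda>s. of_real (cos (real m * s)) * (F (x - s) + F (x + s))) has_integral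
      \<alpha> * of_real (cos (real m * x))) {0..pi}" for x
  proof -
    define W where "W s = of_real (cos (real m * x)) * (P (x + s) - P (x - s))
      + of_real (sin (real m * x)) * (Q (x + s) - Q (x - s))" for s
    have "((\<lambda>s. of_real (cos (real m * s)) * (F (x - s) + F (x + s))) has_integral W pi - W 0) {0..pi}"
    proof (rule fundamental_theorem_of_calculus)
      fix s
      have "(W has_vector_derivative
          of_real (cos (real m * x)) * (of_real (cos (real m * (x + s))) * F (x + s)
             - - (of_real (cos (real m * (x - s))) * F (x - s)))
        + of_real (sin (real m * x)) * (of_real (sin (real m * (x + s))) * F (x + s)
             - - (of_real (sin (real m * (x - s))) * F (x - s)))) (at s within {0..pi})"
        unfolding W_def[abs_def]
        by (intro has_vector_derivative_add has_vector_derivative_diff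
            has_vector_derivative_mult_right has_vector_derivative_shift[of P, OF dP] has_vector_derivative_shift[of Q, OF dQ])
      moreover have "of_real (cos (real m * x)) * (of_real (cos (real m * (x + s))) * F (x + s)
             - - (of_real (cos (real m * (x - s))) * F (x - s)))
        + of_real (sin (real m * x)) * (of_real (sin (real m * (x + s))) * F (x + s)
             - - (of_real (sin (real m * (x - s))) * F (x - s)))
        = of_real (cos (real m * s)) * (F (x - s) + F (x + s))"
      proof -
        define y z where "y = real m * x" and "z = real m * s"
        have "cos y * cos (y + z) + sin y * sin (y + z) = cos z"
          "cos y * cos (y - z) + sin y * sin (y - z) = cos z"
          using cos_diff[of "y + z" y] cos_diff[of y "y - z"] by (simp_all add: mult.commute)
        then have e: "complex_of_real (cos y) * of_real (cos (y + z)) + of_real (sin y) * of_real (sin (y + z)) = of_real (cos z)"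
          "complex_of_real (cos y) * of_real (cos (y - z)) + of_real (sin y) * of_real (sin (y - z)) = of_real (cos z)"
          by (metis of_real_add of_real_mult)+
        have eqs: "real m * (x + s) = y + z" "real m * (x - s) = y - z" by (simp_all add: y_def z_def algebra_simps)
        have comb: "cy * (c1 * A - - (c2 * B)) + sy * (s1 * A - - (s2 * B)) = cz * (B + A)"
          if "cy * c1 + sy * s1 = cz" "cy * c2 + sy * s2 = cz" for A B cy c1 c2 sy s1 s2 cz :: complex
        proof -
          have "cy * (c1 * A - - (c2 * B)) + sy * (s1 * A - - (s2 * B)) =
              (cy * c1 + sy * s1) * A + (cy * c2 + sy * s2) * B" by (simp add: algebra_simps)
          then show ?thesis unfolding that by (simp add: algebra_simps)
        qed
        show ?thesis unfolding eqs unfolding y_def[symmetric] z_def[symmetric] by (rule comb[OF e])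
      qed
      ultimately show "(W has_vector_derivative of_real (cos (real m * s)) * (F (x - s) + F (x + s))) (at s within {0..pi})"
        by simp
    qed simp
    moreover have "W pi - W 0 = \<alpha> * of_real (cos (real m * x))"
      using P Q by (simp add: W_def mult.commute)
    ultimately show ?thesis by simp
  qed
  then show thesis by (rule that)
qed

text \<open>Integrating \<open>e(s) (F'(x - s) - F'(x + s))\<close> by parts over \<open>[0, \<pi>]\<close>, where \<open>e\<close> is the sawtooth minus its sine polynomial, yields
  \<open>\<pi> F(x)\<close> minus a cosine polynomial of degree less than \<open>N\<close>. So the error of that polynomial is at most
  \<open>2 M / \<pi>\<close> times the mean error of the sawtooth.\<close>

lemma favard_even:
  fixes F F' :: "real \<Rightarrow> complex"
  assumes d: "\<And>x. (F has_vector_derivative F' x) (at x)" and c': "continuous_on UNIV F'"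
    and per: "\<And>x. F (x + 2 * pi) = F x" and ev: "\<And>x. F (- x) = F x"
    and bd: "\<And>x. norm (F' x) \<le> M" and N: "0 < N"
  obtains d where "\<And>x. norm (F x - (\<Sum>k<N. d k * of_real (cos (real k * x)))) \<le> M * pi / (2 * real N)"
proof -
  obtain c where sgn: "\<And>x. 0 < x \<Longrightarrow> x < pi \<Longrightarrow>
      0 \<le> ((pi - x) / 2 - (\<Sum>k\<in>{1..<N}. c k * sin (real k * x))) * sin (real N * x)"
    using sawtooth_interpolation[OF N] by blast
  define e where "e x = (pi - x) / 2 - (\<Sum>k\<in>{1..<N}. c k * sin (real k * x))" for x
  have L1: "((\<lambda>x. \<bar>e x\<bar>) has_integral pi\<^sup>2 / (4 * N)) {0..pi}"
    unfolding e_def using sawtooth_L1[OF N sgn] by simp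
  have cF: "continuous_on UNIV F" by (rule continuous_on_vector_derivative) (use d in simp)
  have "\<forall>m. \<exists>\<alpha>. \<forall>x. ((\<lambda>s. of_real (cos (real m * s)) * (F (x - s) + F (x + s))) has_integral
      \<alpha> * of_real (cos (real m * x))) {0..pi}"
  proof
    fix m
    obtain \<alpha> where "\<And>x. ((\<lambda>s. of_real (cos (real m * s)) * (F (x - s) + F (x + s))) has_integral
      \<alpha> * of_real (cos (real m * x))) {0..pi}"
      using even_periodic_convolution_cos[OF cF per ev, of m] by blast
    then show "\<exists>\<alpha>. \<forall>x. ((\<lambda>s. of_real (cos (real m * s)) * (F (x - s) + F (x + s))) has_integral
      \<alpha> * of_real (cos (real m * x))) {0..pi}" by blast
  qed
  from choice[OF this] obtain \<alpha> where
    \<alpha>: "\<And>m x. ((\<lambda>s. of_real (cos (real m * s)) * (F (x - s) + F (x + s))) has_integral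
      \<alpha> m * of_real (cos (real m * x))) {0..pi}" by blast
  have M0: "0 \<le> M" using bd[of 0] norm_ge_zero order_trans by blast
  note sh = has_vector_derivative_shift[of F F', OF d]
  define e' where "e' s = - 1 / 2 - (\<Sum>k\<in>{1..<N}. c k * (real k * cos (real k * s)))" for s
  have de: "((\<lambda>s. complex_of_real (e s)) has_vector_derivative of_real (e' s)) (at s within S)" for s S
  proof -
    have "(e has_real_derivative e' s) (at s within S)"
      unfolding e_def[abs_def] e'_def by (auto intro!: derivative_eq_intros sum.cong simp: mult_ac)
    then show ?thesis by (rule has_vector_derivative_of_real)
  qed
  define K where "K x = 1 / 2 * (\<alpha> 0 * of_real (cos (real 0 * x)))
     + (\<Sum>k\<in>{1..<N}. of_real (c k * real k) * (\<alpha> k * of_real (cos (real k * x))))" for x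
  have main: "((\<lambda>s. of_real (e s) * (F' (x - s) - F' (x + s))) has_integral (of_real pi * F x - K x)) {0..pi}" for x
  proof -
    have i1: "((\<lambda>s. of_real (e s) * (F' (x - s) - F' (x + s)) - of_real (e' s) * (F (x - s) + F (x + s))) has_integral
      (- (of_real (e pi) * (F (x - pi) + F (x + pi)))) - (- (of_real (e 0) * (F (x - 0) + F (x + 0))))) {0..pi}"
    proof (rule fundamental_theorem_of_calculus)
      fix s
      show "((\<lambda>s. - (of_real (e s) * (F (x - s) + F (x + s)))) has_vector_derivative
        of_real (e s) * (F' (x - s) - F' (x + s)) - of_real (e' s) * (F (x - s) + F (x + s))) (at s within {0..pi})"
        by (rule has_vector_derivative_eq_rhs[OF has_vector_derivative_minus[OF
              has_vector_derivative_mult[OF de has_vector_derivative_add[OF sh(2) sh(1)]]]])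
           (simp add: algebra_simps)
    qed simp
    have i2: "((\<lambda>s. - (1 / 2) * (of_real (cos (real 0 * s)) * (F (x - s) + F (x + s)))
       - (\<Sum>k\<in>{1..<N}. of_real (c k * real k) * (of_real (cos (real k * s)) * (F (x - s) + F (x + s)))))
       has_integral - (1 / 2) * (\<alpha> 0 * of_real (cos (real 0 * x)))
       - (\<Sum>k\<in>{1..<N}. of_real (c k * real k) * (\<alpha> k * of_real (cos (real k * x))))) {0..pi}"
      by (intro has_integral_diff has_integral_sum has_integral_mult_right \<alpha>) auto
    have e2: "- (1 / 2) * (of_real (cos (real 0 * s)) * (F (x - s) + F (x + s)))
       - (\<Sum>k\<in>{1..<N}. of_real (c k * real k) * (of_real (cos (real k * s)) * (F (x - s) + F (x + s))))
       = of_real (e' s) * (F (x - s) + F (x + s))" for s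
    proof -
      define G where "G = F (x - s) + F (x + s)"
      show ?thesis unfolding G_def[symmetric]
        by (simp add: e'_def left_diff_distrib right_diff_distrib sum_distrib_right sum_distrib_left mult_ac)
    qed
    have "e 0 = pi / 2" "e pi = 0" by (simp_all add: e_def sin_npi)
    with has_integral_add[OF i1 i2[unfolded e2]]
    show ?thesis by (simp add: K_def algebra_simps)
  qed
  define d where "d k = 1 / of_real pi * (if k = 0 then 1 / 2 * \<alpha> 0 else of_real (c k * real k) * \<alpha> k)" for k
  have K: "1 / of_real pi * K x = (\<Sum>k<N. d k * of_real (cos (real k * x)))" for x
  proof -
    have "{..<N} = insert 0 {1..<N}" using N by auto
    then have "(\<Sum>k<N. d k * of_real (cos (real k * x))) = d 0 + (\<Sum>k\<in>{1..<N}. d k * of_real (cos (real k * x)))"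
      by simp
    also have "(\<Sum>k\<in>{1..<N}. d k * of_real (cos (real k * x))) =
      1 / of_real pi * (\<Sum>k\<in>{1..<N}. of_real (c k * real k) * (\<alpha> k * of_real (cos (real k * x))))"
      unfolding sum_distrib_left by (rule sum.cong) (auto simp: d_def)
    finally show ?thesis by (simp add: K_def d_def distrib_left)
  qed
  have "norm (F x - (\<Sum>k<N. d k * of_real (cos (real k * x)))) \<le> M * pi / (2 * real N)" for x
  proof -
    have "norm (integral {0..pi} (\<lambda>s. of_real (e s) * (F' (x - s) - F' (x + s)))) \<le>
        integral {0..pi} (\<lambda>s. \<bar>e s\<bar> * (2 * M))"
    proof (rule integral_norm_bound_integral)
      show "(\<lambda>s. of_real (e s) * (F' (x - s) - F' (x + s))) integrable_on {0..pi}"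
        using main by (auto simp: integrable_on_def)
      show "(\<lambda>s. \<bar>e s\<bar> * (2 * M)) integrable_on {0..pi}"
        using has_integral_mult_left[OF L1] by (auto simp: integrable_on_def)
      fix s
      have "norm (F' (x - s) - F' (x + s)) \<le> 2 * M"
        using norm_triangle_ineq4[of "F' (x - s)" "F' (x + s)"] bd[of "x - s"] bd[of "x + s"] by linarith
      then show "norm (of_real (e s) * (F' (x - s) - F' (x + s))) \<le> \<bar>e s\<bar> * (2 * M)"
        by (simp add: norm_mult mult_left_mono)
    qed
    also have "\<dots> = pi\<^sup>2 / (4 * N) * (2 * M)"
      using has_integral_mult_left[OF L1, of "2 * M"] by (rule integral_unique)
    finally have b: "norm (of_real pi * F x - K x) \<le> pi\<^sup>2 / (4 * N) * (2 * M)"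
      using main[of x] by (simp add: integral_unique)
    have "F x - (\<Sum>k<N. d k * of_real (cos (real k * x))) = 1 / of_real pi * (of_real pi * F x - K x)"
      unfolding K[symmetric] by (simp add: right_diff_distrib)
    then have "norm (F x - (\<Sum>k<N. d k * of_real (cos (real k * x)))) = 1 / pi * norm (of_real pi * F x - K x)"
      by (simp add: norm_mult norm_divide)
    also have "\<dots> \<le> 1 / pi * (pi\<^sup>2 / (4 * N) * (2 * M))"
      using b by (intro mult_left_mono) auto
    also have "\<dots> = M * pi / (2 * real N)" by (simp add: power2_eq_square)
    finally show ?thesis .
  qed
  then show thesis by (rule that)
qed

text \<open>Chebyshev polynomials of the first kind, with complex coefficients because the approximated functions are complex.\<close>

fun chebyshev :: "nat \<Rightarrow> complex poly" where
  "chebyshev 0 = 1"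
| "chebyshev (Suc 0) = [:0, 1:]"
| "chebyshev (Suc (Suc k)) = [:0, 2:] * chebyshev (Suc k) - chebyshev k"

lemma poly_chebyshev: "poly (chebyshev k) (of_real (cos \<theta>)) = of_real (cos (real k * \<theta>))"
proof (induction k rule: chebyshev.induct)
  case (3 k)
  define y where "y = real (Suc k) * \<theta>"
  have "real (Suc (Suc k)) * \<theta> = y + \<theta>" "real k * \<theta> = y - \<theta>" by (simp_all add: y_def algebra_simps)
  then have "2 * cos \<theta> * cos y - cos (real k * \<theta>) = cos (real (Suc (Suc k)) * \<theta>)"
    by (simp add: cos_add cos_diff)
  then have "2 * complex_of_real (cos \<theta>) * of_real (cos y) - of_real (cos (real k * \<theta>)) = of_real (cos (real (Suc (Suc k)) * \<theta>))"
    by (metis of_real_diff of_real_mult of_real_numeral)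
  then show ?case using 3 by (simp add: y_def algebra_simps)
qed auto

lemma degree_chebyshev: "degree (chebyshev k) \<le> k"
proof (induction k rule: chebyshev.induct)
  case (3 k)
  have "degree ([:0, 2:] * chebyshev (Suc k)) \<le> Suc (Suc k)"
    using degree_mult_le[of "[:0, 2:]" "chebyshev (Suc k)"] 3(1) by simp
  then show ?case using 3(2) by (auto intro: degree_diff_le)
qed auto

text \<open>Under \<open>x = b cos \<theta>\<close> the function becomes even and periodic with derivative bounded by \<open>b M\<close>, and
  cosine polynomials become polynomials in \<open>x\<close>.\<close>

lemma jackson_first_order:
  fixes u u' :: "real \<Rightarrow> complex"
  assumes b: "0 < b" and d: "\<And>x. x \<in> {-b..b} \<Longrightarrow> (u has_vector_derivative u' x) (at x within {-b..b})"
    and c': "continuous_on {-b..b} u'" and bd: "\<And>x. x \<in> {-b..b} \<Longrightarrow> norm (u' x) \<le> M"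
  obtains p where "degree p \<le> n" "\<And>x. x \<in> {-b..b} \<Longrightarrow> norm (u x - poly p (of_real x)) \<le> pi * b / 2 / real (Suc n) * M"
proof -
  define F where "F \<theta> = u (b * cos \<theta>)" for \<theta>
  define F' where "F' \<theta> = (- b * sin \<theta>) *\<^sub>R u' (b * cos \<theta>)" for \<theta>
  have mem: "b * cos \<theta> \<in> {-b..b}" for \<theta>
    using mult_left_mono[OF cos_le_one[of \<theta>], of b] mult_left_mono[OF cos_ge_minus_one[of \<theta>], of b] b by simp
  have dF: "(F has_vector_derivative F' \<theta>) (at \<theta>)" for \<theta>
  proof -
    have "(u has_vector_derivative u' (b * cos \<theta>)) (at (b * cos \<theta>) within range (\<lambda>\<theta>. b * cos \<theta>))"
      by (rule has_vector_derivative_within_subset[OF d]) (use mem in auto)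
    then have "((u \<circ> (\<lambda>\<theta>. b * cos \<theta>)) has_vector_derivative F' \<theta>) (at \<theta> within UNIV)"
      unfolding F'_def
      by (intro vector_diff_chain_within)
         (auto intro!: derivative_eq_intros simp flip: has_real_derivative_iff_has_vector_derivative)
    then show ?thesis by (simp add: F_def[abs_def] o_def)
  qed
  have cF': "continuous_on UNIV F'"
    unfolding F'_def[abs_def] by (intro continuous_intros continuous_on_compose2[OF c']) (use mem in auto)
  have bF': "norm (F' \<theta>) \<le> b * M" for \<theta>
  proof -
    have "norm (F' \<theta>) = b * (\<bar>sin \<theta>\<bar> * norm (u' (b * cos \<theta>)))" using b by (simp add: F'_def abs_mult)
    also have "\<dots> \<le> b * (1 * M)"
      using b bd[OF mem] order_trans[OF norm_ge_zero bd[OF mem]]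
      by (intro mult_left_mono mult_mono) auto
    finally show ?thesis by simp
  qed
  obtain a where a: "\<And>x. norm (F x - (\<Sum>k<Suc n. a k * of_real (cos (real k * x)))) \<le> b * M * pi / (2 * real (Suc n))"
    using favard_even[OF dF cF' _ _ bF', of "Suc n"] by (auto simp: F_def)
  define p where "p = pcompose (\<Sum>k<Suc n. smult (a k) (chebyshev k)) [:0, 1 / of_real b:]"
  have "degree (\<Sum>k<Suc n. smult (a k) (chebyshev k)) \<le> n"
    by (rule degree_sum_le) (auto intro: order_trans[OF degree_smult_le] order_trans[OF degree_chebyshev])
  then have dp: "degree p \<le> n * 1"
    unfolding p_def by (intro order_trans[OF degree_pcompose_le] mult_mono) auto
  have ap: "norm (u x - poly p (of_real x)) \<le> pi * b / 2 / real (Suc n) * M" if x: "x \<in> {-b..b}" for x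
  proof -
    define \<theta> where "\<theta> = arccos (x / b)"
    have "-1 \<le> x / b" "x / b \<le> 1" using x b by (auto simp: field_simps)
    then have \<theta>: "cos \<theta> = x / b" by (simp add: \<theta>_def cos_arccos)
    have "poly p (of_real x) = (\<Sum>k<Suc n. a k * of_real (cos (real k * \<theta>)))"
      unfolding poly_chebyshev[symmetric] \<theta> by (simp add: p_def poly_pcompose poly_sum)
    moreover have "u x = F \<theta>" using b by (simp add: F_def \<theta>)
    ultimately show ?thesis using a[of \<theta>] by (simp add: mult_ac)
  qed
  show thesis using dp ap by (intro that[of p]) simp_all
qed

text \<open>Apply the first order estimate to \<open>u\<close> minus a primitive of \<open>p\<close>, whose derivative is bounded by \<open>\<delta>\<close>.\<close>

lemma jackson_step:
  fixes u u' :: "real \<Rightarrow> complex"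
  assumes b: "0 < b" and d: "\<And>x. x \<in> {-b..b} \<Longrightarrow> (u has_vector_derivative u' x) (at x within {-b..b})"
    and c': "continuous_on {-b..b} u'"
    and p: "degree p \<le> n" "\<And>x. x \<in> {-b..b} \<Longrightarrow> norm (u' x - poly p (of_real x)) \<le> \<delta>"
  obtains P where "degree P \<le> Suc n"
    "\<And>x. x \<in> {-b..b} \<Longrightarrow> norm (u x - poly P (of_real x)) \<le> pi * b / 2 / real (Suc (Suc n)) * \<delta>"
proof -
  define P0 where "P0 = (\<Sum>i\<le>n. monom (coeff p i / of_nat (Suc i)) (Suc i))"
  have dP0: "degree P0 \<le> Suc n" unfolding P0_def
  proof (rule degree_sum_le)
    fix i assume "i \<in> {..n}"
    then show "degree (monom (coeff p i / of_nat (Suc i)) (Suc i)) \<le> Suc n"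
      using degree_monom_le[of "coeff p i / of_nat (Suc i)" "Suc i"] by simp
  qed simp
  have pd: "pderiv P0 = p"
    using p(1) by (simp add: P0_def higher_pderiv_sum[of 1, simplified] pderiv_monom poly_as_sum_of_monoms' del: of_nat_Suc)
  have dP: "((\<lambda>x. poly P0 (of_real x)) has_vector_derivative poly p (of_real x)) (at x within S)" for x S
    using field_vector_diff_chain_within[OF has_vector_derivative_of_real[OF DERIV_ident]
      has_field_derivative_at_within[OF poly_DERIV[of P0 "of_real x"]], of S]
    by (simp add: o_def pd)
  have cp: "continuous_on S (\<lambda>x. poly p (complex_of_real x))" for S by (intro continuous_intros)
  obtain q where q: "degree q \<le> Suc n" "\<And>x. x \<in> {-b..b} \<Longrightarrow>
      norm ((u x - poly P0 (of_real x)) - poly q (of_real x)) \<le> pi * b / 2 / real (Suc (Suc n)) * \<delta>"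
    by (rule jackson_first_order[OF b, of "\<lambda>x. u x - poly P0 (of_real x)" "\<lambda>x. u' x - poly p (of_real x)" \<delta> "Suc n"])
       (use p(2) in \<open>auto intro!: has_vector_derivative_diff d dP continuous_on_diff c' cp\<close>)
  show thesis
  proof (rule that)
    show "degree (P0 + q) \<le> Suc n" using dP0 q(1) by (rule degree_add_le)
    fix x assume "x \<in> {-b..b}"
    from q(2)[OF this] show "norm (u x - poly (P0 + q) (of_real x)) \<le> pi * b / 2 / real (Suc (Suc n)) * \<delta>"
      by (simp add: algebra_simps)
  qed
qed

text \<open>The approximation of the \<open>k\<close>-th derivative is left open. With \<open>p = 0\<close> one gets the explicit estimate, with
  an approximation by the theorem of Weierstrass the \<open>o(1)\<close>.\<close>

lemma jackson_higher_order:
  fixes u :: "nat \<Rightarrow> real \<Rightarrow> complex"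
  assumes b: "0 < b"
    and d: "\<And>j x. j < k \<Longrightarrow> x \<in> {-b..b} \<Longrightarrow> (u j has_vector_derivative u (Suc j) x) (at x within {-b..b})"
    and c: "\<And>j. j \<le> k \<Longrightarrow> continuous_on {-b..b} (u j)"
    and p: "degree p \<le> m" "\<And>x. x \<in> {-b..b} \<Longrightarrow> norm (u k x - poly p (of_real x)) \<le> \<delta>"
  shows "\<exists>P. degree P \<le> m + k \<and> (\<forall>x\<in>{-b..b}. norm (u 0 x - poly P (of_real x)) \<le>
     (pi * b / 2) ^ k / (\<Prod>j<k. real (m + k + 1) - real j) * \<delta>)"
  using d c p(2)
proof (induction k arbitrary: u)
  case 0
  then show ?case using p(1) by auto
next
  case (Suc k)
  obtain P where P: "degree P \<le> m + k" "\<And>x. x \<in> {-b..b} \<Longrightarrow> norm (u 1 x - poly P (of_real x)) \<le>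
     (pi * b / 2) ^ k / (\<Prod>j<k. real (m + k + 1) - real j) * \<delta>"
    using Suc.IH[of "\<lambda>j. u (Suc j)"] Suc.prems by auto
  obtain Q where Q: "degree Q \<le> Suc (m + k)" "\<And>x. x \<in> {-b..b} \<Longrightarrow> norm (u 0 x - poly Q (of_real x)) \<le>
     pi * b / 2 / real (Suc (Suc (m + k))) * ((pi * b / 2) ^ k / (\<Prod>j<k. real (m + k + 1) - real j) * \<delta>)"
    using jackson_step[OF b _ _ P, of "u 0"] Suc.prems(1)[of 0] Suc.prems(2)[of 1] by auto
  have "(\<Prod>j<Suc k. real (m + Suc k + 1) - real j) = real (Suc (Suc (m + k))) * (\<Prod>j<k. real (m + k + 1) - real j)"
    by (simp only: prod.lessThan_Suc_shift) (simp add: algebra_simps)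
  then have "pi * b / 2 / real (Suc (Suc (m + k))) * ((pi * b / 2) ^ k / (\<Prod>j<k. real (m + k + 1) - real j) * \<delta>)
      = (pi * b / 2) ^ Suc k / (\<Prod>j<Suc k. real (m + Suc k + 1) - real j) * \<delta>"
    by (simp only: power_Suc) (simp only: times_divide_times_eq[symmetric] mult.assoc)
  then show ?case using Q by (intro exI[of _ Q]) simp
qed

lemma weierstrass_complex:
  fixes u :: "real \<Rightarrow> complex"
  assumes c: "continuous_on {-b..b} u" and e: "0 < \<epsilon>"
  obtains p where "\<And>x. x \<in> {-b..b} \<Longrightarrow> norm (u x - poly p (of_real x)) \<le> \<epsilon>"
proof -
  have r: "\<exists>p. \<forall>x\<in>{-b..b}. \<bar>v x - poly p x\<bar> < \<epsilon> / 2"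
    if v: "continuous_on {-b..b} v" for v :: "real \<Rightarrow> real"
  proof -
    obtain g where g: "polynomial_function g" "\<And>x. x \<in> {-b..b} \<Longrightarrow> norm (v x - g x) < \<epsilon> / 2"
      using Stone_Weierstrass_polynomial_function[OF compact_Icc v, of "\<epsilon> / 2"] e by auto
    then obtain a n where a: "g = (\<lambda>x. \<Sum>i\<le>n. a i * x ^ i)"
      using real_polynomial_function_imp_sum real_polynomial_function_eq by metis
    have "poly (\<Sum>i\<le>n. monom (a i) i) x = g x" for x by (simp add: a poly_sum poly_monom)
    then show ?thesis using g(2) by (metis real_norm_def)
  qed
  have "continuous_on {-b..b} (\<lambda>x. Re (u x))" "continuous_on {-b..b} (\<lambda>x. Im (u x))"
    by (intro continuous_intros c)+
  from this[THEN r] obtain p1 p2 where p: "\<And>x. x \<in> {-b..b} \<Longrightarrow> \<bar>Re (u x) - poly p1 x\<bar> < \<epsilon> / 2"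
    "\<And>x. x \<in> {-b..b} \<Longrightarrow> \<bar>Im (u x) - poly p2 x\<bar> < \<epsilon> / 2"
    by blast
  have o: "poly (map_poly of_real q) (of_real x) = complex_of_real (poly q x)" for q x
    by (induction q) (auto simp: map_poly_pCons)
  show thesis
  proof (rule that[of "map_poly of_real p1 + smult \<i> (map_poly of_real p2)"])
    fix x assume x: "x \<in> {-b..b}"
    have "norm (u x - poly (map_poly of_real p1 + smult \<i> (map_poly of_real p2)) (of_real x)) \<le>
      \<bar>Re (u x) - poly p1 x\<bar> + \<bar>Im (u x) - poly p2 x\<bar>"
      by (rule order_trans[OF cmod_le]) (simp add: o)
    then show "norm (u x - poly (map_poly of_real p1 + smult \<i> (map_poly of_real p2)) (of_real x)) \<le> \<epsilon>"
      using p[OF x] by linarith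
  qed
qed

section \<open>The estimate for systems of formal powers\<close>

text \<open>The Riccati equation \<open>a' = q - a\<^sup>2\<close> for \<open>a = f'/f\<close>. Continuing \<open>a'\<close> by constants outside \<open>[-b,b]\<close> gives the
  extension of \<open>a\<close> to a \<open>C\<^sup>1\<close> function on the line.\<close>

lemma C2_on_nonvanishing_log_derivative:
  assumes b: "0 < b" and q: "continuous_on {-b..b} q" and f: "C2_on b f"
    and ode: "\<And>x. x \<in> {-b..b} \<Longrightarrow> D_on b (D_on b f) x - q x * f x = 0"
    and nz: "\<And>x. x \<in> {-b..b} \<Longrightarrow> f x \<noteq> 0"
  obtains a a' where "\<And>x. (a has_vector_derivative a' x) (at x)" "continuous_on UNIV a'"
    "\<And>x. x \<in> {-b..b} \<Longrightarrow> a x = D_on b f x / f x"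
    "\<And>x. x \<in> {-b..b} \<Longrightarrow> q x = a' x + (a x)\<^sup>2"
    "\<And>x. x \<in> {-b..b} \<Longrightarrow> (f has_vector_derivative a x * f x) (at x within {-b..b})"
proof -
  have df: "(f has_vector_derivative D_on b f x) (at x within {-b..b})"
    and ddf: "(D_on b f has_vector_derivative q x * f x) (at x within {-b..b})" if x: "x \<in> {-b..b}" for x
  proof -
    show "(f has_vector_derivative D_on b f x) (at x within {-b..b})"
      using f x unfolding C2_on_def differentiable_on_def D_on_def vector_derivative_works by blast
    have "(D_on b f has_vector_derivative D_on b (D_on b f) x) (at x within {-b..b})"
      using f x unfolding C2_on_def differentiable_on_def D_on_def[of b "D_on b f"] vector_derivative_works by blast
    then show "(D_on b f has_vector_derivative q x * f x) (at x within {-b..b})"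
      using ode[OF x] by simp
  qed
  define c where "c x = D_on b f x * inverse (f x)" for x
  define c' where "c' x = q x - (c x)\<^sup>2" for x
  have dc: "(c has_vector_derivative c' x) (at x within {-b..b})" if x: "x \<in> {-b..b}" for x
  proof -
    have "(inverse has_field_derivative - (inverse (f x) ^ Suc (Suc 0))) (at (f x) within f ` {-b..b})"
      by (rule DERIV_inverse[OF nz[OF x]])
    from field_vector_diff_chain_within[OF df[OF x] this]
    have "((\<lambda>x. inverse (f x)) has_vector_derivative D_on b f x * - (inverse (f x) ^ Suc (Suc 0))) (at x within {-b..b})"
      by (simp add: o_def)
    from has_vector_derivative_mult[OF ddf[OF x] this]
    show ?thesis unfolding c_def
      by (rule has_vector_derivative_eq_rhs) (use nz[OF x] in \<open>simp add: c'_def c_def power2_eq_square field_simps\<close>)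
  qed
  have cc: "continuous_on {-b..b} c" by (rule continuous_on_vector_derivative[OF dc])
  have cc': "continuous_on {-b..b} c'" unfolding c'_def by (intro continuous_intros q cc)
  define a' where "a' x = c' (clip b x)" for x
  define a where "a x = c 0 + prim a' x" for x
  have ca': "continuous_on UNIV a'" unfolding a'_def by (rule continuous_on_clip_compose[OF b cc'])
  have da: "(a has_vector_derivative a' x) (at x)" for x
    unfolding a_def[abs_def]
    using has_vector_derivative_add[OF has_vector_derivative_const has_vector_derivative_prim[OF ca']] by simp
  have ac: "a x = c x" if x: "x \<in> {-b..b}" for x
  proof -
    have seg: "closed_segment 0 x \<subseteq> {-b..b}" using x b by (simp add: closed_segment_subset)
    have "c x - c 0 = prim a' x"
    proof (rule prim_FTC[OF _ ca'])
      fix s assume "s \<in> closed_segment 0 x"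
      then have s: "s \<in> {-b..b}" using seg by blast
      show "(c has_vector_derivative a' s) (at s within closed_segment 0 x)"
        using has_vector_derivative_within_subset[OF dc[OF s] seg] s by (simp add: a'_def)
    qed
    then show ?thesis by (simp add: a_def algebra_simps)
  qed
  show thesis
  proof (rule that[OF da ca'])
    fix x assume x: "x \<in> {-b..b}"
    show "a x = D_on b f x / f x" by (simp add: ac[OF x] c_def divide_inverse)
    show "q x = a' x + (a x)\<^sup>2" using x by (simp add: ac[OF x] a'_def c'_def)
    show "(f has_vector_derivative a x * f x) (at x within {-b..b})"
      using df[OF x] nz[OF x] by (simp add: ac[OF x] c_def mult.assoc)
  qed
qed

lemma prod_descending_ge:
  assumes "2 * k \<le> n"
  shows "(real n / 2) ^ k \<le> (\<Prod>j<k. real (n + 1) - real j)"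
proof -
  have "(real n / 2) ^ k = (\<Prod>j<k. real n / 2)" by simp
  also have "\<dots> \<le> (\<Prod>j<k. real (n + 1) - real j)"
  proof (rule prod_mono)
    fix j assume "j \<in> {..<k}"
    then have "2 * real j \<le> real n" using assms by auto
    then show "0 \<le> real n / 2 \<and> real n / 2 \<le> real (n + 1) - real j" by simp
  qed
  finally show ?thesis .
qed

theorem theorem29:
  fixes b :: real and q f g :: "real \<Rightarrow> complex" and k :: nat
  assumes "0 < b"
    and "continuous_on {-b..b} q"
    and "C2_on b f"
    and "\<And>x. x \<in> {-b..b} \<Longrightarrow> D_on b (D_on b f) x - q x * f x = 0"
    and "\<And>x. x \<in> {-b..b} \<Longrightarrow> f x \<noteq> 0"
    and "f 0 = 1"
    and "1 \<le> k"
    and "has_continuous_f_derivs b f k g"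
  shows "(\<forall>n\<ge>k. best_approx b f n g \<le>
            (pi * b / 2) ^ k * opnorm b (T_op b q f) *
              max (opnorm b (op_inv b (T_op b q f))) (opnorm b (op_inv b (T_D_op b q f)))
            / (\<Prod>j<k. real (n + 1) - real j) * unorm b (f_deriv b f k g)) \<and>
         (\<lambda>n. best_approx b f n g) \<in> o(\<lambda>n. 1 / real n ^ k)"
proof -
  obtain a a' where da: "\<And>x. (a has_vector_derivative a' x) (at x)" and ca': "continuous_on UNIV a'"
    and a: "\<And>x. x \<in> {-b..b} \<Longrightarrow> a x = D_on b f x / f x"
    and qa: "\<And>x. x \<in> {-b..b} \<Longrightarrow> q x = a' x + (a x)\<^sup>2"
    and df: "\<And>x. x \<in> {-b..b} \<Longrightarrow> (f has_vector_derivative a x * f x) (at x within {-b..b})"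
    using C2_on_nonvanishing_log_derivative[OF assms(1-5)] by metis
  obtain S D Sv Dv where "first_order_goursat b a a' S D Sv Dv"
    using first_order_goursat_exists[OF assms(1) da ca'] by metis
  then interpret transmutation b a a' S D Sv Dv f q
    by (intro transmutation.intro transmutation_axioms.intro qa df assms(5,6))
  define qD where "qD = (\<lambda>x. - q x + 2 * (D_on b f x / f x)\<^sup>2)"
  have qD: "qD x = - a' x + (a x)\<^sup>2" if "x \<in> I" for x
    using qa[OF that] a[OF that] by (simp add: qD_def)
  interpret R: transmutation b "\<lambda>x. - a x" "\<lambda>x. - a' x" S "\<lambda>u v. - D u v" Sv "\<lambda>u v. - Dv u v"
    "\<lambda>x. inverse (f x)" qD
    by (rule reflect_transmutation[OF qD])
  have a0: "a 0 = D_on b f 0" using a[OF I0] assms(6) by simp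
  have Op: "Op = T_op b q f" unfolding Op_def T_op_def a0 ..
  have ROp: "R.Op = T_D_op b q f" unfolding R.Op_def unfolding T_D_op_def a0 qD_def ..
  define d where "d j = f_deriv b f j g" for j
  have cd: "continuous_on I (d j)" if "j \<le> k" for j
    using assms(8) that by (simp add: has_continuous_f_derivs_def d_def)
  have dd: "((\<lambda>s. f s powi ((- 1) ^ Suc j) * d j s) has_vector_derivative
      d (Suc j) x * f x powi ((- 1) ^ Suc j)) (at x within I)" if j: "j < k" and x: "x \<in> I" for j x
  proof -
    have "(\<lambda>s. f s powi ((- 1) ^ Suc j) * d j s) differentiable (at x within I)"
      using assms(8) j x unfolding has_continuous_f_derivs_def differentiable_on_def d_def by blast
    then have "((\<lambda>s. f s powi ((- 1) ^ Suc j) * d j s) has_vector_derivative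
        D_on b (\<lambda>s. f s powi ((- 1) ^ Suc j) * d j s) x) (at x within I)"
      unfolding vector_derivative_works D_on_def .
    moreover have "d (Suc j) x * f x powi ((- 1) ^ Suc j) = D_on b (\<lambda>s. f s powi ((- 1) ^ Suc j) * d j s) x"
    proof -
      have "f x powi ((- 1) ^ j) * f x powi ((- 1) ^ Suc j) = 1"
        using F_nz[OF x] by (simp add: power_int_minus)
      then show ?thesis by (simp add: d_def mult_ac)
    qed
    ultimately show ?thesis by simp
  qed
  \<comment> \<open>The successive derivatives of \<open>T^{-1} g\<close>.\<close>
  define U where "U j = op_inv b (if even j then Op else R.Op) (restrict (d j) I)" for j
  have dU: "(U j has_vector_derivative U (Suc j) x) (at x within I)" if j: "j < k" and x: "x \<in> I" for j x
  proof (cases "even j")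
    case True
    have "((\<lambda>x. d j x * inverse (f x)) has_vector_derivative d (Suc j) y * inverse (f y)) (at y within I)"
      if "y \<in> I" for y
      using dd[OF j that] True by (simp add: power_int_minus mult.commute)
    from op_inv_has_vector_derivative[OF qD cd cd this x] j True
    show ?thesis by (simp add: U_def R.Op_def)
  next
    case False
    have "((\<lambda>x. d j x * inverse (inverse (f x))) has_vector_derivative d (Suc j) y * inverse (inverse (f y))) (at y within I)"
      if "y \<in> I" for y
      using dd[OF j that] False by (simp add: mult.commute)
    moreover have "q y = - (- a' y) + (- a y)\<^sup>2" if "y \<in> I" for y using qa[OF that] by simp
    ultimately show ?thesis
      using R.op_inv_has_vector_derivative[of q "d j" "d (Suc j)" x] cd j False x
      by (simp add: U_def Op_def)
  qed
  have U: "U j \<in> C_space b" if "j \<le> k" for j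
    using op_inv_Op(1)[OF C_space_restrict[OF cd[OF that]]] R.op_inv_Op(1)[OF C_space_restrict[OF cd[OF that]]]
    by (simp add: U_def)
  have cU: "continuous_on I (U j)" if "j \<le> k" for j using U[OF that] by (simp add: C_space_def)
  define B where "B = opnorm b Op"
  define Mx where "Mx = max (opnorm b (op_inv b Op)) (opnorm b (op_inv b R.Op))"
  have B0: "0 \<le> B" unfolding B_def by (rule opnorm_Op(3))
  have nU: "unorm b (U k) \<le> Mx * unorm b (d k)"
  proof -
    have dk: "restrict (d k) I \<in> C_space b" by (rule C_space_restrict[OF cd]) simp
    have "unorm b (U k) \<le> Mx * unorm b (restrict (d k) I)"
    proof (cases "even k")
      case True
      have "unorm b (U k) \<le> opnorm b (op_inv b Op) * unorm b (restrict (d k) I)"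
        using opnorm_Op(2)[OF dk] True by (simp add: U_def)
      also have "\<dots> \<le> Mx * unorm b (restrict (d k) I)"
        using dk by (intro mult_right_mono unorm_nonneg b) (auto simp: Mx_def C_space_def)
      finally show ?thesis .
    next
      case False
      have "unorm b (U k) \<le> opnorm b (op_inv b R.Op) * unorm b (restrict (d k) I)"
        using R.opnorm_Op(2)[OF dk] False by (simp add: U_def)
      also have "\<dots> \<le> Mx * unorm b (restrict (d k) I)"
        using dk by (intro mult_right_mono unorm_nonneg b) (auto simp: Mx_def C_space_def)
      finally show ?thesis .
    qed
    also have "unorm b (restrict (d k) I) = unorm b (d k)" by (rule unorm_cong) simp
    finally show ?thesis .
  qed
  have cg: "continuous_on I g" using cd[of 0] by (simp add: d_def)
  have U0: "U 0 = op_inv b Op (restrict g I)" by (simp add: U_def d_def)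
  define P where "P n = (\<Prod>j<k. real (n + 1) - real j)" for n
  have main: "best_approx b f n g \<le> B * ((pi * b / 2) ^ k / P n * \<delta>)"
    if n: "degree p + k \<le> n" and bd: "\<And>x. x \<in> I \<Longrightarrow> norm (U k x - poly p (of_real x)) \<le> \<delta>" for n p \<delta>
  proof -
    define m where "m = n - k"
    have m: "m + k = n" "degree p \<le> m" using n by (auto simp: m_def)
    obtain p' where p': "degree p' \<le> n" "\<And>x. x \<in> I \<Longrightarrow> norm (U 0 x - poly p' (of_real x)) \<le> (pi * b / 2) ^ k / P n * \<delta>"
      using jackson_higher_order[of b k U, OF b dU cU m(2) bd] unfolding m(1) P_def by blast
    show ?thesis unfolding B_def
      by (rule best_approx_le[OF cg p'(1)]) (use p'(2) U0 in simp)
  qed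
  have "best_approx b f n g \<le> (pi * b / 2) ^ k * B * Mx / P n * unorm b (d k)" if n: "k \<le> n" for n
  proof -
    have "0 \<le> P n" unfolding P_def using n by (intro prod_nonneg) auto
    then have c0: "0 \<le> B * ((pi * b / 2) ^ k / P n)" using B0 b by simp
    have "best_approx b f n g \<le> B * ((pi * b / 2) ^ k / P n * unorm b (U k))"
      by (rule main[of 0]) (use n unorm_upper[OF cU] in auto)
    also have "\<dots> \<le> B * ((pi * b / 2) ^ k / P n) * (Mx * unorm b (d k))"
      using mult_left_mono[OF nU c0] by (simp add: mult.assoc)
    finally show ?thesis by (simp add: mult_ac)
  qed
  moreover have "(\<lambda>n. best_approx b f n g) \<in> o(\<lambda>n. 1 / real n ^ k)"
  proof (rule landau_o.smallI)
    fix c :: real assume c: "0 < c"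
    define C where "C = (pi * b / 2) ^ k"
    have C: "0 < C" using b by (simp add: C_def)
    \<comment> \<open>The factor \<open>2 ^ k\<close> accounts for \<open>(n / 2) ^ k\<close> as a lower bound of the descending product,
        and \<open>B + 1\<close> replaces \<open>B\<close> only to have a positive divisor.\<close>
    define \<epsilon> where "\<epsilon> = c / (2 ^ k * C * (B + 1))"
    have \<epsilon>: "0 < \<epsilon>" using c C B0 by (simp add: \<epsilon>_def)
    obtain p where p: "\<And>x. x \<in> I \<Longrightarrow> norm (U k x - poly p (of_real x)) \<le> \<epsilon>"
      using weierstrass_complex[OF cU[OF order_refl] \<epsilon>] by metis
    have "norm (best_approx b f n g) \<le> c * norm (1 / real n ^ k)" if n: "max (degree p + k) (2 * k + 1) \<le> n" for n
    proof -
      obtain h where h: "h \<in> Phi f n" "best_approx b f n g = unorm b (\<lambda>x. g x - h x)"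
        using best_approx_attained[OF b continuous_on_F F_nz cg, of n] by blast
      have "continuous_on I h" using h(1) unfolding Phi_def
        by (auto intro!: continuous_intros continuous_on_phi b continuous_on_F F_nz)
      then have nn: "0 \<le> best_approx b f n g" unfolding h(2) by (intro unorm_nonneg b continuous_intros cg)
      have n0: "0 < (real n / 2) ^ k" using n by simp
      have "best_approx b f n g \<le> B * (C / P n * \<epsilon>)"
        unfolding C_def by (rule main[OF _ p]) (use n in simp)
      also have "\<dots> \<le> (B + 1) * (C / (real n / 2) ^ k * \<epsilon>)"
      proof (rule mult_mono)
        have "(real n / 2) ^ k \<le> P n" unfolding P_def using n by (intro prod_descending_ge) simp
        then show "C / P n * \<epsilon> \<le> C / (real n / 2) ^ k * \<epsilon>" "0 \<le> C / P n * \<epsilon>"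
          using n0 C \<epsilon> by (auto intro!: mult_right_mono divide_left_mono mult_nonneg_nonneg divide_nonneg_nonneg)
      qed (use B0 in auto)
      also have "\<dots> = c * (1 / real n ^ k)"
      proof -
        have "z * (C / (N / Y) * (c / (Y * C * z))) = c * (1 / N)" if "0 < z" "0 < Y" "0 < N" for z Y N :: real
          using that C by (simp add: field_simps)
        from this[of "B + 1" "2 ^ k" "real n ^ k"] show ?thesis
          using B0 n by (simp add: \<epsilon>_def power_divide)
      qed
      finally show ?thesis using nn by simp
    qed
    then show "\<forall>\<^sub>F n in sequentially. norm (best_approx b f n g) \<le> c * norm (1 / real n ^ k)"
      unfolding eventually_sequentially by blast
  qed
  ultimately show ?thesis unfolding B_def Mx_def P_def d_def Op ROp by blast
qed

end
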